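(* Let $K\ge 1$, let $P=(p_{kl})$ be a substochastic $K\times K$ matrix with spectral radius less than $1$, let $\lambda_k>0$, $\mu_k>0$ ($k=1,\dots,K$), let $\nu=(I-P^T)^{-1}\lambda$, $\rho_k=\nu_k/\mu_k$, and assume $\rho_k<1$ for all $k$. Let $r\in\mathbb R_+^K$, $r\ne0$. Then the optimal trajectory from $0$ to $r$, that is, the function $q^\ast$ on $[0,T^\ast]$ minimizing $\int_0^T L(q(t),\dot q(t))\,dt$ over all $T\ge0$ and all absolutely continuous $q:[0,T]\to\mathbb R_+^K$ with $q(0)=0$, $q(T)=r$, exists, is unique up to the time spent at the origin (take $q^\ast(t)\neq0$ for $0<t\le T^\ast$), and consists of finitely many line segments lying in faces $F_J$ with sets $J$ decreasing with respect to inclusion, except possibly for the terminal point: there are $n\ge1$, times $0=t_0<t_1<\dots<t_n=T^\ast$ and sets $J_1\supsetneq J_2\supsetneq\dots\supsetneq J_n$ such that, for each $i$, $q^\ast$ is affine on $[t_{i-1},t_i]$ and $q^\ast(t)\in F_{J_i}$ for $t_{i-1}<t<t_i$. In particular, each face contains at most one segment.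
   Context: Substochastic: nonnegative entries, row sums at most $1$. $\lambda=(\lambda_1,\dots,\lambda_K)^T$. For $J\subset\{1,\dots,K\}$, $J^c$ is its complement and $F_J=\{x\in\mathbb R^K: x_i=0 \text{ for } i\in J,\ x_i>0\text{ for } i\notin J\}$; these faces partition $\mathbb R_+^K$. For $\theta\in\mathbb R^K$, $h_k(\theta)=e^{-\theta_k}\bigl(\sum_{l=1}^K(e^{\theta_l}-1)p_{kl}+1\bigr)-1$ and, with $u^+=\max(u,0)$, $$H_J(\theta)=\sum_{k=1}^K(e^{\theta_k}-1)\lambda_k+\sum_{k\in J}h_k(\theta)^+\mu_k+\sum_{k\in J^c}h_k(\theta)\mu_k .$$ The Lagrangian is $L(x,y)=\sum_{J}\mathbf 1_{F_J}(x)L_J(y)$ for $x\in\mathbb R_+^K$, $y\in\mathbb R^K$, where $L_J(y)=\sup_{\theta\in\mathbb R^K}(\theta\cdot y-H_J(\theta))$. *)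

theory Defs
  imports "HOL-Analysis.Analysis"
begin

text \<open>
  The nodes are the elements of a finite type \<open>'n\<close>, so \<open>K = CARD('n)\<close>, and
  \<open>P $ k $ l\<close> is the entry \<open>p\<^sub>k\<^sub>l\<close>.
\<close>

definition substochastic :: "real^'n^'n \<Rightarrow> bool" where
  "substochastic P \<longleftrightarrow> (\<forall>k l. 0 \<le> P $ k $ l) \<and> (\<forall>k. (\<Sum>l\<in>UNIV. P $ k $ l) \<le> 1)"

definition complex_eigenvalues :: "real^'n^'n \<Rightarrow> complex set" where
  "complex_eigenvalues A =
     {c. \<exists>v :: complex^'n. v \<noteq> 0 \<and> map_matrix complex_of_real A *v v = c *s v}"

text \<open>The eigenvalues form a finite nonempty set, so the supremum is a maximum.\<close>

definition spectral_radius :: "real^'n^'n \<Rightarrow> real" where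
  "spectral_radius A = (SUP c\<in>complex_eigenvalues A. cmod c)"

definition face :: "'n set \<Rightarrow> (real^'n) set" where
  "face J = {x. (\<forall>i\<in>J. x $ i = 0) \<and> (\<forall>i\<in>-J. x $ i > 0)}"

definition h_node :: "real^'n^'n \<Rightarrow> 'n \<Rightarrow> real^'n \<Rightarrow> real" where
  "h_node P k \<theta> = exp (- \<theta> $ k) * ((\<Sum>l\<in>UNIV. (exp (\<theta> $ l) - 1) * P $ k $ l) + 1) - 1"

definition H_face ::
  "real^'n^'n \<Rightarrow> real^'n \<Rightarrow> real^'n \<Rightarrow> 'n set \<Rightarrow> real^'n \<Rightarrow> real" where
  "H_face P lam \<mu> J \<theta> =
     (\<Sum>k\<in>UNIV. (exp (\<theta> $ k) - 1) * lam $ k)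
     + (\<Sum>k\<in>J. max (h_node P k \<theta>) 0 * \<mu> $ k)
     + (\<Sum>k\<in>-J. h_node P k \<theta> * \<mu> $ k)"

definition L_face ::
  "real^'n^'n \<Rightarrow> real^'n \<Rightarrow> real^'n \<Rightarrow> 'n set \<Rightarrow> real^'n \<Rightarrow> ereal" where
  "L_face P lam \<mu> J y = (SUP \<theta>. ereal (\<theta> \<bullet> y - H_face P lam \<mu> J \<theta>))"

text \<open>
  In the extended reals \<open>0 * \<infinity> = 0\<close>, so for \<open>x\<close> in the orthant exactly one summand survives.
  The value \<open>0\<close> at \<open>x\<close> outside the orthant is never used.
\<close>

definition Lagrangian ::
  "real^'n^'n \<Rightarrow> real^'n \<Rightarrow> real^'n \<Rightarrow> real^'n \<Rightarrow> real^'n \<Rightarrow> ereal" where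
  "Lagrangian P lam \<mu> x y = (\<Sum>J\<in>UNIV. indicator (face J) x * L_face P lam \<mu> J y)"

lemma L_face_nonneg: "0 \<le> L_face P lam \<mu> J y"
proof -
  have "ereal (0 \<bullet> y - H_face P lam \<mu> J 0) \<le> L_face P lam \<mu> J y"
    unfolding L_face_def by (rule SUP_upper) simp
  then show ?thesis
    by (simp add: H_face_def h_node_def zero_ereal_def)
qed

lemma Lagrangian_nonneg: "0 \<le> Lagrangian P lam \<mu> x y"
  unfolding Lagrangian_def
  by (intro sum_nonneg ereal_0_le_mult L_face_nonneg) (simp add: indicator_def)

definition abs_continuous_on :: "real \<Rightarrow> real \<Rightarrow> (real \<Rightarrow> 'a::real_normed_vector) \<Rightarrow> bool" where
  "abs_continuous_on a b q \<longleftrightarrow>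
     (\<forall>\<epsilon>>0. \<exists>\<delta>>0. \<forall>(m::nat) u v.
        (\<forall>i<m. a \<le> u i \<and> u i \<le> v i \<and> v i \<le> b) \<and>
        disjoint_family_on (\<lambda>i. {u i<..<v i}) {..<m} \<and>
        (\<Sum>i<m. v i - u i) < \<delta> \<longrightarrow>
        (\<Sum>i<m. norm (q (v i) - q (u i))) < \<epsilon>)"

text \<open>A path on \<open>[0,T]\<close> is a function on all of \<open>real\<close> of which only the values on \<open>{0..T}\<close> matter.\<close>

definition admissible :: "real^'n \<Rightarrow> real \<Rightarrow> (real \<Rightarrow> real^'n) \<Rightarrow> bool" where
  "admissible r T q \<longleftrightarrow>
     0 \<le> T \<and> abs_continuous_on 0 T q \<and> (\<forall>t\<in>{0..T}. \<forall>i. 0 \<le> q t $ i) \<and> q 0 = 0 \<and> q T = r"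

text \<open>
  By \<open>Lagrangian_nonneg\<close> the truncation in \<open>e2ennreal\<close> loses nothing.  The unspecified values of
  \<open>vector_derivative\<close> at the endpoints and at points of non-differentiability concern a null set
  only, as \<open>q\<close> is absolutely continuous on \<open>[0,T]\<close>.
\<close>

definition path_cost ::
  "real^'n^'n \<Rightarrow> real^'n \<Rightarrow> real^'n \<Rightarrow> real \<Rightarrow> (real \<Rightarrow> real^'n) \<Rightarrow> ennreal" where
  "path_cost P lam \<mu> T q =
     (\<integral>\<^sup>+t\<in>{0..T}. e2ennreal (Lagrangian P lam \<mu> (q t) (vector_derivative q (at t))) \<partial>lebesgue)"

definition optimal_trajectory ::
  "real^'n^'n \<Rightarrow> real^'n \<Rightarrow> real^'n \<Rightarrow> real^'n \<Rightarrow> real \<Rightarrow> (real \<Rightarrow> real^'n) \<Rightarrow> bool" where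
  "optimal_trajectory P lam \<mu> r T q \<longleftrightarrow>
     admissible r T q \<and>
     (\<forall>T' q'. admissible r T' q' \<longrightarrow> path_cost P lam \<mu> T q \<le> path_cost P lam \<mu> T' q')"

definition affine_on_interval :: "real \<Rightarrow> real \<Rightarrow> (real \<Rightarrow> real^'n) \<Rightarrow> bool" where
  "affine_on_interval a b q \<longleftrightarrow> (\<exists>x v. \<forall>t\<in>{a..b}. q t = x + t *\<^sub>R v)"

end

(*
  The quasipotential is linear: V(r) = alpha . r with alpha_k = -ln rho_k.  On the face of J let z be
  the function that equals 1/rho_k - 1 off J and is P-harmonic on J, and put theta_k = ln (1 + z_k).
  Then H_J(theta) = 0 and theta = alpha off J, while the velocity of a path vanishes on J at almost
  every time that it spends in the face; hence L_J(y) >= theta . y = alpha . y there, and every path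
  to r costs at least alpha . r.  Equality holds iff y is a subgradient of H_J at theta, which means
  that z_k <= 1/rho_k - 1 on J ("J is good") and y_k = nu_k (z - P z)_k.  So a path is optimal iff it
  solves, almost everywhere, a differential inclusion with one velocity per face: the time reversal of
  the fluid dynamics of the reversed network.  Started at r and run backwards, the maximum principle
  for P shows that a coordinate that has reached 0 stays there, which gives the piecewise linear
  solution, and that two solutions coincide (they solve the same Skorokhod reflection problem).
*)
theory Submission
  imports Defs
begin

section \<open>Differentiability of absolutely continuous functions\<close>

text \<open>Competitors are arbitrary absolutely continuous paths, so comparing costs rests on
  differentiability almost everywhere (Vitali covers) and on the fundamental theorem of calculus
  (gauges). The substitution \<theta> = ln (1 + z) makes H_J rational in z: node k contributes ((P
  z)_k - z_k) / (1 + z_k) times \<mu>_k, and the traffic equation turns the arrival term into the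
  sum of \<nu>_k (z - P z)_k. As \<mu>_k = \<nu>_k / \<rho>_k, the value z_k = 1/\<rho>_k - 1 off J
  makes the two cancel node by node; that is its origin. The velocity field jumps between faces, so
  Lipschitz theory gives no uniqueness. The inverse of the linear map u -> \<nu> (u - P u) removes
  this obstacle: in the new coordinates an extremal path moves with speed z, which is 1/\<rho>_k - 1
  where the path has positive k-th coordinate and at most that elsewhere. Two solutions with the
  same endpoint are then compared by a maximum principle over time and node together. The spectral
  radius enters through the nonnegative inverse of I - P, which yields \<nu> > 0 and a positive
  weight m with P m < m.\<close>

text \<open>The families used below are indexed by pieces of divisions, tagged pieces or pairs of
  pieces, so the index sets of natural numbers in the definition are replaced by arbitrary finite
  sets.\<close>

lemma abs_continuous_on_family:
  fixes f :: "real \<Rightarrow> 'a::real_normed_vector"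
  assumes "abs_continuous_on a b f" "\<epsilon> > 0"
  obtains \<delta> where "\<delta> > 0"
    "\<And>A u v. \<lbrakk>finite A; \<And>i. i \<in> A \<Longrightarrow> a \<le> u i \<and> u i \<le> v i \<and> v i \<le> b;
        disjoint_family_on (\<lambda>i::'i. {u i<..<v i}) A; (\<Sum>i\<in>A. v i - u i) < \<delta>\<rbrakk>
      \<Longrightarrow> (\<Sum>i\<in>A. norm (f (v i) - f (u i))) < \<epsilon>"
proof -
  obtain \<delta> where "\<delta> > 0" and \<delta>: "\<forall>(m::nat) u v.
        (\<forall>i<m. a \<le> u i \<and> u i \<le> v i \<and> v i \<le> b) \<and>
        disjoint_family_on (\<lambda>i. {u i<..<v i}) {..<m} \<and>
        (\<Sum>i<m. v i - u i) < \<delta> \<longrightarrow>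
        (\<Sum>i<m. norm (f (v i) - f (u i))) < \<epsilon>"
    using assms(1)[unfolded abs_continuous_on_def, rule_format, OF assms(2)] by blast
  show ?thesis
  proof
    show "\<delta> > 0" by fact
    fix A u v
    assume A: "finite A" "\<And>i. i \<in> A \<Longrightarrow> a \<le> u i \<and> u i \<le> v i \<and> v i \<le> b"
      "disjoint_family_on (\<lambda>i::'i. {u i<..<v i}) A" "(\<Sum>i\<in>A. v i - u i) < \<delta>"
    obtain h where h: "bij_betw h {..<card A} A"
      using ex_bij_betw_nat_finite[OF A(1)] by (auto simp: lessThan_atLeast0)
    have hA: "h i \<in> A" if "i < card A" for i using h that by (auto simp: bij_betw_def)
    have "(\<Sum>i<card A. norm (f (v (h i)) - f (u (h i)))) < \<epsilon>"
    proof (rule \<delta>[rule_format, of "card A" "u \<circ> h" "v \<circ> h", unfolded o_def], intro conjI)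
      show "\<forall>i<card A. a \<le> u (h i) \<and> u (h i) \<le> v (h i) \<and> v (h i) \<le> b"
        using A(2) hA by blast
      show "disjoint_family_on (\<lambda>i. {u (h i)<..<v (h i)}) {..<card A}"
        using A(3) h hA unfolding disjoint_family_on_def bij_betw_def inj_on_def
        by (metis lessThan_iff)
      show "(\<Sum>i<card A. v (h i) - u (h i)) < \<delta>"
        using A(4) sum.reindex_bij_betw[OF h, of "\<lambda>i. v i - u i"] by simp
    qed
    then show "(\<Sum>i\<in>A. norm (f (v i) - f (u i))) < \<epsilon>"
      using sum.reindex_bij_betw[OF h, of "\<lambda>i. norm (f (v i) - f (u i))"] by simp
  qed
qed

lemma abs_continuous_on_subinterval:
  assumes "abs_continuous_on a b f" "a \<le> c" "d \<le> b"
  shows "abs_continuous_on c d f"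
  using assms unfolding abs_continuous_on_def by (meson order_trans)

lemma abs_continuous_on_bounded_linear:
  assumes "abs_continuous_on a b f" "bounded_linear h"
  shows "abs_continuous_on a b (\<lambda>t. h (f t))"
proof -
  interpret bounded_linear h by fact
  obtain C where C: "C > 0" "\<And>x. norm (h x) \<le> norm x * C" using pos_bounded by blast
  show ?thesis
    unfolding abs_continuous_on_def
  proof (intro allI impI)
    fix \<epsilon> :: real assume "\<epsilon> > 0"
    then have "\<epsilon> / C > 0" using C by simp
    obtain \<delta> where "\<delta> > 0" and \<delta>: "\<forall>(m::nat) u v.
        (\<forall>i<m. a \<le> u i \<and> u i \<le> v i \<and> v i \<le> b) \<and>
        disjoint_family_on (\<lambda>i. {u i<..<v i}) {..<m} \<and>
        (\<Sum>i<m. v i - u i) < \<delta> \<longrightarrow>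
        (\<Sum>i<m. norm (f (v i) - f (u i))) < \<epsilon> / C"
      using assms(1)[unfolded abs_continuous_on_def, rule_format, OF \<open>\<epsilon> / C > 0\<close>] by blast
    have "(\<Sum>i<m. norm (h (f (v i)) - h (f (u i)))) < \<epsilon>"
      if H: "(\<forall>i<m. a \<le> u i \<and> u i \<le> v i \<and> v i \<le> b) \<and>
        disjoint_family_on (\<lambda>i. {u i<..<v i}) {..<m} \<and>
        (\<Sum>i<m. v i - u i) < \<delta>" for m :: nat and u v
    proof -
      have "(\<Sum>i<m. norm (h (f (v i)) - h (f (u i)))) \<le> (\<Sum>i<m. norm (f (v i) - f (u i)) * C)"
        by (intro sum_mono) (metis C(2) diff)
      also have "\<dots> < \<epsilon>"
        using \<delta>[rule_format, OF H] C(1) by (simp add: sum_distrib_right[symmetric] pos_less_divide_eq)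
      finally show ?thesis .
    qed
    with \<open>\<delta> > 0\<close> show "\<exists>\<delta>>0. \<forall>(m::nat) u v.
        (\<forall>i<m. a \<le> u i \<and> u i \<le> v i \<and> v i \<le> b) \<and>
        disjoint_family_on (\<lambda>i. {u i<..<v i}) {..<m} \<and>
        (\<Sum>i<m. v i - u i) < \<delta> \<longrightarrow>
        (\<Sum>i<m. norm (h (f (v i)) - h (f (u i)))) < \<epsilon>" by blast
  qed
qed

section \<open>Finite families of intervals and Vitali covers on the line\<close>

lemma sum_lengths_le_measure:
  fixes u v :: "'i \<Rightarrow> real"
  assumes "finite A" "\<And>i. i \<in> A \<Longrightarrow> u i \<le> v i \<and> {u i<..<v i} \<subseteq> U"
    "disjoint_family_on (\<lambda>i. {u i<..<v i}) A" "U \<in> lmeasurable"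
  shows "(\<Sum>i\<in>A. v i - u i) \<le> measure lebesgue U"
proof -
  have "(\<Sum>i\<in>A. v i - u i) = (\<Sum>i\<in>A. measure lebesgue {u i<..<v i})"
    using assms(2) by (intro sum.cong) auto
  also have "\<dots> = measure lebesgue (\<Union>i\<in>A. {u i<..<v i})"
    using assms(1-3) by (intro measure_finite_Union[symmetric]) (auto simp: emeasure_lborel_Ioo)
  also have "\<dots> \<le> measure lebesgue U"
    using assms by (intro measure_mono_fmeasurable) auto
  finally show ?thesis .
qed

lemma division_interval:
  fixes D :: "real set set"
  assumes "D division_of S" "K \<in> D"
  shows "K = {Inf K..Sup K}" "Inf K \<le> Sup K" "interior K = {Inf K<..<Sup K}"
proof -
  obtain a b where "K = cbox a b" "K \<noteq> {}" using assms by (metis division_ofD(3,4))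
  then show "K = {Inf K..Sup K}" "Inf K \<le> Sup K" "interior K = {Inf K<..<Sup K}"
    by auto
qed

lemma division_disjoint_family:
  fixes D :: "real set set"
  assumes "D division_of S"
  shows "disjoint_family_on (\<lambda>K. {Inf K<..<Sup K}) D"
  unfolding disjoint_family_on_def
  using assms division_interval(3)[OF assms] division_ofD(5)[OF assms] by (metis)

lemma division_sum_increments:
  fixes f :: "real \<Rightarrow> 'a::real_normed_vector"
  assumes D: "D division_of {a..b}" and "a \<le> b"
  shows "(\<Sum>K\<in>D. f (Sup K) - f (Inf K)) = f b - f a"
proof -
  let ?p = "(\<lambda>K. (Inf K, K)) ` D"
  note dD = division_ofD[OF D]
  have "?p tagged_division_of {a..b}"
  proof (rule tagged_division_ofI)
    show "finite ?p" using dD(1) by simp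
    have "{K. \<exists>x. (x, K) \<in> ?p} = D" by auto
    then show "\<Union>{K. \<exists>x. (x, K) \<in> ?p} = {a..b}" using dD(6) by simp
    fix x K assume "(x, K) \<in> ?p"
    then have K: "K \<in> D" "x = Inf K" by auto
    show "x \<in> K" using division_interval(1,2)[OF D K(1)] K(2)
      by (metis atLeastAtMost_iff order_refl)
    show "K \<subseteq> {a..b}" "\<exists>a b. K = cbox a b" using dD K by auto
  next
    fix x1 K1 x2 K2 assume "(x1, K1) \<in> ?p" "(x2, K2) \<in> ?p" "(x1, K1) \<noteq> (x2, K2)"
    then show "interior K1 \<inter> interior K2 = {}" using dD(5) by auto
  qed
  from additive_tagged_division_1[OF \<open>a \<le> b\<close> this, of f]
  show ?thesis by (simp add: sum.reindex inj_on_def)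
qed

text \<open>Vitali's theorem gives countably many disjoint intervals that cover S up to a null set.
  Finitely many of them exhaust the measure up to e, and N collects what is left. The intervals need
  only contain x, not be centred at it, so slopes over intervals around x are admissible for
  Q.\<close>

lemma finite_Vitali_cover:
  fixes S U :: "real set"
  assumes "open U" "U \<in> lmeasurable" "S \<subseteq> U" "0 < e"
    and Q: "\<And>x d. x \<in> S \<Longrightarrow> 0 < d \<Longrightarrow> \<exists>u v. u < v \<and> u \<le> x \<and> x \<le> v \<and> v - u < d \<and> Q u v"
  obtains D N where "D division_of \<Union>D" "\<Union>D \<subseteq> U"
    "\<And>K. K \<in> D \<Longrightarrow> Q (Inf K) (Sup K)"
    "N \<in> lmeasurable" "measure lebesgue N < e" "S \<subseteq> \<Union>D \<union> N"
proof -
  define I where "I = {(u,v). u < v \<and> {u..v} \<subseteq> U \<and> Q u v}"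
  define c :: "real \<times> real \<Rightarrow> real" where "c = (\<lambda>(u,v). (u + v) / 2)"
  define \<rho> :: "real \<times> real \<Rightarrow> real" where "\<rho> = (\<lambda>(u,v). (v - u) / 2)"
  have cb: "cball (c i) (\<rho> i) = {fst i..snd i}" for i
    by (cases i) (auto simp: c_def \<rho>_def cball_eq_atLeastAtMost field_simps)
  have r: "0 < \<rho> i" if "i \<in> I" for i using that by (auto simp: I_def \<rho>_def)
  have cov: "\<exists>i. i \<in> I \<and> x \<in> cball (c i) (\<rho> i) \<and> \<rho> i < d" if "x \<in> S" "0 < d" for x d
  proof -
    obtain h where "h > 0" "ball x h \<subseteq> U" using \<open>open U\<close> \<open>S \<subseteq> U\<close> \<open>x \<in> S\<close> by (meson open_contains_ball subsetD)
    \<comment> \<open>The bound h keeps the interval inside U, the bound d makes the cover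
      fine.\<close>
    obtain u v where uv: "u < v" "u \<le> x" "x \<le> v" "v - u < min d h" "Q u v"
      using Q[OF \<open>x \<in> S\<close>, of "min d h"] \<open>0 < d\<close> \<open>h > 0\<close> by auto
    have "{u..v} \<subseteq> ball x h" using uv by (auto simp: dist_real_def)
    then have "(u,v) \<in> I" using uv \<open>ball x h \<subseteq> U\<close> by (auto simp: I_def)
    moreover have "x \<in> cball (c (u,v)) (\<rho> (u,v))" using uv by (simp add: cb)
    moreover have "\<rho> (u,v) < d" using uv by (simp add: \<rho>_def)
    ultimately show ?thesis by blast
  qed
  obtain C where C: "countable C" "C \<subseteq> I"
     "pairwise (\<lambda>i j. disjnt (cball (c i) (\<rho> i)) (cball (c j) (\<rho> j))) C"
     "negligible (S - (\<Union>i \<in> C. cball (c i) (\<rho> i)))"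
    using Vitali_covering_theorem_cballs[OF r cov] by blast
  define D0 where "D0 = (\<lambda>i. {fst i..snd i}) ` C"
  have D0U: "K \<subseteq> U" if "K \<in> D0" for K using that C(2) by (auto simp: D0_def I_def subset_iff)
  have "countable D0" using C(1) by (simp add: D0_def)
  then obtain D where D: "D \<subseteq> D0" "finite D" "measure lebesgue (\<Union>D0) - e < measure lebesgue (\<Union>D)"
  proof (rule measure_countable_Union_approachable[OF _ \<open>0 < e\<close>])
    show "d \<in> lmeasurable" if "d \<in> D0" for d using that by (auto simp: D0_def)
    show "measure lebesgue (\<Union>D') \<le> measure lebesgue U" if "D' \<subseteq> D0" "finite D'" for D'
      using that D0U \<open>U \<in> lmeasurable\<close>
      by (intro measure_mono_fmeasurable) (auto intro!: sets.finite_Union simp: D0_def)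
  qed auto
  have meas0: "\<Union>D0 \<in> lmeasurable"
    by (rule fmeasurableI2[OF \<open>U \<in> lmeasurable\<close>])
       (use D0U \<open>countable D0\<close> in \<open>auto intro!: sets.countable_Union simp: D0_def\<close>)
  have meas: "\<Union>D \<in> lmeasurable"
    by (rule fmeasurableI2[OF meas0]) (use D in \<open>auto intro!: sets.finite_Union simp: D0_def\<close>)
  define N where "N = (\<Union>D0 - \<Union>D) \<union> (S - \<Union>D0)"
  have UD0: "(\<Union>i \<in> C. cball (c i) (\<rho> i)) = \<Union>D0" by (simp add: cb D0_def)
  have neg: "negligible (S - \<Union>D0)" using C(4) UD0 by simp
  show ?thesis
  proof
    show "D division_of \<Union>D"
    proof (rule division_ofI)
      show "finite D" by fact
      fix K assume "K \<in> D"
      then show "K \<subseteq> \<Union>D" by blast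
      obtain i where "i \<in> C" "K = {fst i..snd i}" using \<open>K \<in> D\<close> D(1) by (force simp: D0_def)
      then show "K \<noteq> {}" "\<exists>a b. K = cbox a b" using C(2) by (auto simp: I_def)
    next
      fix K1 K2 assume K: "K1 \<in> D" "K2 \<in> D" "K1 \<noteq> K2"
      obtain i where i: "i \<in> C" "K1 = {fst i..snd i}" using K(1) D(1) by (force simp: D0_def)
      obtain j where j: "j \<in> C" "K2 = {fst j..snd j}" using K(2) D(1) by (force simp: D0_def)
      have "i \<noteq> j" using i j K(3) by blast
      then have "disjnt K1 K2" using pairwiseD[OF C(3) i(1) j(1)] i j by (simp add: cb)
      then show "interior K1 \<inter> interior K2 = {}"
        by (metis disjnt_def interior_Int interior_empty)
    qed auto
    show "\<Union>D \<subseteq> U" using D(1) D0U by blast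
    show "Q (Inf K) (Sup K)" if K: "K \<in> D" for K
    proof -
      obtain i where "i \<in> C" "K = {fst i..snd i}" using K D(1) by (force simp: D0_def)
      then have "i \<in> I" using C(2) by blast
      then have "fst i < snd i" "Q (fst i) (snd i)" by (simp_all add: I_def case_prod_beta)
      then show ?thesis by (simp add: \<open>K = _\<close>)
    qed
    have m1: "\<Union>D0 - \<Union>D \<in> lmeasurable"
      using meas meas0 by (intro fmeasurable.Diff)
    have m2: "S - \<Union>D0 \<in> lmeasurable"
      by (rule negligible_imp_measurable[OF neg])
    show "N \<in> lmeasurable" unfolding N_def using m1 m2 by (rule fmeasurable.Un)
    have "measure lebesgue N \<le> measure lebesgue (\<Union>D0 - \<Union>D) + measure lebesgue (S - \<Union>D0)"
      unfolding N_def using m1 m2 by (intro measure_Un_le) (simp_all add: fmeasurableD)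
    also have "\<dots> = measure lebesgue (\<Union>D0) - measure lebesgue (\<Union>D)"
      using meas meas0 neg D(1)
      by (subst measurable_measure_Diff) (auto simp: negligible_imp_measure0 fmeasurableD)
    finally show "measure lebesgue N < e" using D(3) by linarith
    show "S \<subseteq> \<Union>D \<union> N" by (auto simp: N_def)
  qed
qed

lemma measure_Union_division_le:
  fixes D :: "real set set"
  assumes "D division_of S"
  shows "S \<in> lmeasurable" "measure lebesgue S \<le> (\<Sum>K\<in>D. Sup K - Inf K)"
proof -
  note dD = division_ofD[OF assms]
  have m: "K \<in> lmeasurable" "measure lebesgue K = Sup K - Inf K" if "K \<in> D" for K
    by (subst division_interval(1)[OF assms that]; use division_interval(2)[OF assms that] in simp)+
  show "S \<in> lmeasurable"
    using dD(1,6) m(1) by (metis fmeasurable.finite_Union subsetI)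
  have "measure lebesgue (\<Union>K\<in>D. K) \<le> (\<Sum>K\<in>D. measure lebesgue K)"
    using dD(1) m(1) by (intro measure_UNION_le) (auto simp: fmeasurableD)
  also have "\<dots> = (\<Sum>K\<in>D. Sup K - Inf K)" using m(2) by simp
  finally show "measure lebesgue S \<le> (\<Sum>K\<in>D. Sup K - Inf K)" using dD(6) by simp
qed

text \<open>Near a point the increments over disjoint intervals sum to less than 1, so disjoint
  intervals of slope at least M have total length at most 1/M. Negligibility is local, so it
  suffices to argue in a short neighbourhood of each point.\<close>

lemma negligible_infinite_slopes:
  fixes f :: "real \<Rightarrow> real"
  assumes ac: "abs_continuous_on a b f" and "S \<subseteq> {a<..<b}"
    and steep: "\<And>x d M. x \<in> S \<Longrightarrow> 0 < d \<Longrightarrow>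
        \<exists>u v. u < v \<and> u \<le> x \<and> x \<le> v \<and> v - u < d \<and> M * (v - u) \<le> \<bar>f v - f u\<bar>"
  shows "negligible S"
proof -
  obtain \<delta> where "\<delta> > 0" and \<delta>: "\<And>A u v. \<lbrakk>finite A; \<And>i. i \<in> A \<Longrightarrow> a \<le> u i \<and> u i \<le> v i \<and> v i \<le> b;
        disjoint_family_on (\<lambda>i::real set. {u i<..<v i}) A; (\<Sum>i\<in>A. v i - u i) < \<delta>\<rbrakk>
      \<Longrightarrow> (\<Sum>i\<in>A. norm (f (v i) - f (u i))) < 1"
    using abs_continuous_on_family[OF ac zero_less_one] by blast
  have "\<exists>U. openin (top_of_set S) U \<and> x \<in> U \<and> negligible U" if "x \<in> S" for x
  proof (intro exI conjI)
    \<comment> \<open>The radius gives U length at most 2\<delta>/3, below the \<delta> of absolute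
      continuity.\<close>
    define U where "U = {a<..<b} \<inter> ball x (\<delta>/3)"
    have U: "open U" "U \<in> lmeasurable" by (auto simp: U_def)
    have "measure lebesgue U \<le> measure lebesgue (ball x (\<delta>/3))"
      by (rule measure_mono_fmeasurable) (auto simp: U_def)
    also have "\<dots> < \<delta>" using \<open>\<delta> > 0\<close> by (simp add: ball_eq_greaterThanLessThan)
    finally have mU: "measure lebesgue U < \<delta>" .
    show "openin (top_of_set S) (S \<inter> U)" using U by blast
    show "x \<in> S \<inter> U" using \<open>x \<in> S\<close> \<open>S \<subseteq> _\<close> \<open>\<delta> > 0\<close> by (auto simp: U_def)
    show "negligible (S \<inter> U)"
      unfolding negligible_outer
    proof (intro allI impI)
      fix e :: real assume "e > 0"
      \<comment> \<open>Slope 2/e and increments below 1 leave total length below e/2; N takes the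
        other half of e.\<close>
      obtain D N where D: "D division_of \<Union>D" "\<Union>D \<subseteq> U"
        "\<And>K. K \<in> D \<Longrightarrow> 2 / e * (Sup K - Inf K) \<le> \<bar>f (Sup K) - f (Inf K)\<bar>"
        "N \<in> lmeasurable" "measure lebesgue N < e/2" "S \<inter> U \<subseteq> \<Union>D \<union> N"
        using finite_Vitali_cover[OF U, of "S \<inter> U" "e/2" "\<lambda>u v. 2 / e * (v - u) \<le> \<bar>f v - f u\<bar>"]
          steep \<open>e > 0\<close> by (metis Int_iff Int_lower2 half_gt_zero)
      note int = division_interval[OF D(1)]
      have bnd: "a \<le> Inf K \<and> Inf K \<le> Sup K \<and> Sup K \<le> b \<and> {Inf K<..<Sup K} \<subseteq> U" if "K \<in> D" for K
      proof -
        have KU: "{Inf K..Sup K} \<subseteq> U" using int(1)[OF that] D(2) that by blast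
        then have "Inf K \<in> U" "Sup K \<in> U" using int(2)[OF that] by auto
        then show ?thesis using int(2)[OF that] KU by (auto simp: U_def)
      qed
      have "(\<Sum>K\<in>D. Sup K - Inf K) \<le> measure lebesgue U"
        using D bnd U division_disjoint_family[OF D(1)]
        by (intro sum_lengths_le_measure) auto
      then have "(\<Sum>K\<in>D. norm (f (Sup K) - f (Inf K))) < 1"
        using D(1) bnd mU division_disjoint_family[OF D(1)] by (intro \<delta>) auto
      moreover have "2 / e * (\<Sum>K\<in>D. Sup K - Inf K) \<le> (\<Sum>K\<in>D. norm (f (Sup K) - f (Inf K)))"
        unfolding sum_distrib_left using D(3) by (intro sum_mono) simp
      ultimately have "2 / e * (\<Sum>K\<in>D. Sup K - Inf K) < 1" by linarith
      then have len: "(\<Sum>K\<in>D. Sup K - Inf K) < e/2" using \<open>e > 0\<close> by (simp add: field_simps)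
      have "measure lebesgue (\<Union>D \<union> N) \<le> measure lebesgue (\<Union>D) + measure lebesgue N"
        using measure_Union_division_le[OF D(1)] D(4) by (intro measure_Un_le) (auto simp: fmeasurableD)
      then have "measure lebesgue (\<Union>D \<union> N) < e"
        using measure_Union_division_le(2)[OF D(1)] len D(5) by linarith
      moreover have "\<Union>D \<union> N \<in> lmeasurable"
        using measure_Union_division_le(1)[OF D(1)] D(4) by (rule fmeasurable.Un)
      ultimately show "\<exists>T. S \<inter> U \<subseteq> T \<and> T \<in> lmeasurable \<and> measure lebesgue T < e"
        using D(6) by blast
    qed
  qed
  then show ?thesis using locally_negligible_alt by blast
qed

lemma outer_measure_open:
  fixes S :: "real set"
  assumes "A \<in> lmeasurable" "S \<subseteq> A" "measure lebesgue A < c" "open V" "S \<subseteq> V"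
  obtains U where "open U" "U \<in> lmeasurable" "S \<subseteq> U" "U \<subseteq> V" "measure lebesgue U < c"
proof -
  obtain T where T: "open T" "A \<subseteq> T" "(T - A) \<in> lmeasurable"
    "emeasure lebesgue (T - A) < ennreal (c - measure lebesgue A)"
    using sets_lebesgue_outer_open[of A "c - measure lebesgue A"] assms by (auto simp: fmeasurableD)
  have TA: "T = A \<union> (T - A)" using T(2) by blast
  have mT: "T \<in> lmeasurable" using TA fmeasurable.Un[OF assms(1) T(3)] by simp
  have "measure lebesgue (T - A) < c - measure lebesgue A"
    using T(3,4) assms(3) by (simp add: emeasure_eq_measure2 ennreal_less_iff)
  moreover have "measure lebesgue T \<le> measure lebesgue A + measure lebesgue (T - A)"
    using measure_Un_le[of A lebesgue "T - A"] TA assms(1) T(3) by (auto simp: fmeasurableD)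
  ultimately have lt: "measure lebesgue T < c" by linarith
  have m: "T \<inter> V \<in> lmeasurable" using mT \<open>open V\<close>
    by (intro fmeasurable_Int_fmeasurable) (auto simp: borel_open)
  have "measure lebesgue (T \<inter> V) \<le> measure lebesgue T"
    using mT m by (intro measure_mono_fmeasurable) (auto simp: fmeasurableD)
  then show ?thesis
    using that[of "T \<inter> V"] T(1,2) assms m lt by auto
qed


text \<open>If S had outer measure s > 0, it could be covered almost tightly by intervals of slope
  at most q, and again, inside these, by intervals of slope at least p. The two families differ in
  length by at most 3\<epsilon>, and absolute continuity makes f vary by less than \<eta> on the
  difference. Comparing increments gives (p - q) X \<le> 2\<eta> for a length X close to s, which is
  impossible.\<close>

lemma negligible_opposite_slopes:
  fixes f :: "real \<Rightarrow> real"
  assumes ac: "abs_continuous_on a b f" and Sab: "S \<subseteq> {a<..<b}" and "q < p"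
    and lo: "\<And>x d. x \<in> S \<Longrightarrow> 0 < d \<Longrightarrow>
        \<exists>u v. u < v \<and> u \<le> x \<and> x \<le> v \<and> v - u < d \<and> f v - f u \<le> q * (v - u)"
    and hi: "\<And>x d. x \<in> S \<Longrightarrow> 0 < d \<Longrightarrow>
        \<exists>u v. u < v \<and> u \<le> x \<and> x \<le> v \<and> v - u < d \<and> p * (v - u) \<le> f v - f u"
  shows "negligible S"
proof (rule ccontr)
  assume nneg: "\<not> negligible S"
  \<comment> \<open>S is not assumed measurable, so s is its outer measure.\<close>
  define s where "s = Inf (measure lebesgue ` {A \<in> lmeasurable. S \<subseteq> A})"
  have ne: "measure lebesgue ` {A \<in> lmeasurable. S \<subseteq> A} \<noteq> {}"
    using Sab by (auto intro: exI[of _ "{a<..<b}"])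
  have bdd: "bdd_below (measure lebesgue ` {A \<in> lmeasurable. S \<subseteq> A})"
    by (auto intro!: bdd_belowI[of _ 0])
  have s_le: "s \<le> measure lebesgue A" if "A \<in> lmeasurable" "S \<subseteq> A" for A
    unfolding s_def using that bdd by (auto intro!: cInf_lower)
  have s_less: "\<exists>A \<in> lmeasurable. S \<subseteq> A \<and> measure lebesgue A < c" if "s < c" for c
    using cInf_lessD[OF ne] that unfolding s_def by blast
  have "s > 0"
  proof (rule ccontr)
    assume "\<not> s > 0"
    then have "\<exists>A. S \<subseteq> A \<and> A \<in> lmeasurable \<and> measure lebesgue A < e" if "e > 0" for e
      using s_less[of e] that by auto
    then have "negligible S" unfolding negligible_outer by blast
    with nneg show False ..
  qed
  define \<eta> where "\<eta> = (p - q) * s / 4"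
  have "\<eta> > 0" using \<open>q < p\<close> \<open>s > 0\<close> by (simp add: \<eta>_def)
  obtain \<delta> where "\<delta> > 0" and \<delta>: "\<And>A u v. \<lbrakk>finite A; \<And>i. i \<in> A \<Longrightarrow> a \<le> u i \<and> u i \<le> v i \<and> v i \<le> b;
        disjoint_family_on (\<lambda>i::real set \<times> real set. {u i<..<v i}) A; (\<Sum>i\<in>A. v i - u i) < \<delta>\<rbrakk>
      \<Longrightarrow> (\<Sum>i\<in>A. norm (f (v i) - f (u i))) < \<eta>"
    using abs_continuous_on_family[OF ac \<open>\<eta> > 0\<close>] by blast
  \<comment> \<open>The three bounds give in turn X \<ge> 3s/4, a remainder Y \<le> 3\<epsilon> <
    \<delta>, and \<bar>q\<bar> Y \<le> \<eta>.\<close>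
  define \<epsilon> where "\<epsilon> = min (s/8) (min (\<delta>/4) ((p - q) * s / (12 * (\<bar>q\<bar> + 1))))"
  have "\<epsilon> > 0" using \<open>q < p\<close> \<open>s > 0\<close> \<open>\<delta> > 0\<close> by (simp add: \<epsilon>_def add_nonneg_pos)
  have \<epsilon>s: "\<epsilon> \<le> s/8" and \<epsilon>\<delta>: "\<epsilon> \<le> \<delta>/4" unfolding \<epsilon>_def by linarith+
  have "\<epsilon> \<le> (p - q) * s / (12 * (\<bar>q\<bar> + 1))" unfolding \<epsilon>_def by linarith
  then have "\<epsilon> * (12 * (\<bar>q\<bar> + 1)) \<le> (p - q) * s" by (simp add: pos_le_divide_eq add_nonneg_pos)
  then have \<epsilon>q: "3 * \<bar>q\<bar> * \<epsilon> \<le> \<eta>"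
    using \<open>\<epsilon> > 0\<close> by (simp add: \<eta>_def algebra_simps)
  obtain U where U: "open U" "U \<in> lmeasurable" "S \<subseteq> U" "U \<subseteq> {a<..<b}" "measure lebesgue U < s + \<epsilon>"
    using s_less[of "s + \<epsilon>"] \<open>\<epsilon> > 0\<close> Sab outer_measure_open[of _ S "s + \<epsilon>" "{a<..<b}"] by auto
  obtain F N where F: "F division_of \<Union>F" "\<Union>F \<subseteq> U"
      "\<And>K. K \<in> F \<Longrightarrow> f (Sup K) - f (Inf K) \<le> q * (Sup K - Inf K)"
      "N \<in> lmeasurable" "measure lebesgue N < \<epsilon>" "S \<subseteq> \<Union>F \<union> N"
    using finite_Vitali_cover[OF U(1-3) \<open>\<epsilon> > 0\<close>, of "\<lambda>u v. f v - f u \<le> q * (v - u)"] lo by metis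
  note Fint = division_interval[OF F(1)]
  have finF: "finite F" using F(1) by blast
  \<comment> \<open>The error \<epsilon> is shared among the intervals of F.\<close>
  define \<epsilon>' where "\<epsilon>' = \<epsilon> / (real (card F) + 1)"
  have "\<epsilon>' > 0" using \<open>\<epsilon> > 0\<close> by (simp add: \<epsilon>'_def add_nonneg_pos)
  have "card F * \<epsilon>' \<le> \<epsilon>" using \<open>\<epsilon> > 0\<close> by (simp add: \<epsilon>'_def field_simps)
  define \<Phi> where "\<Phi> K G Q N \<longleftrightarrow> G division_of \<Union>G \<and> \<Union>G \<subseteq> K \<and> G \<subseteq> Q \<and> Q division_of K \<and>
      (\<forall>g\<in>G. p * (Sup g - Inf g) \<le> f (Sup g) - f (Inf g)) \<and>
      N \<in> lmeasurable \<and> measure lebesgue N < \<epsilon>' \<and> S \<inter> interior K \<subseteq> \<Union>G \<union> N"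
    for K G Q and N :: "real set"
  have "\<exists>G Q N. \<Phi> K G Q N" if "K \<in> F" for K
  proof -
    have KI: "K = {Inf K..Sup K}" "interior K = {Inf K<..<Sup K}" using Fint that by auto
    have "interior K \<in> lmeasurable" by (simp add: KI(2))
    then obtain G N where G: "G division_of \<Union>G" "\<Union>G \<subseteq> interior K"
      "\<And>g. g \<in> G \<Longrightarrow> p * (Sup g - Inf g) \<le> f (Sup g) - f (Inf g)"
      "N \<in> lmeasurable" "measure lebesgue N < \<epsilon>'" "S \<inter> interior K \<subseteq> \<Union>G \<union> N"
      using finite_Vitali_cover[OF open_interior _ _ \<open>\<epsilon>' > 0\<close>, of K "S \<inter> interior K"
          "\<lambda>u v. p * (v - u) \<le> f v - f u"] hi by (metis Int_iff Int_lower2)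
    have "\<Union>G \<subseteq> K" using G(2) interior_subset by blast
    then have "\<Union>G \<subseteq> cbox (Inf K) (Sup K)" using KI(1) by simp
    \<comment> \<open>The gaps between the intervals of G are filled to a division of K, so that
      increments over K telescope.\<close>
    then obtain Q where "G \<subseteq> Q" "Q division_of cbox (Inf K) (Sup K)"
      using partial_division_extend_interval[OF G(1)] by blast
    with G \<open>\<Union>G \<subseteq> K\<close> KI(1) show ?thesis unfolding \<Phi>_def by (metis cbox_interval)
  qed
  then obtain G Q M where \<Phi>: "\<And>K. K \<in> F \<Longrightarrow> \<Phi> K (G K) (Q K) (M K)" by metis
  have G: "\<And>K. K \<in> F \<Longrightarrow> G K division_of \<Union>(G K)"
      "\<And>K. K \<in> F \<Longrightarrow> \<Union>(G K) \<subseteq> K" "\<And>K. K \<in> F \<Longrightarrow> G K \<subseteq> Q K" "\<And>K. K \<in> F \<Longrightarrow> Q K division_of K"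
      "\<And>K g. K \<in> F \<Longrightarrow> g \<in> G K \<Longrightarrow> p * (Sup g - Inf g) \<le> f (Sup g) - f (Inf g)"
    and M: "\<And>K. K \<in> F \<Longrightarrow> M K \<in> lmeasurable" "\<And>K. K \<in> F \<Longrightarrow> measure lebesgue (M K) < \<epsilon>'"
      "\<And>K. K \<in> F \<Longrightarrow> S \<inter> interior K \<subseteq> \<Union>(G K) \<union> M K"
    using \<Phi> unfolding \<Phi>_def by blast+
  have finQ: "finite (Q K)" if "K \<in> F" for K using G(4)[OF that] by blast
  define R where "R K = Q K - G K" for K
  define L where "L = (\<Sum>K\<in>F. Sup K - Inf K)"
  define X where "X = (\<Sum>K\<in>F. \<Sum>g\<in>G K. Sup g - Inf g)"
  define Y where "Y = (\<Sum>K\<in>F. \<Sum>g\<in>R K. Sup g - Inf g)"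
  have split: "(\<Sum>K\<in>F. h (Sup K) - h (Inf K)) =
      (\<Sum>K\<in>F. \<Sum>g\<in>G K. h (Sup g) - h (Inf g)) + (\<Sum>K\<in>F. \<Sum>g\<in>R K. h (Sup g) - h (Inf g))"
    for h :: "real \<Rightarrow> real"
    unfolding sum.distrib[symmetric]
  proof (rule sum.cong[OF refl])
    fix K assume K: "K \<in> F"
    have "(\<Sum>g\<in>Q K. h (Sup g) - h (Inf g)) = h (Sup K) - h (Inf K)"
      using G(4)[OF K] Fint(1,2)[OF K] division_sum_increments[of "Q K" "Inf K" "Sup K" h] by simp
    then show "h (Sup K) - h (Inf K) =
        (\<Sum>g\<in>G K. h (Sup g) - h (Inf g)) + (\<Sum>g\<in>R K. h (Sup g) - h (Inf g))"
      using sum.subset_diff[OF G(3)[OF K] finQ[OF K], of "\<lambda>g. h (Sup g) - h (Inf g)"] by (simp add: R_def)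
  qed
  have L: "L = X + Y" unfolding L_def X_def Y_def using split[of "\<lambda>x. x"] by simp
  have FU: "{Inf K<..<Sup K} \<subseteq> U" if "K \<in> F" for K
    using Fint(1)[OF that] F(2) that by (metis Sup_upper greaterThanLessThan_subseteq_atLeastAtMost_iff order_refl subset_trans)
  have "L \<le> measure lebesgue U"
    unfolding L_def using finF Fint(2) FU U(2) division_disjoint_family[OF F(1)]
    by (intro sum_lengths_le_measure) auto
  then have L_less: "L < s + \<epsilon>" using U(5) by linarith
  have X_ge: "s \<le> X + 2 * \<epsilon>"
  proof -
    \<comment> \<open>The inner cover reaches only the interior of K; the two endpoints are added
      and have measure 0.\<close>
    define W where "W K = \<Union>(G K) \<union> (M K \<union> {Inf K, Sup K})" for K
    have Wm: "W K \<in> lmeasurable" if "K \<in> F" for K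
      unfolding W_def using measure_Union_division_le(1)[OF G(1)[OF that]] M(1)[OF that]
      by (intro fmeasurable.Un) (auto intro: negligible_imp_measurable)
    have Wle: "measure lebesgue (W K) \<le> (\<Sum>g\<in>G K. Sup g - Inf g) + \<epsilon>'" if "K \<in> F" for K
    proof -
      have "measure lebesgue (W K) \<le> measure lebesgue (\<Union>(G K)) + (measure lebesgue (M K) + measure lebesgue {Inf K, Sup K})"
        unfolding W_def using measure_Union_division_le(1)[OF G(1)[OF that]] M(1)[OF that]
        by (intro order_trans[OF measure_Un_le] add_mono order_refl sets.Un) (auto simp: fmeasurableD)
      also have "measure lebesgue {Inf K, Sup K} = 0" by (intro negligible_imp_measure0) auto
      finally show ?thesis
        using measure_Union_division_le(2)[OF G(1)[OF that]] M(2)[OF that] by linarith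
    qed
    have "S \<subseteq> N \<union> (\<Union>K\<in>F. W K)"
    proof
      fix x assume "x \<in> S"
      show "x \<in> N \<union> (\<Union>K\<in>F. W K)"
      proof (cases "x \<in> N")
        case False
        then obtain K where K: "K \<in> F" "x \<in> K" using F(6) \<open>x \<in> S\<close> by blast
        have "x \<in> {Inf K..Sup K}" using K Fint(1) by metis
        then have "x \<in> interior K \<or> x \<in> {Inf K, Sup K}" using Fint(3)[OF K(1)] by auto
        then have "x \<in> W K" using M(3)[OF K(1)] \<open>x \<in> S\<close> by (auto simp: W_def)
        then show ?thesis using K by blast
      qed auto
    qed
    moreover have mW: "(\<Union>K\<in>F. W K) \<in> lmeasurable" using finF Wm by blast
    ultimately have "s \<le> measure lebesgue (N \<union> (\<Union>K\<in>F. W K))"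
      using F(4) by (intro s_le) blast+
    also have "\<dots> \<le> measure lebesgue N + measure lebesgue (\<Union>K\<in>F. W K)"
      using F(4) mW by (intro measure_Un_le) (auto simp: fmeasurableD)
    also have "measure lebesgue (\<Union>K\<in>F. W K) \<le> (\<Sum>K\<in>F. measure lebesgue (W K))"
      using finF Wm by (intro measure_UNION_le) (auto simp: fmeasurableD)
    also have "\<dots> \<le> (\<Sum>K\<in>F. (\<Sum>g\<in>G K. Sup g - Inf g) + \<epsilon>')"
      using Wle by (rule sum_mono)
    also have "\<dots> = X + card F * \<epsilon>'" by (simp add: sum.distrib X_def)
    finally show ?thesis using F(5) \<open>card F * \<epsilon>' \<le> \<epsilon>\<close> by linarith
  qed
  have Y: "Y \<le> 3 * \<epsilon>" using L L_less X_ge by linarith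
  have RK: "g \<subseteq> K" "Inf g \<le> Sup g" "g = {Inf g..Sup g}" "interior g = {Inf g<..<Sup g}"
    if "K \<in> F" "g \<in> R K" for K g
    using division_interval[OF G(4)[OF that(1)]] division_ofD(2)[OF G(4)[OF that(1)]] that(2)
    by (auto simp: R_def)
  have "Y \<ge> 0" unfolding Y_def using RK(2) by (intro sum_nonneg) auto
  have "(\<Sum>(K,g)\<in>Sigma F R. norm (f (Sup g) - f (Inf g))) < \<eta>"
    unfolding case_prod_beta
  proof (rule \<delta>)
    show "finite (Sigma F R)" using finF finQ by (auto simp: R_def)
    show "(\<Sum>i\<in>Sigma F R. Sup (snd i) - Inf (snd i)) < \<delta>"
    proof -
      have "(\<Sum>i\<in>Sigma F R. Sup (snd i) - Inf (snd i)) = Y"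
        unfolding Y_def using finF finQ by (subst sum.Sigma) (auto simp: R_def case_prod_beta)
      then show ?thesis using Y \<epsilon>\<delta> \<open>\<epsilon> > 0\<close> \<open>\<delta> > 0\<close> by linarith
    qed
    show "a \<le> Inf (snd i) \<and> Inf (snd i) \<le> Sup (snd i) \<and> Sup (snd i) \<le> b" if i: "i \<in> Sigma F R" for i
    proof -
      obtain K g where Kg: "i = (K,g)" "K \<in> F" "g \<in> R K" using i by blast
      have "g \<subseteq> {a<..<b}" using RK(1)[OF Kg(2,3)] F(2) U(4) Kg(2) by blast
      moreover have "Inf g \<in> g" "Sup g \<in> g" using RK(2,3)[OF Kg(2,3)]
        by (metis atLeastAtMost_iff order_refl)+
      ultimately show ?thesis using RK(2)[OF Kg(2,3)] Kg(1) by auto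
    qed
    show "disjoint_family_on (\<lambda>i. {Inf (snd i)<..<Sup (snd i)}) (Sigma F R)"
      unfolding disjoint_family_on_def
    proof (intro ballI impI)
      fix i j assume "i \<in> Sigma F R" "j \<in> Sigma F R" "i \<noteq> j"
      then obtain K g K' g' where ij: "i = (K,g)" "K \<in> F" "g \<in> R K" "j = (K',g')" "K' \<in> F" "g' \<in> R K'" by blast
      have "interior g \<inter> interior g' = {}"
      proof (cases "K = K'")
        case True
        then have "g \<noteq> g'" using ij \<open>i \<noteq> j\<close> by auto
        then show ?thesis using division_ofD(5)[OF G(4)[OF ij(2)]] ij True by (auto simp: R_def)
      next
        case False
        have "interior g \<subseteq> interior K" "interior g' \<subseteq> interior K'"
          using RK(1) ij by (auto intro!: interior_mono)
        then show ?thesis using division_ofD(5)[OF F(1) ij(2,5) False] by blast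
      qed
      then show "{Inf (snd i)<..<Sup (snd i)} \<inter> {Inf (snd j)<..<Sup (snd j)} = {}"
        using RK(4)[OF ij(2,3)] RK(4)[OF ij(5,6)] ij by simp
    qed
  qed
  also have "(\<Sum>(K,g)\<in>Sigma F R. norm (f (Sup g) - f (Inf g))) = (\<Sum>K\<in>F. \<Sum>g\<in>R K. norm (f (Sup g) - f (Inf g)))"
    using finF finQ by (subst sum.Sigma) (auto simp: R_def)
  finally have small: "(\<Sum>K\<in>F. \<Sum>g\<in>R K. norm (f (Sup g) - f (Inf g))) < \<eta>" .
  have "(\<Sum>K\<in>F. \<Sum>g\<in>R K. f (Sup g) - f (Inf g)) \<ge> (\<Sum>K\<in>F. \<Sum>g\<in>R K. - norm (f (Sup g) - f (Inf g)))"
    by (intro sum_mono) auto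
  then have rest: "(\<Sum>K\<in>F. \<Sum>g\<in>R K. f (Sup g) - f (Inf g)) \<ge> - \<eta>"
    using small by (simp add: sum_negf)
  have "p * X \<le> (\<Sum>K\<in>F. \<Sum>g\<in>G K. f (Sup g) - f (Inf g))"
    unfolding X_def sum_distrib_left using G(5) by (intro sum_mono)
  moreover have "(\<Sum>K\<in>F. f (Sup K) - f (Inf K)) \<le> q * L"
    unfolding L_def sum_distrib_left using F(3) by (intro sum_mono)
  ultimately have "p * X - \<eta> \<le> q * (X + Y)" using split[of f] rest unfolding L by linarith
  moreover have "q * Y \<le> \<bar>q\<bar> * (3 * \<epsilon>)"
    using Y \<open>Y \<ge> 0\<close> by (metis abs_ge_self abs_mult abs_of_nonneg mult_left_mono abs_ge_zero order_trans)
  ultimately have "(p - q) * X \<le> 2 * \<eta>" using \<epsilon>q by (simp add: algebra_simps)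
  moreover have "(p - q) * X \<ge> (p - q) * (3/4 * s)"
    using X_ge \<epsilon>s \<open>q < p\<close> by (intro mult_left_mono) auto
  ultimately have "(p - q) * s \<le> 0" by (simp add: \<eta>_def field_simps)
  then show False using \<open>q < p\<close> \<open>s > 0\<close> by (simp add: mult_le_0_iff)
qed

text \<open>A difference quotient at x is the slope of an interval with x as an endpoint. The first
  hypothesis bounds the quotients. If their lower and upper limits differed, two rationals strictly
  between would be the slopes that the second hypothesis excludes.\<close>

lemma differentiable_if_no_exceptional_slopes:
  fixes f :: "real \<Rightarrow> real"
  assumes "\<not> (\<forall>M. \<forall>d>0. \<exists>u v. u < v \<and> u \<le> x \<and> x \<le> v \<and> v - u < d \<and> M * (v - u) \<le> \<bar>f v - f u\<bar>)"
    and "\<And>p q :: rat. q < p \<Longrightarrow>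
      \<not> ((\<forall>d>0. \<exists>u v. u < v \<and> u \<le> x \<and> x \<le> v \<and> v - u < d \<and> f v - f u \<le> of_rat q * (v - u)) \<and>
         (\<forall>d>0. \<exists>u v. u < v \<and> u \<le> x \<and> x \<le> v \<and> v - u < d \<and> of_rat p * (v - u) \<le> f v - f u))"
  shows "f differentiable (at x)"
proof -
  define \<phi> where "\<phi> y = (f y - f x) / (y - x)" for y
  have slope: "\<exists>u v. u < v \<and> u \<le> x \<and> x \<le> v \<and> v - u = \<bar>y - x\<bar> \<and> f v - f u = \<phi> y * (v - u)"
    if "y \<noteq> x" for y
    using that
    by (intro exI[of _ "min x y"] exI[of _ "max x y"]) (auto simp: min_def max_def \<phi>_def field_simps)
  obtain M d where "d > 0" and Md: "\<And>u v. u < v \<Longrightarrow> u \<le> x \<Longrightarrow> x \<le> v \<Longrightarrow> v - u < d \<Longrightarrow> \<bar>f v - f u\<bar> < M * (v - u)"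
    using assms(1) by (meson not_le)
  have ev: "eventually (\<lambda>y. \<bar>\<phi> y\<bar> \<le> M) (at x)"
    unfolding eventually_at
  proof (intro exI[of _ d] conjI ballI impI)
    fix y assume y: "y \<noteq> x \<and> dist y x < d"
    obtain u v where uv: "u < v" "u \<le> x" "x \<le> v" "v - u = \<bar>y - x\<bar>" "f v - f u = \<phi> y * (v - u)"
      using slope y by blast
    have "\<bar>\<phi> y\<bar> * (v - u) < M * (v - u)"
      using Md[OF uv(1-3)] uv y by (simp add: abs_mult dist_real_def)
    then show "\<bar>\<phi> y\<bar> \<le> M" using uv(1) by simp
  qed fact
  define l where "l = Liminf (at x) (\<lambda>y. ereal (\<phi> y))"
  define L where "L = Limsup (at x) (\<lambda>y. ereal (\<phi> y))"
  have lL: "l \<le> L" unfolding l_def L_def by (rule Liminf_le_Limsup) simp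
  have lM: "ereal (-M) \<le> l" unfolding l_def
    by (rule Liminf_bounded) (use ev in eventually_elim, auto)
  have LM: "L \<le> ereal M" unfolding L_def
    by (rule Limsup_bounded) (use ev in eventually_elim, auto)
  have "l = L"
  proof (rule ccontr)
    assume "l \<noteq> L"
    then have "l < L" using lL by simp
    then obtain r1 where r1: "l < ereal r1" "ereal r1 < L" using ereal_dense2 by blast
    then obtain r2 where r2: "ereal r1 < ereal r2" "ereal r2 < L" using ereal_dense2 by blast
    obtain c where "r1 < real_of_rat c" "real_of_rat c < r2" using of_rat_dense r2(1) by auto
    obtain e where "real_of_rat c < real_of_rat e" "real_of_rat e < r2"
      using of_rat_dense \<open>real_of_rat c < r2\<close> by blast
    have "\<exists>u v. u < v \<and> u \<le> x \<and> x \<le> v \<and> v - u < d \<and> f v - f u \<le> of_rat c * (v - u)" if "d > 0" for d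
    proof (rule ccontr)
      assume neg: "\<not> ?thesis"
      have "eventually (\<lambda>y. ereal (of_rat c) \<le> ereal (\<phi> y)) (at x)"
        unfolding eventually_at
      proof (intro exI[of _ d] conjI ballI impI)
        fix y assume y: "y \<noteq> x \<and> dist y x < d"
        obtain u v where uv: "u < v" "u \<le> x" "x \<le> v" "v - u = \<bar>y - x\<bar>" "f v - f u = \<phi> y * (v - u)"
          using slope y by blast
        have "v - u < d" using uv(4) y by (simp add: dist_real_def)
        then have "\<not> f v - f u \<le> of_rat c * (v - u)" using neg uv(1-3) by blast
        then have "\<not> \<phi> y * (v - u) \<le> of_rat c * (v - u)" unfolding uv(5) .
        then show "ereal (of_rat c) \<le> ereal (\<phi> y)"
          using uv(1) mult_right_mono[of "\<phi> y" "of_rat c" "v - u"] by (cases "\<phi> y \<le> of_rat c") auto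
      qed fact
      then have "ereal (of_rat c) \<le> l" unfolding l_def by (rule Liminf_bounded)
      then show False using r1 \<open>r1 < real_of_rat c\<close> by (meson ereal_less(3) less_le_trans less_ereal.simps(1) not_less order_less_trans)
    qed
    moreover have "\<exists>u v. u < v \<and> u \<le> x \<and> x \<le> v \<and> v - u < d \<and> of_rat e * (v - u) \<le> f v - f u" if "d > 0" for d
    proof (rule ccontr)
      assume neg: "\<not> ?thesis"
      have "eventually (\<lambda>y. ereal (\<phi> y) \<le> ereal (of_rat e)) (at x)"
        unfolding eventually_at
      proof (intro exI[of _ d] conjI ballI impI)
        fix y assume y: "y \<noteq> x \<and> dist y x < d"
        obtain u v where uv: "u < v" "u \<le> x" "x \<le> v" "v - u = \<bar>y - x\<bar>" "f v - f u = \<phi> y * (v - u)"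
          using slope y by blast
        have "v - u < d" using uv(4) y by (simp add: dist_real_def)
        then have "\<not> of_rat e * (v - u) \<le> f v - f u" using neg uv(1-3) by blast
        then have "\<not> of_rat e * (v - u) \<le> \<phi> y * (v - u)" unfolding uv(5) .
        then show "ereal (\<phi> y) \<le> ereal (of_rat e)"
          using uv(1) mult_right_mono[of "of_rat e" "\<phi> y" "v - u"] by (cases "of_rat e \<le> \<phi> y") auto
      qed fact
      then have "L \<le> ereal (of_rat e)" unfolding L_def by (rule Limsup_bounded)
      then show False using r2 \<open>real_of_rat e < r2\<close> by (meson less_ereal.simps(1) less_le_trans not_less order_less_trans)
    qed
    ultimately show False using assms(2)[of c e] \<open>real_of_rat c < real_of_rat e\<close> by (auto simp: of_rat_less)
  qed
  obtain l' where l': "l = ereal l'" using lM LM \<open>l = L\<close> by (cases l) auto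
  have "((\<lambda>y. ereal (\<phi> y)) \<longlongrightarrow> l) (at x)"
    using \<open>l = L\<close> unfolding l_def L_def by (subst tendsto_iff_Liminf_eq_Limsup) auto
  then have "(\<phi> \<longlongrightarrow> l') (at x)" unfolding l' by simp
  then have "(f has_field_derivative l') (at x)"
    unfolding has_field_derivative_iff \<phi>_def .
  then show ?thesis by (auto simp: real_differentiable_def)
qed

text \<open>Rational slopes keep the union of exceptional sets countable.\<close>

theorem abs_continuous_on_differentiable_ae:
  fixes f :: "real \<Rightarrow> real"
  assumes ac: "abs_continuous_on a b f"
  shows "negligible {x \<in> {a<..<b}. \<not> f differentiable (at x)}"
proof -
  define S0 where "S0 = {x \<in> {a<..<b}. \<forall>M. \<forall>d>0. \<exists>u v. u < v \<and> u \<le> x \<and> x \<le> v \<and> v - u < d \<and> M * (v - u) \<le> \<bar>f v - f u\<bar>}"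
  define S where "S q p = {x \<in> {a<..<b}.
     (\<forall>d>0. \<exists>u v. u < v \<and> u \<le> x \<and> x \<le> v \<and> v - u < d \<and> f v - f u \<le> of_rat q * (v - u)) \<and>
     (\<forall>d>0. \<exists>u v. u < v \<and> u \<le> x \<and> x \<le> v \<and> v - u < d \<and> of_rat p * (v - u) \<le> f v - f u)}" for q p :: rat
  have "negligible S0"
    by (rule negligible_infinite_slopes[OF ac]) (auto simp: S0_def)
  moreover have "negligible (S q p)" if "q < p" for q p
    by (rule negligible_opposite_slopes[OF ac, of _ "of_rat q" "of_rat p"]) (use that in \<open>auto simp: S_def of_rat_less\<close>)
  then have "negligible (\<Union>i \<in> {(q,p). q < p}. S (fst i) (snd i))"
    by (intro negligible_countable_Union) auto
  ultimately have "negligible (S0 \<union> (\<Union>i \<in> {(q,p). q < p}. S (fst i) (snd i)))"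
    by (rule negligible_Un)
  moreover have "{x \<in> {a<..<b}. \<not> f differentiable (at x)} \<subseteq> S0 \<union> (\<Union>i \<in> {(q,p). q < p}. S (fst i) (snd i))"
  proof
    fix x assume x: "x \<in> {x \<in> {a<..<b}. \<not> f differentiable (at x)}"
    show "x \<in> S0 \<union> (\<Union>i \<in> {(q,p). q < p}. S (fst i) (snd i))"
    proof (rule ccontr)
      assume n: "x \<notin> S0 \<union> (\<Union>i \<in> {(q,p). q < p}. S (fst i) (snd i))"
      have "f differentiable (at x)"
      proof (rule differentiable_if_no_exceptional_slopes)
        show "\<not> (\<forall>M. \<forall>d>0. \<exists>u v. u < v \<and> u \<le> x \<and> x \<le> v \<and> v - u < d \<and> M * (v - u) \<le> \<bar>f v - f u\<bar>)"
          using x n unfolding S0_def by blast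
        fix p q :: rat assume "q < p"
        then have "x \<notin> S q p" using n by force
        then show "\<not> ((\<forall>d>0. \<exists>u v. u < v \<and> u \<le> x \<and> x \<le> v \<and> v - u < d \<and> f v - f u \<le> of_rat q * (v - u)) \<and>
         (\<forall>d>0. \<exists>u v. u < v \<and> u \<le> x \<and> x \<le> v \<and> v - u < d \<and> of_rat p * (v - u) \<le> f v - f u))"
          using x unfolding S_def by blast
      qed
      with x show False by blast
    qed
  qed
  ultimately show ?thesis by (rule negligible_subset)
qed

section \<open>The fundamental theorem of calculus\<close>

text \<open>Two kinds of tags are estimated separately. At a tag outside N the derivative makes the
  error at most e' times the length. Pieces tagged in N lie in an open set of measure below
  \<delta>, where absolute continuity bounds all increments together by e/2.\<close>

lemma abs_continuous_on_has_integral: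
  fixes f g :: "real \<Rightarrow> real"
  assumes ac: "abs_continuous_on a b f" and "a \<le> b" and N: "negligible N"
    and der: "\<And>t. t \<in> {a..b} - N \<Longrightarrow> (f has_vector_derivative g t) (at t within {a..b})"
  shows "(g has_integral (f b - f a)) {a..b}"
proof -
  \<comment> \<open>With value 0 on N, a tag in N contributes only the increment of f to the
    error.\<close>
  define g0 where "g0 t = (if t \<in> N then 0 else g t)" for t
  have "(g0 has_integral (f b - f a)) {a..b}"
    unfolding has_integral_real
  proof (intro allI impI)
    fix e :: real assume "e > 0"
    \<comment> \<open>The summand 1 covers the case a = b.\<close>
    define e' where "e' = e / (2 * (b - a + 1))"
    have "e' > 0" using \<open>e > 0\<close> \<open>a \<le> b\<close> by (simp add: e'_def)
    have "\<exists>d>0. t \<in> {a..b} - N \<longrightarrow> (\<forall>y\<in>{a..b}. norm (y - t) < d \<longrightarrow>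
           norm (f y - f t - (y - t) *\<^sub>R g t) \<le> e' * norm (y - t))" for t
      using der[of t, unfolded has_vector_derivative_def has_derivative_within_alt] \<open>e' > 0\<close>
      by (cases "t \<in> {a..b} - N") (auto intro: exI[of _ 1])
    then obtain d where d: "\<And>t. 0 < d t" "\<And>t y. \<lbrakk>t \<in> {a..b} - N; y \<in> {a..b}; norm (y - t) < d t\<rbrakk> \<Longrightarrow>
           norm (f y - f t - (y - t) *\<^sub>R g t) \<le> e' * norm (y - t)" by metis
    obtain \<delta> where "\<delta> > 0" and \<delta>: "\<And>A u v. \<lbrakk>finite A; \<And>i. i \<in> A \<Longrightarrow> a \<le> u i \<and> u i \<le> v i \<and> v i \<le> b;
        disjoint_family_on (\<lambda>i::real \<times> real set. {u i<..<v i}) A; (\<Sum>i\<in>A. v i - u i) < \<delta>\<rbrakk>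
      \<Longrightarrow> (\<Sum>i\<in>A. norm (f (v i) - f (u i))) < e / 2"
      using abs_continuous_on_family[OF ac half_gt_zero[OF \<open>e > 0\<close>]] by blast
    obtain A where A: "N \<subseteq> A" "A \<in> lmeasurable" "measure lebesgue A < \<delta>"
      using N \<open>\<delta> > 0\<close> unfolding negligible_outer by blast
    obtain U where U: "open U" "U \<in> lmeasurable" "N \<subseteq> U" "measure lebesgue U < \<delta>"
      using outer_measure_open[OF A(2,1,3) open_UNIV] by auto
    have "\<exists>h>0. t \<in> N \<longrightarrow> ball t h \<subseteq> U" for t
      using U(1,3) by (cases "t \<in> N") (auto simp: open_contains_ball intro: exI[of _ 1])
    then obtain h where h: "\<And>t. h t > 0" "\<And>t. t \<in> N \<Longrightarrow> ball t (h t) \<subseteq> U" by metis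
    define \<gamma> where "\<gamma> t = ball t (min (d t) (h t))" for t
    have gauge: "gauge \<gamma>" unfolding \<gamma>_def by (rule gauge_ball_dependent) (use d(1) h(1) in auto)
    have bound: "norm ((\<Sum>(x,K)\<in>D. measure lborel K *\<^sub>R g0 x) - (f b - f a)) < e"
      if D: "D tagged_division_of {a..b}" and fine: "\<gamma> fine D" for D
    proof -
      have finD: "finite D" using D by blast
      have KD: "x \<in> K" "K = {Inf K..Sup K}" "Inf K \<le> Sup K" "K \<subseteq> {a..b}" "K \<subseteq> \<gamma> x"
        "interior K = {Inf K<..<Sup K}" "measure lborel K = Sup K - Inf K" if xK: "(x,K) \<in> D" for x K
      proof -
        obtain u v where "K = cbox u v" "x \<in> K" "K \<subseteq> {a..b}"
          using tagged_division_ofD(2-4)[OF D xK] by blast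
        then show "x \<in> K" "K = {Inf K..Sup K}" "Inf K \<le> Sup K" "K \<subseteq> {a..b}"
          "interior K = {Inf K<..<Sup K}" "measure lborel K = Sup K - Inf K" by auto
        show "K \<subseteq> \<gamma> x" using fine xK by (auto simp: fine_def)
      qed
      define DN where "DN = {i \<in> D. fst i \<in> N}"
      define r where "r i = measure lborel (snd i) *\<^sub>R g0 (fst i) - (f (Sup (snd i)) - f (Inf (snd i)))" for i
      have "(\<Sum>(x,K)\<in>D. measure lborel K *\<^sub>R g0 x) - (f b - f a) = sum r D"
        using additive_tagged_division_1[OF \<open>a \<le> b\<close> D, of f]
        by (simp add: r_def sum_subtractf case_prod_beta)
      also have "\<dots> = sum r (D - DN) + sum r DN"
        by (rule sum.subset_diff) (auto simp: DN_def finD)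
      also have "norm \<dots> \<le> norm (sum r (D - DN)) + norm (sum r DN)" by (rule norm_triangle_ineq)
      also have "norm (sum r (D - DN)) \<le> (\<Sum>i\<in>D - DN. e' * (Sup (snd i) - Inf (snd i)))"
      proof (rule sum_norm_le)
        fix i assume i: "i \<in> D - DN"
        obtain x K where xK: "i = (x,K)" "(x,K) \<in> D" "x \<notin> N" using i by (cases i) (auto simp: DN_def)
        define u v where "u = Inf K" and "v = Sup K"
        have K: "x \<in> {u..v}" "u \<le> v" "K = {u..v}" using KD(1-3)[OF xK(2)] by (auto simp: u_def v_def)
        have x: "x \<in> {a..b} - N" using KD(1,4)[OF xK(2)] xK(3) by auto
        have "u \<in> K" "v \<in> K" using K by auto
        then have uv: "u \<in> {a..b}" "v \<in> {a..b}" "norm (u - x) < d x" "norm (v - x) < d x"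
          using KD(4,5)[OF xK(2)] by (auto simp: \<gamma>_def subset_iff dist_real_def)
        have "norm ((f v - f x - (v - x) *\<^sub>R g x) - (f u - f x - (u - x) *\<^sub>R g x)) \<le>
          e' * norm (v - x) + e' * norm (u - x)"
          using d(2)[OF x uv(2,4)] d(2)[OF x uv(1,3)] by (rule order_trans[OF norm_triangle_ineq4 add_mono])
        also have "\<dots> = e' * (v - u)" using K(1) by (simp add: algebra_simps)
        finally have "norm ((v - u) *\<^sub>R g x - (f v - f u)) \<le> e' * (v - u)"
          by (simp add: algebra_simps norm_minus_commute)
        then show "norm (r i) \<le> e' * (Sup (snd i) - Inf (snd i))"
          using KD(7)[OF xK(2)] xK by (simp add: r_def g0_def u_def v_def)
      qed
      also have "\<dots> \<le> (\<Sum>i\<in>D. e' * (Sup (snd i) - Inf (snd i)))"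
        using finD KD(3) \<open>e' > 0\<close> by (intro sum_mono2) auto
      also have "\<dots> = e' * (b - a)"
        using additive_tagged_division_1[OF \<open>a \<le> b\<close> D, of "\<lambda>x. x"]
        by (simp add: sum_distrib_left[symmetric] case_prod_beta)
      also have "\<dots> \<le> e / 2" using \<open>e > 0\<close> \<open>a \<le> b\<close> by (simp add: e'_def field_simps)
      also have "norm (sum r DN) \<le> (\<Sum>i\<in>DN. norm (f (Sup (snd i)) - f (Inf (snd i))))"
        by (rule sum_norm_le) (auto simp: DN_def r_def g0_def)
      also have "\<dots> < e / 2"
      proof (rule \<delta>)
        show "finite DN" using finD by (simp add: DN_def)
        have bnd: "a \<le> Inf (snd i) \<and> Inf (snd i) \<le> Sup (snd i) \<and> Sup (snd i) \<le> b \<and> {Inf (snd i)<..<Sup (snd i)} \<subseteq> U"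
          if i: "i \<in> DN" for i
        proof -
          obtain x K where xK: "i = (x,K)" "(x,K) \<in> D" "x \<in> N" using i by (cases i) (auto simp: DN_def)
          have "Inf K \<in> K" "Sup K \<in> K" using KD(2,3)[OF xK(2)] by (metis atLeastAtMost_iff order_refl)+
          then have "a \<le> Inf K" "Sup K \<le> b" using KD(4)[OF xK(2)] by auto
          moreover have "K \<subseteq> U" using KD(5)[OF xK(2)] h(2)[OF xK(3)] by (auto simp: \<gamma>_def subset_iff)
          then have "{Inf K<..<Sup K} \<subseteq> U" using KD(6)[OF xK(2)] interior_subset by blast
          ultimately show ?thesis using KD(3)[OF xK(2)] xK(1) by simp
        qed
        then show "a \<le> Inf (snd i) \<and> Inf (snd i) \<le> Sup (snd i) \<and> Sup (snd i) \<le> b" if "i \<in> DN" for i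
          using that by blast
        show dj: "disjoint_family_on (\<lambda>i. {Inf (snd i)<..<Sup (snd i)}) DN"
          unfolding disjoint_family_on_def
        proof (intro ballI impI)
          fix i j assume "i \<in> DN" "j \<in> DN" "i \<noteq> j"
          then obtain x K y L where ij: "i = (x,K)" "(x,K) \<in> D" "j = (y,L)" "(y,L) \<in> D" "(x,K) \<noteq> (y,L)"
            by (cases i, cases j) (auto simp: DN_def)
          show "{Inf (snd i)<..<Sup (snd i)} \<inter> {Inf (snd j)<..<Sup (snd j)} = {}"
            using tagged_division_ofD(5)[OF D ij(2,4,5)] KD(6)[OF ij(2)] KD(6)[OF ij(4)] ij by simp
        qed
        have "(\<Sum>i\<in>DN. Sup (snd i) - Inf (snd i)) \<le> measure lebesgue U"
          using \<open>finite DN\<close> bnd dj U(2) by (intro sum_lengths_le_measure) auto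
        then show "(\<Sum>i\<in>DN. Sup (snd i) - Inf (snd i)) < \<delta>" using U(4) by linarith
      qed
      finally show ?thesis by simp
    qed
    show "\<exists>\<gamma>. gauge \<gamma> \<and> (\<forall>D. D tagged_division_of {a..b} \<and> \<gamma> fine D \<longrightarrow>
        norm ((\<Sum>(x,K)\<in>D. measure lborel K *\<^sub>R g0 x) - (f b - f a)) < e)"
    proof (intro exI conjI allI impI)
      show "gauge \<gamma>" by (rule gauge)
      fix D assume "D tagged_division_of {a..b} \<and> \<gamma> fine D"
      then show "norm ((\<Sum>(x,K)\<in>D. measure lborel K *\<^sub>R g0 x) - (f b - f a)) < e"
        by (elim conjE) (rule bound)
    qed
  qed
  then show ?thesis
    by (rule has_integral_spike[OF N, rotated]) (auto simp: g0_def)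
qed

text \<open>Absolute continuity bounds the variation by 1 only over total length below \<delta>. So
  integrability is shown on intervals shorter than \<delta>, and [a, b] is reached in steps of
  length \<delta>/2.\<close>

lemma abs_continuous_on_derivative_absolutely_integrable:
  fixes f g :: "real \<Rightarrow> real"
  assumes ac: "abs_continuous_on a b f" and "a \<le> b" and N: "negligible N"
    and der: "\<And>t. t \<in> {a..b} - N \<Longrightarrow> (f has_vector_derivative g t) (at t within {a..b})"
  shows "g absolutely_integrable_on {a..b}"
proof -
  obtain \<delta> where "\<delta> > 0" and \<delta>: "\<And>A u v. \<lbrakk>finite A; \<And>i. i \<in> A \<Longrightarrow> a \<le> u i \<and> u i \<le> v i \<and> v i \<le> b;
      disjoint_family_on (\<lambda>i::real set. {u i<..<v i}) A; (\<Sum>i\<in>A. v i - u i) < \<delta>\<rbrakk>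
    \<Longrightarrow> (\<Sum>i\<in>A. norm (f (v i) - f (u i))) < 1"
    using abs_continuous_on_family[OF ac zero_less_one] by blast
  have int: "(g has_integral (f d - f c)) {c..d}" if "a \<le> c" "c \<le> d" "d \<le> b" for c d
  proof (rule abs_continuous_on_has_integral[OF _ \<open>c \<le> d\<close> N])
    show "abs_continuous_on c d f" using abs_continuous_on_subinterval[OF ac] that by blast
    show "(f has_vector_derivative g t) (at t within {c..d})" if "t \<in> {c..d} - N" for t
      by (rule has_vector_derivative_within_subset[OF der])
         (use that \<open>a \<le> c\<close> \<open>d \<le> b\<close> in auto)
  qed
  have small: "g absolutely_integrable_on {c..d}" if cd: "a \<le> c" "c \<le> d" "d \<le> b" "d - c < \<delta>" for c d
    unfolding box_real(2)[symmetric]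
  proof (rule bounded_variation_absolutely_integrable_interval[where B=1])
    show "g integrable_on cbox c d" using int[OF cd(1-3)] by auto
    fix D assume "D division_of cbox c d"
    then have D: "D division_of {c..d}" by simp
    note Dint = division_interval[OF D]
    have KI: "c \<le> Inf K \<and> Inf K \<le> Sup K \<and> Sup K \<le> d" if "K \<in> D" for K
    proof -
      have "Inf K \<in> K" "Sup K \<in> K" using Dint(1,2)[OF that] by (metis atLeastAtMost_iff order_refl)+
      then show ?thesis using division_ofD(2)[OF D that] Dint(2)[OF that] by auto
    qed
    have "(\<Sum>K\<in>D. norm (integral K g)) = (\<Sum>K\<in>D. norm (f (Sup K) - f (Inf K)))"
    proof (rule sum.cong[OF refl])
      fix K assume K: "K \<in> D"
      have "integral {Inf K..Sup K} g = f (Sup K) - f (Inf K)"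
        using KI[OF K] cd by (intro integral_unique int) auto
      then show "norm (integral K g) = norm (f (Sup K) - f (Inf K))" using Dint(1)[OF K] by simp
    qed
    also have "\<dots> < 1"
    proof (rule \<delta>)
      show "finite D" using D by blast
      show "a \<le> Inf K \<and> Inf K \<le> Sup K \<and> Sup K \<le> b" if "K \<in> D" for K using KI[OF that] cd by auto
      show "disjoint_family_on (\<lambda>K. {Inf K<..<Sup K}) D" by (rule division_disjoint_family[OF D])
      show "(\<Sum>K\<in>D. Sup K - Inf K) < \<delta>"
        using division_sum_increments[OF D cd(2), of "\<lambda>x. x"] cd(4) by simp
    qed
    finally show "(\<Sum>K\<in>D. norm (integral K g)) \<le> 1" by simp
  qed
  define h where "h = \<delta> / 2"
  have "h > 0" "h < \<delta>" using \<open>\<delta> > 0\<close> by (simp_all add: h_def)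
  have step: "g absolutely_integrable_on {a..min b (a + real n * h)}" for n
  proof (induction n)
    case 0
    show ?case using small[of a a] \<open>\<delta> > 0\<close> \<open>a \<le> b\<close> by (simp add: min_def)
  next
    case (Suc n)
    define c where "c = min b (a + real n * h)"
    define d where "d = min b (a + real (Suc n) * h)"
    have le: "a + real n * h \<le> a + real (Suc n) * h" "a \<le> a + real n * h" "a + real (Suc n) * h = a + real n * h + h"
      using \<open>h > 0\<close> by (auto simp: algebra_simps)
    have cd: "a \<le> c" "c \<le> d" "d \<le> b" "d - c < \<delta>"
      using le \<open>h < \<delta>\<close> \<open>a \<le> b\<close> \<open>h > 0\<close> unfolding c_def d_def by (auto simp: min_def)
    have "g absolutely_integrable_on ({a..c} \<union> {c..d})"
      using Suc small[OF cd] unfolding c_def[symmetric] by (intro set_integrable_Un) auto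
    moreover have "{a..c} \<union> {c..d} = {a..d}" using cd by auto
    ultimately show ?case by (simp add: d_def)
  qed
  obtain n :: nat where "(b - a) / h < real n" using reals_Archimedean2 by blast
  then have "min b (a + real n * h) = b" using \<open>h > 0\<close> by (simp add: field_simps)
  then show ?thesis using step[of n] by simp
qed

text \<open>A path is differentiable where all its coordinates are. The endpoints join the null set
  because the derivative is two-sided.\<close>

lemma abs_continuous_on_vector_derivative_ae:
  fixes q :: "real \<Rightarrow> 'a::euclidean_space"
  assumes ac: "abs_continuous_on a b q"
  shows "negligible {t \<in> {a..b}. \<not> (q has_vector_derivative vector_derivative q (at t)) (at t)}"
proof -
  have "negligible {t \<in> {a<..<b}. \<not> (\<lambda>t. q t \<bullet> i) differentiable (at t)}" for i
    by (intro abs_continuous_on_differentiable_ae abs_continuous_on_bounded_linear[OF ac]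
        bounded_linear_inner_left)
  then have "negligible ({a, b} \<union> (\<Union>i\<in>Basis. {t \<in> {a<..<b}. \<not> (\<lambda>t. q t \<bullet> i) differentiable (at t)}))"
    by (intro negligible_Un negligible_countable_Union) (auto intro: countable_finite)
  then show ?thesis
  proof (rule negligible_subset)
    show "{t \<in> {a..b}. \<not> (q has_vector_derivative vector_derivative q (at t)) (at t)} \<subseteq>
      {a, b} \<union> (\<Union>i\<in>Basis. {t \<in> {a<..<b}. \<not> (\<lambda>t. q t \<bullet> i) differentiable (at t)})"
    proof
      fix t assume t: "t \<in> {t \<in> {a..b}. \<not> (q has_vector_derivative vector_derivative q (at t)) (at t)}"
      then have "\<not> q differentiable (at t)" by (simp add: vector_derivative_works)
      then have "\<exists>i\<in>Basis. \<not> (\<lambda>t. q t \<bullet> i) differentiable (at t)"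
        using differentiable_componentwise_within by blast
      then show "t \<in> {a, b} \<union> (\<Union>i\<in>Basis. {t \<in> {a<..<b}. \<not> (\<lambda>t. q t \<bullet> i) differentiable (at t)})"
        using t by auto
    qed
  qed
qed

theorem abs_continuous_on_FTC:
  fixes q :: "real \<Rightarrow> 'a::euclidean_space"
  assumes ac: "abs_continuous_on a b q" and cd: "a \<le> c" "c \<le> d" "d \<le> b"
  shows "(\<lambda>t. w \<bullet> vector_derivative q (at t)) absolutely_integrable_on {c..d}"
    and "((\<lambda>t. w \<bullet> vector_derivative q (at t)) has_integral (w \<bullet> q d - w \<bullet> q c)) {c..d}"
proof -
  let ?N = "{t \<in> {a..b}. \<not> (q has_vector_derivative vector_derivative q (at t)) (at t)}"
  have N: "negligible ?N" by (rule abs_continuous_on_vector_derivative_ae[OF ac])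
  have ac': "abs_continuous_on c d (\<lambda>t. w \<bullet> q t)"
    by (intro abs_continuous_on_bounded_linear[OF abs_continuous_on_subinterval[OF ac]]
        bounded_linear_inner_right) (use cd in auto)
  have der: "((\<lambda>t. w \<bullet> q t) has_vector_derivative w \<bullet> vector_derivative q (at t)) (at t within {c..d})"
    if "t \<in> {c..d} - ?N" for t
  proof -
    have "(q has_vector_derivative vector_derivative q (at t)) (at t)" using that cd by auto
    then show ?thesis
      by (rule has_vector_derivative_at_within[OF
            bounded_linear.has_vector_derivative[OF bounded_linear_inner_right]])
  qed
  show "(\<lambda>t. w \<bullet> vector_derivative q (at t)) absolutely_integrable_on {c..d}"
    by (rule abs_continuous_on_derivative_absolutely_integrable[OF ac' cd(2) N der])
  show "((\<lambda>t. w \<bullet> vector_derivative q (at t)) has_integral (w \<bullet> q d - w \<bullet> q c)) {c..d}"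
    by (rule abs_continuous_on_has_integral[OF ac' cd(2) N der])
qed

section \<open>Faces, velocities and the local Lagrangian\<close>

text \<open>The weight \<open>m\<close> carries the maximum principle for \<open>P\<close>.\<close>

locale stable_network =
  fixes P :: "real^'n^'n" and lam \<mu> \<nu> m :: "real^'n"
  assumes P_nonneg: "0 \<le> P $ k $ l"
    and P_row: "(\<Sum>l\<in>UNIV. P $ k $ l) \<le> 1"
    and lam_pos: "0 < lam $ k"
    and \<nu>_pos: "0 < \<nu> $ k"
    and \<nu>_less: "\<nu> $ k < \<mu> $ k"
    and traffic: "\<nu> $ l = lam $ l + (\<Sum>k\<in>UNIV. \<nu> $ k * P $ k $ l)"
    and m_pos: "0 < m $ k"
    and m_super: "(P *v m) $ k < m $ k"
begin

section \<open>The maximum principle for P\<close>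

lemma P_apply: "(P *v z) $ k = (\<Sum>l\<in>UNIV. P $ k $ l * z $ l)"
  by (simp add: matrix_vector_mult_def)

lemma P_mono: "(\<And>k. u $ k \<le> w $ k) \<Longrightarrow> (P *v u) $ k \<le> (P *v w) $ k"
  unfolding P_apply by (intro sum_mono mult_left_mono P_nonneg)

text \<open>Let c be the minimum of u/m, attained at j. If c < 0, then j is in J, and u \<ge> c m
  gives (P u)_j \<ge> c (P m)_j > c m_j = u_j, against superharmonicity at j.\<close>

lemma comparison:
  assumes super: "\<And>k. k \<in> J \<Longrightarrow> (P *v u) $ k \<le> u $ k" and off: "\<And>k. k \<notin> J \<Longrightarrow> 0 \<le> u $ k"
  shows "0 \<le> u $ k"
proof (rule ccontr)
  assume "\<not> 0 \<le> u $ k"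
  define c where "c = Min (range (\<lambda>k. u $ k / m $ k))"
  have c_le: "c \<le> u $ j / m $ j" for j unfolding c_def by (intro Min_le) auto
  have "u $ k / m $ k < 0" using \<open>\<not> 0 \<le> u $ k\<close> m_pos[of k] by (simp add: divide_neg_pos)
  then have "c < 0" using c_le[of k] by linarith
  have "c \<in> range (\<lambda>k. u $ k / m $ k)" unfolding c_def by (intro Min_in) auto
  then obtain j where "c = u $ j / m $ j" by blast
  then have j: "u $ j = c * m $ j" using m_pos[of j] by simp
  have "u $ j < 0" using j \<open>c < 0\<close> m_pos[of j] by (simp add: mult_neg_pos)
  then have "(P *v u) $ j \<le> c * m $ j" using super[of j] off[of j] j by force
  moreover have "(c *s m) $ l \<le> u $ l" for l
    using c_le[of l] m_pos[of l] by (simp add: pos_le_divide_eq)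
  then have "(P *v (c *s m)) $ j \<le> (P *v u) $ j" by (rule P_mono)
  then have "c * (P *v m) $ j \<le> (P *v u) $ j" by (simp add: P_apply sum_distrib_left mult.left_commute)
  moreover have "c * m $ j < c * (P *v m) $ j" using m_super[of j] \<open>c < 0\<close> by simp
  ultimately show False by linarith
qed

text \<open>The system is square, so injectivity suffices; it follows from \<open>comparison\<close>
  applied to a solution of the homogeneous problem and to its negative.\<close>

lemma dirichlet_problem: "\<exists>z. \<forall>k. z $ k = (if k \<in> J then (P *v z) $ k else 0) + g $ k"
proof -
  define A :: "real^'n \<Rightarrow> real^'n" where "A z = (\<chi> k. z $ k - (if k \<in> J then (P *v z) $ k else 0))" for z
  have lin: "linear A"
    by (rule linearI)
       (auto simp: A_def vec_eq_iff matrix_vector_right_distrib matrix_vector_mult_scaleR algebra_simps)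
  have "z = 0" if "A z = 0" for z
  proof -
    have z: "z $ k = (if k \<in> J then (P *v z) $ k else 0)" for k
      using that by (simp add: A_def vec_eq_iff)
    have "0 \<le> z $ k" for k by (rule comparison[of J]) (use z in \<open>auto split: if_splits\<close>)
    moreover have "0 \<le> (- z) $ k" for k
    proof (rule comparison[of J])
      fix j
      have "(P *v (- z)) $ j = - (P *v z) $ j" by (simp add: P_apply sum_negf)
      then show "(P *v (- z)) $ j \<le> (- z) $ j" if "j \<in> J"
        using z[of j] that unfolding vector_uminus_component by argo
      show "0 \<le> (- z) $ j" if "j \<notin> J"
        using z[of j] that unfolding vector_uminus_component by argo
    qed
    ultimately show ?thesis by (simp add: vec_eq_iff order_antisym)
  qed
  then have "inj A" using lin by (simp add: linear_injective_0)
  then have "surj A" using lin linear_injective_imp_surjective by blast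
  then obtain z where "A z = g" by (metis surjD)
  then have "A z $ k = g $ k" for k by simp
  then have "z $ k - (if k \<in> J then (P *v z) $ k else 0) = g $ k" for k
    unfolding A_def vec_lambda_beta .
  then have "z $ k = g $ k + (if k \<in> J then (P *v z) $ k else 0)" for k
    unfolding diff_eq_eq .
  then have "z $ k = (if k \<in> J then (P *v z) $ k else 0) + g $ k" for k
    by (rule trans[OF _ add.commute])
  then show ?thesis by blast
qed

section \<open>The harmonic function of a face and its velocity\<close>

definition \<zeta> :: "'n \<Rightarrow> real" where "\<zeta> k = \<mu> $ k / \<nu> $ k - 1"

definition harmonic :: "'n set \<Rightarrow> real^'n" where
  "harmonic J = (SOME z. \<forall>k. z $ k = (if k \<in> J then (P *v z) $ k else \<zeta> k))"

definition velocity :: "'n set \<Rightarrow> real^'n" where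
  "velocity J = (\<chi> k. \<nu> $ k * (harmonic J $ k - (P *v harmonic J) $ k))"

definition good :: "'n set \<Rightarrow> bool" where
  "good J \<longleftrightarrow> (\<forall>k. harmonic J $ k \<le> \<zeta> k)"

definition \<alpha> :: "real^'n" where "\<alpha> = (\<chi> k. ln (1 + \<zeta> k))"

lemma \<zeta>_pos: "0 < \<zeta> k"
  using \<nu>_pos[of k] \<nu>_less[of k] by (simp add: \<zeta>_def)

lemma \<mu>_eq: "\<mu> $ k = \<nu> $ k * (1 + \<zeta> k)"
  using \<nu>_pos[of k] by (simp add: \<zeta>_def)

lemma \<alpha>_pos: "0 < \<alpha> $ k"
  using \<zeta>_pos[of k] by (simp add: \<alpha>_def)

lemma harmonic: "harmonic J $ k = (if k \<in> J then (P *v harmonic J) $ k else \<zeta> k)"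
proof -
  obtain z where "\<forall>k. z $ k = (if k \<in> J then (P *v z) $ k else 0) + (\<chi> k. if k \<in> J then 0 else \<zeta> k) $ k"
    using dirichlet_problem by blast
  then have "\<exists>z. \<forall>k. z $ k = (if k \<in> J then (P *v z) $ k else \<zeta> k)" by (auto split: if_splits)
  then have "\<forall>k. harmonic J $ k = (if k \<in> J then (P *v harmonic J) $ k else \<zeta> k)"
    unfolding harmonic_def by (rule someI_ex)
  then show ?thesis by blast
qed

lemma harmonic_nonneg: "0 \<le> harmonic J $ k"
  by (rule comparison[of J]) (use harmonic[of J] \<zeta>_pos in \<open>auto simp: less_imp_le\<close>)

text \<open>The difference with \<open>harmonic J\<close> satisfies the hypotheses of
  \<open>comparison\<close>. This is how goodness passes from one face to another.\<close>

lemma harmonic_le_supersolution: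
  assumes "\<And>k. k \<in> J \<Longrightarrow> (P *v u) $ k \<le> u $ k" "\<And>k. k \<notin> J \<Longrightarrow> \<zeta> k \<le> u $ k"
  shows "harmonic J $ k \<le> u $ k"
proof -
  have "0 \<le> (u - harmonic J) $ k"
    by (rule comparison[of J])
       (use assms harmonic[of J] in \<open>auto simp: matrix_vector_mult_diff_distrib\<close>)
  then show ?thesis by simp
qed

lemma velocity_on: "k \<in> J \<Longrightarrow> velocity J $ k = 0"
  using harmonic[of J k] by (simp add: velocity_def)

text \<open>The traffic equation says lam = (I - P^T) \<nu>; here I - P is moved to the other
  factor. It matches the arrival term of the Hamiltonian with its service terms.\<close>

lemma traffic_dual: "(\<Sum>k\<in>UNIV. lam $ k * u $ k) = (\<Sum>k\<in>UNIV. \<nu> $ k * (u $ k - (P *v u) $ k))"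
proof -
  have "(\<Sum>k\<in>UNIV. \<nu> $ k * (P *v u) $ k) = (\<Sum>k\<in>UNIV. \<Sum>l\<in>UNIV. \<nu> $ k * P $ k $ l * u $ l)"
    by (simp add: P_apply sum_distrib_left mult.assoc)
  also have "\<dots> = (\<Sum>l\<in>UNIV. (\<Sum>k\<in>UNIV. \<nu> $ k * P $ k $ l) * u $ l)"
    by (subst sum.swap) (simp add: sum_distrib_right)
  also have "\<dots> = (\<Sum>l\<in>UNIV. (\<nu> $ l - lam $ l) * u $ l)"
  proof (rule sum.cong[OF refl])
    fix l
    have "(\<Sum>k\<in>UNIV. \<nu> $ k * P $ k $ l) = \<nu> $ l - lam $ l" using traffic[of l] by linarith
    then show "(\<Sum>k\<in>UNIV. \<nu> $ k * P $ k $ l) * u $ l = (\<nu> $ l - lam $ l) * u $ l" by (simp only:)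
  qed
  finally show ?thesis by (simp add: algebra_simps sum_subtractf)
qed

text \<open>The logarithmic substitution removes the exponentials. It also shows that on J the
  positive part of \<open>h_node\<close> switches on exactly where z fails to be
  superharmonic.\<close>

lemma h_node_ln:
  assumes "\<And>k. 0 < 1 + z $ k"
  shows "h_node P k (\<chi> k. ln (1 + z $ k)) = ((P *v z) $ k - z $ k) / (1 + z $ k)"
proof -
  have "exp (ln (1 + z $ l)) = 1 + z $ l" for l using assms by simp
  moreover have "1 + z $ k \<noteq> 0" using assms[of k] by simp
  ultimately show ?thesis
    by (simp add: h_node_def P_apply exp_minus) (simp add: field_simps)
qed

lemma H_face_ln:
  assumes "\<And>k. 0 < 1 + z $ k"
  shows "H_face P lam \<mu> J (\<chi> k. ln (1 + z $ k)) =
    (\<Sum>k\<in>UNIV. lam $ k * z $ k)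
     + (\<Sum>k\<in>J. max (((P *v z) $ k - z $ k) / (1 + z $ k)) 0 * \<mu> $ k)
     + (\<Sum>k\<in>-J. ((P *v z) $ k - z $ k) / (1 + z $ k) * \<mu> $ k)"
proof -
  have "exp (ln (1 + z $ l)) = 1 + z $ l" for l using assms by simp
  then show ?thesis unfolding H_face_def h_node_ln[OF assms] by (simp add: mult.commute)
qed

lemma sum_off: "(\<Sum>k\<in>UNIV. f k) = (\<Sum>k\<in>J. f k) + (\<Sum>k\<in>-J. f k)" for f :: "'n \<Rightarrow> real"
  using sum.union_disjoint[of J "-J" f] by (simp add: Compl_partition)

section \<open>The bound on the local Lagrangian and its equality case\<close>

definition \<theta> :: "'n set \<Rightarrow> real^'n" where "\<theta> J = (\<chi> k. ln (1 + harmonic J $ k))"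

lemma \<theta>_inner:
  assumes "\<And>k. k \<in> J \<Longrightarrow> y $ k = 0"
  shows "\<theta> J \<bullet> y = \<alpha> \<bullet> y"
  unfolding inner_vec_def
  by (rule sum.cong) (use assms harmonic[of J] in \<open>auto simp: \<theta>_def \<alpha>_def\<close>)

text \<open>On J all terms vanish by harmonicity. Off J the rate \<mu>_k equals \<nu>_k (1 + z_k),
  so the service terms cancel the arrival terms rewritten by \<open>traffic_dual\<close>.\<close>

lemma H_face_\<theta>: "H_face P lam \<mu> J (\<theta> J) = 0"
proof -
  let ?z = "harmonic J"
  have pos: "0 < 1 + ?z $ k" for k using harmonic_nonneg[of J k] by linarith
  have "(\<Sum>k\<in>J. max (((P *v ?z) $ k - ?z $ k) / (1 + ?z $ k)) 0 * \<mu> $ k) = 0"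
    by (rule sum.neutral) (use harmonic[of J] in auto)
  moreover have "(\<Sum>k\<in>-J. ((P *v ?z) $ k - ?z $ k) / (1 + ?z $ k) * \<mu> $ k) =
      (\<Sum>k\<in>-J. \<nu> $ k * ((P *v ?z) $ k - ?z $ k))"
  proof (rule sum.cong[OF refl])
    fix k assume "k \<in> -J"
    then have "?z $ k = \<zeta> k" using harmonic[of J k] by simp
    then show "((P *v ?z) $ k - ?z $ k) / (1 + ?z $ k) * \<mu> $ k = \<nu> $ k * ((P *v ?z) $ k - ?z $ k)"
      using \<mu>_eq[of k] pos[of k] by simp
  qed
  moreover have "(\<Sum>k\<in>J. \<nu> $ k * (?z $ k - (P *v ?z) $ k)) = 0"
    by (rule sum.neutral) (use harmonic[of J] in auto)
  ultimately show ?thesis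
    unfolding \<theta>_def H_face_ln[OF pos] traffic_dual[of ?z] sum_off[of _ J]
    by (simp add: sum.distrib[symmetric] algebra_simps)
qed

lemma L_face_ge:
  assumes "\<And>k. k \<in> J \<Longrightarrow> y $ k = 0"
  shows "ereal (\<alpha> \<bullet> y) \<le> L_face P lam \<mu> J y"
proof -
  have "ereal (\<theta> J \<bullet> y - H_face P lam \<mu> J (\<theta> J)) \<le> L_face P lam \<mu> J y"
    unfolding L_face_def by (rule SUP_upper) simp
  then show ?thesis by (simp add: H_face_\<theta> \<theta>_inner[OF assms])
qed

text \<open>Each exponential is bounded below by its tangent at \<theta> J, and the linear parts add
  up to the inner product with the velocity. Goodness is what controls J: it says \<nu>_k w_k \<le>
  \<mu>_k, so \<mu>_k times the positive part of \<open>h_node\<close> dominates \<nu>_k w_k times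
  \<open>h_node\<close>.\<close>

lemma H_face_subgradient:
  assumes "good J"
  shows "(t - \<theta> J) \<bullet> velocity J \<le> H_face P lam \<mu> J t"
proof -
  define z where "z = harmonic J"
  define w where "w k = 1 + z $ k" for k
  define \<eta> where "\<eta> k = t $ k - \<theta> J $ k" for k
  \<comment> \<open>u is the first-order change of z = exp \<theta> - 1 when \<theta> moves by
    \<eta>.\<close>
  define u where "u = (\<chi> k. w k * \<eta> k)"
  have w_pos: "0 < w k" for k using harmonic_nonneg[of J k] by (simp add: w_def z_def)
  have e: "exp (t $ k) = w k * exp (\<eta> k)" for k
    using w_pos[of k] by (simp add: \<eta>_def \<theta>_def z_def[symmetric] w_def[symmetric] exp_diff)
  have e': "w k * exp (- t $ k) = exp (- \<eta> k)" for k
    using w_pos[of k] by (simp add: exp_minus e)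
  have lam_part: "lam $ k * (z $ k + u $ k) \<le> (exp (t $ k) - 1) * lam $ k" for k
  proof -
    have "w k * (1 + \<eta> k) \<le> w k * exp (\<eta> k)"
      using w_pos[of k] by (intro mult_left_mono exp_ge_add_one_self) auto
    then have "z $ k + u $ k \<le> exp (t $ k) - 1" by (simp add: e u_def w_def algebra_simps)
    then show ?thesis using lam_pos[of k] by (metis less_imp_le mult.commute mult_left_mono)
  qed
  have node_part: "\<nu> $ k * ((P *v z) $ k - z $ k + (P *v u) $ k - \<eta> k * (1 + (P *v z) $ k)) \<le> \<nu> $ k * (w k * h_node P k t)" for k
  proof (rule mult_left_mono)
    show "0 \<le> \<nu> $ k" using \<nu>_pos[of k] by simp
    \<comment> \<open>w_k (h_k + 1) is a nonnegative combination of exponentials: exp (\<eta>_l -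
      \<eta>_k) with weight P_kl w_l, and exp (-\<eta>_k) with the probability of leaving the
      network as weight.\<close>
    have 1: "P $ k $ l * w l * (1 + \<eta> l - \<eta> k) \<le> exp (- \<eta> k) * (exp (t $ l) * P $ k $ l)" for l
    proof -
      have "P $ k $ l * w l * (1 + (\<eta> l - \<eta> k)) \<le> P $ k $ l * w l * exp (\<eta> l - \<eta> k)"
        using w_pos[of l] P_nonneg[of k l] by (intro mult_left_mono exp_ge_add_one_self mult_nonneg_nonneg) auto
      then show ?thesis by (simp add: e exp_diff exp_minus field_simps)
    qed
    have 2: "(1 - (\<Sum>l\<in>UNIV. P $ k $ l)) * (1 - \<eta> k) \<le> (1 - (\<Sum>l\<in>UNIV. P $ k $ l)) * exp (- \<eta> k)"
      using P_row[of k] exp_ge_add_one_self[of "- \<eta> k"] by (intro mult_left_mono) auto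
    have "(P *v z) $ k - z $ k + (P *v u) $ k - \<eta> k * (1 + (P *v z) $ k) =
      (\<Sum>l\<in>UNIV. P $ k $ l * w l * (1 + \<eta> l - \<eta> k)) + (1 - (\<Sum>l\<in>UNIV. P $ k $ l)) * (1 - \<eta> k) - w k"
      by (simp add: P_apply w_def u_def algebra_simps sum.distrib sum_subtractf sum_distrib_left)
    also have "\<dots> \<le> (\<Sum>l\<in>UNIV. exp (- \<eta> k) * (exp (t $ l) * P $ k $ l)) + (1 - (\<Sum>l\<in>UNIV. P $ k $ l)) * exp (- \<eta> k) - w k"
      by (intro diff_right_mono add_mono sum_mono 1 2)
    also have "\<dots> = exp (- \<eta> k) * ((\<Sum>l\<in>UNIV. (exp (t $ l) - 1) * P $ k $ l) + 1) - w k"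
      by (simp add: algebra_simps sum_distrib_left sum_subtractf)
    also have "\<dots> = w k * h_node P k t"
      by (simp add: h_node_def e'[symmetric] algebra_simps)
    finally show "(P *v z) $ k - z $ k + (P *v u) $ k - \<eta> k * (1 + (P *v z) $ k) \<le> w k * h_node P k t" .
  qed
  have on: "\<nu> $ k * (w k * h_node P k t) \<le> max (h_node P k t) 0 * \<mu> $ k" for k
  proof -
    have "w k \<le> 1 + \<zeta> k" using assms by (simp add: good_def w_def z_def)
    then have le: "\<nu> $ k * w k \<le> \<mu> $ k" using \<mu>_eq[of k] \<nu>_pos[of k] by simp
    have "(\<nu> $ k * w k) * h_node P k t \<le> (\<nu> $ k * w k) * max (h_node P k t) 0"
      using \<nu>_pos[of k] w_pos[of k] by (intro mult_left_mono) auto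
    also have "\<dots> \<le> \<mu> $ k * max (h_node P k t) 0" using le by (intro mult_right_mono) auto
    finally show ?thesis by (simp add: algebra_simps)
  qed
  have off: "\<nu> $ k * (w k * h_node P k t) = h_node P k t * \<mu> $ k" if "k \<in> -J" for k
    using that harmonic[of J k] \<mu>_eq[of k] by (simp add: w_def z_def)
  have "(t - \<theta> J) \<bullet> velocity J = (\<Sum>k\<in>UNIV. \<nu> $ k * (u $ k - \<eta> k * (1 + (P *v z) $ k)))"
    by (simp add: inner_vec_def velocity_def \<eta>_def z_def u_def w_def algebra_simps)
  \<comment> \<open>\<open>traffic_dual\<close> for z + u cancels every occurrence of P u and the
    zeroth-order terms.\<close>
  also have "\<dots> = (\<Sum>k\<in>UNIV. lam $ k * (z + u) $ k)
     + (\<Sum>k\<in>UNIV. \<nu> $ k * ((P *v z) $ k - z $ k + (P *v u) $ k - \<eta> k * (1 + (P *v z) $ k)))"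
    unfolding traffic_dual
    by (simp add: sum.distrib[symmetric] matrix_vector_right_distrib algebra_simps)
  also have "\<dots> \<le> (\<Sum>k\<in>UNIV. (exp (t $ k) - 1) * lam $ k) + (\<Sum>k\<in>UNIV. \<nu> $ k * (w k * h_node P k t))"
    using lam_part node_part by (intro add_mono sum_mono) auto
  also have "\<dots> \<le> H_face P lam \<mu> J t"
  proof -
    have "(\<Sum>k\<in>J. \<nu> $ k * (w k * h_node P k t)) \<le> (\<Sum>k\<in>J. max (h_node P k t) 0 * \<mu> $ k)"
      by (intro sum_mono on)
    moreover have "(\<Sum>k\<in>-J. \<nu> $ k * (w k * h_node P k t)) = (\<Sum>k\<in>-J. h_node P k t * \<mu> $ k)"
      by (intro sum.cong refl off)
    ultimately show ?thesis
      unfolding H_face_def sum_off[of "\<lambda>k. \<nu> $ k * (w k * h_node P k t)" J] by linarith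
  qed
  finally show ?thesis .
qed

lemma L_face_velocity:
  assumes "good J"
  shows "L_face P lam \<mu> J (velocity J) = ereal (\<alpha> \<bullet> velocity J)"
proof (rule antisym)
  show "L_face P lam \<mu> J (velocity J) \<le> ereal (\<alpha> \<bullet> velocity J)"
    unfolding L_face_def
  proof (rule SUP_least)
    fix t
    show "ereal (t \<bullet> velocity J - H_face P lam \<mu> J t) \<le> ereal (\<alpha> \<bullet> velocity J)"
      using H_face_subgradient[OF assms, of t] \<theta>_inner[of J "velocity J"] velocity_on
      by (simp add: inner_diff_left)
  qed
  show "ereal (\<alpha> \<bullet> velocity J) \<le> L_face P lam \<mu> J (velocity J)"
    by (rule L_face_ge) (rule velocity_on)
qed

section \<open>First-order conditions when the lower bound is attained\<close>

lemma perturbed_pos: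
  assumes "\<bar>s\<bar> < 1 / (norm \<xi> + 1)"
  shows "0 < 1 + (harmonic J + s *\<^sub>R \<xi>) $ k"
proof -
  have "\<bar>s\<bar> * \<bar>\<xi> $ k\<bar> \<le> \<bar>s\<bar> * (norm \<xi> + 1)"
    using component_le_norm_cart[of \<xi> k] by (intro mult_left_mono) auto
  also have "\<dots> < 1" using assms by (simp add: pos_less_divide_eq add_nonneg_pos)
  finally have "\<bar>s * \<xi> $ k\<bar> < 1" by (simp add: abs_mult)
  then show ?thesis using harmonic_nonneg[of J k] by simp
qed

lemma P_perturbed: "(P *v (z + s *\<^sub>R \<xi>)) $ k = (P *v z) $ k + s * (P *v \<xi>) $ k"
  by (simp add: matrix_vector_right_distrib matrix_vector_mult_scaleR)

text \<open>Attaining the lower bound makes \<theta> J a maximiser in the supremum defining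
  \<open>L_face\<close>, since \<open>H_face\<close> vanishes there. The next two lemmas test this
  maximum in chosen directions.\<close>

lemma H_face_ge_perturbed:
  assumes y: "\<And>k. k \<in> J \<Longrightarrow> y $ k = 0" and L: "L_face P lam \<mu> J y \<le> ereal (\<alpha> \<bullet> y)"
  shows "t \<bullet> y - H_face P lam \<mu> J t \<le> \<theta> J \<bullet> y"
proof -
  have "ereal (t \<bullet> y - H_face P lam \<mu> J t) \<le> L_face P lam \<mu> J y"
    unfolding L_face_def by (rule SUP_upper) simp
  then show ?thesis using L \<theta>_inner[OF y] by (metis ereal_less_eq(3) order_trans)
qed

text \<open>The positive parts make \<open>H_face\<close> nonsmooth, so z is varied only in
  directions that are harmonic on J: the terms of J then stay 0 and the objective is differentiable
  in s. A direction that off J is the unit vector at i isolates the i-th component.\<close>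

lemma L_face_tight_imp_velocity:
  assumes y: "\<And>k. k \<in> J \<Longrightarrow> y $ k = 0" and L: "L_face P lam \<mu> J y \<le> ereal (\<alpha> \<bullet> y)"
  shows "y = velocity J"
proof -
  let ?z = "harmonic J"
  have "y $ i = velocity J $ i" if "i \<notin> J" for i
  proof -
    obtain \<xi> where \<xi>: "\<forall>k. \<xi> $ k = (if k \<in> J then (P *v \<xi>) $ k else 0) + (\<chi> k. if k = i then 1 else 0) $ k"
      using dirichlet_problem by blast
    have \<xi>J: "(P *v \<xi>) $ k = \<xi> $ k" if "k \<in> J" for k using \<xi> that \<open>i \<notin> J\<close> by auto
    have \<xi>off: "\<xi> $ k = (if k = i then 1 else 0)" if "k \<notin> J" for k using \<xi> that by auto
    define z where "z s = ?z + s *\<^sub>R \<xi>" for s :: real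
    define w where "w k = 1 + ?z $ k" for k
    have w_pos: "0 < w k" for k using harmonic_nonneg[of J k] by (simp add: w_def)
    \<comment> \<open>This is the objective for \<bar>s\<bar> < d with the vanishing terms of J left
      out, which gives a formula differentiable at 0.\<close>
    define F where "F s = (\<Sum>k\<in>UNIV. ln (w k + s * \<xi> $ k) * y $ k) - (\<Sum>k\<in>UNIV. lam $ k * (?z $ k + s * \<xi> $ k))
        - (\<Sum>k\<in>-J. (((P *v ?z) $ k - ?z $ k) + s * ((P *v \<xi>) $ k - \<xi> $ k)) / (w k + s * \<xi> $ k) * \<mu> $ k)" for s
    define d where "d = 1 / (norm \<xi> + 1)"
    have "d > 0" by (simp add: d_def add_nonneg_pos)
    have F: "F s = (\<chi> k. ln (1 + z s $ k)) \<bullet> y - H_face P lam \<mu> J (\<chi> k. ln (1 + z s $ k))" if "\<bar>s\<bar> < d" for s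
    proof -
      have pos: "0 < 1 + z s $ k" for k unfolding z_def using perturbed_pos that by (simp add: d_def)
      have "(\<Sum>k\<in>J. max (((P *v z s) $ k - z s $ k) / (1 + z s $ k)) 0 * \<mu> $ k) = 0"
        by (rule sum.neutral) (use \<xi>J harmonic[of J] in \<open>auto simp: z_def P_perturbed\<close>)
      then show ?thesis
        unfolding H_face_ln[OF pos] F_def
        by (simp add: z_def P_perturbed w_def inner_vec_def algebra_simps)
    qed
    have "F s \<le> F 0" if "\<bar>s\<bar> < d" for s
    proof -
      have "F s \<le> \<theta> J \<bullet> y" unfolding F[OF that] by (rule H_face_ge_perturbed[OF y L])
      moreover have "F 0 = \<theta> J \<bullet> y"
        using F[of 0] \<open>d > 0\<close> H_face_\<theta>[of J] by (simp add: z_def \<theta>_def)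
      ultimately show ?thesis by simp
    qed
    then have max0: "\<forall>s. \<bar>0 - s\<bar> < d \<longrightarrow> F s \<le> F 0" by simp
    define D where "D = (\<Sum>k\<in>UNIV. \<xi> $ k / w k * y $ k) - (\<Sum>k\<in>UNIV. lam $ k * \<xi> $ k)
        - (\<Sum>k\<in>-J. (((P *v \<xi>) $ k - \<xi> $ k) * w k - ((P *v ?z) $ k - ?z $ k) * \<xi> $ k) / (w k * w k) * \<mu> $ k)"
    have "DERIV F 0 :> D"
      unfolding F_def D_def
    proof (intro DERIV_diff DERIV_sum)
      fix k
      have nz: "w k \<noteq> 0" using w_pos[of k] by simp
      show "((\<lambda>s. ln (w k + s * \<xi> $ k) * y $ k) has_field_derivative \<xi> $ k / w k * y $ k) (at 0)"
        using w_pos[of k] by (auto intro!: derivative_eq_intros simp: field_simps)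
      show "((\<lambda>s. lam $ k * (?z $ k + s * \<xi> $ k)) has_field_derivative lam $ k * \<xi> $ k) (at 0)"
        by (auto intro!: derivative_eq_intros)
      show "((\<lambda>s. (((P *v ?z) $ k - ?z $ k) + s * ((P *v \<xi>) $ k - \<xi> $ k)) / (w k + s * \<xi> $ k) * \<mu> $ k)
        has_field_derivative (((P *v \<xi>) $ k - \<xi> $ k) * w k - ((P *v ?z) $ k - ?z $ k) * \<xi> $ k) / (w k * w k) * \<mu> $ k) (at 0)"
        using nz by (auto intro!: derivative_eq_intros simp: algebra_simps)
    qed
    then have "D = 0" using DERIV_local_max \<open>d > 0\<close> max0 by blast
    have "(\<Sum>k\<in>UNIV. \<xi> $ k / w k * y $ k) = (\<Sum>k\<in>UNIV. if k = i then y $ i / w i else 0)"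
    proof (rule sum.cong[OF refl])
      fix k
      show "\<xi> $ k / w k * y $ k = (if k = i then y $ i / w i else 0)"
        using y[of k] \<xi>off[of k] \<open>i \<notin> J\<close> by (cases "k \<in> J") auto
    qed
    then have 1: "(\<Sum>k\<in>UNIV. \<xi> $ k / w k * y $ k) = y $ i / w i" by simp
    have "(\<Sum>k\<in>J. \<nu> $ k * (\<xi> $ k - (P *v \<xi>) $ k)) = 0"
      by (rule sum.neutral) (use \<xi>J in auto)
    then have 2: "(\<Sum>k\<in>UNIV. lam $ k * \<xi> $ k) = (\<Sum>k\<in>-J. \<nu> $ k * (\<xi> $ k - (P *v \<xi>) $ k))"
      unfolding traffic_dual sum_off[of _ J] by simp
    have 3: "(\<Sum>k\<in>-J. (((P *v \<xi>) $ k - \<xi> $ k) * w k - ((P *v ?z) $ k - ?z $ k) * \<xi> $ k) / (w k * w k) * \<mu> $ k) =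
      (\<Sum>k\<in>-J. \<nu> $ k * ((P *v \<xi>) $ k - \<xi> $ k)) + (\<Sum>k\<in>-J. if k = i then velocity J $ i / w i else 0)"
      unfolding sum.distrib[symmetric]
    proof (rule sum.cong[OF refl])
      fix k assume "k \<in> -J"
      then have \<mu>: "\<mu> $ k = \<nu> $ k * w k" using harmonic[of J k] \<mu>_eq[of k] by (simp add: w_def)
      have E: "(if k = i then velocity J $ i / w i else 0) = \<nu> $ k * (?z $ k - (P *v ?z) $ k) * \<xi> $ k / w k"
        using \<xi>off \<open>k \<in> -J\<close> by (simp add: velocity_def)
      then show "(((P *v \<xi>) $ k - \<xi> $ k) * w k - ((P *v ?z) $ k - ?z $ k) * \<xi> $ k) / (w k * w k) * \<mu> $ k =
        \<nu> $ k * ((P *v \<xi>) $ k - \<xi> $ k) + (if k = i then velocity J $ i / w i else 0)"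
        unfolding E \<mu> using w_pos[of k] by (simp add: field_simps)
    qed
    have "(\<Sum>k\<in>-J. if k = i then velocity J $ i / w i else 0) = velocity J $ i / w i"
      using \<open>i \<notin> J\<close> by simp
    moreover have "(\<Sum>k\<in>-J. \<nu> $ k * (\<xi> $ k - (P *v \<xi>) $ k)) + (\<Sum>k\<in>-J. \<nu> $ k * ((P *v \<xi>) $ k - \<xi> $ k)) = 0"
      by (simp add: sum.distrib[symmetric] algebra_simps)
    ultimately have "D = y $ i / w i - velocity J $ i / w i"
      unfolding D_def 1 2 3 by linarith
    then show ?thesis using \<open>D = 0\<close> w_pos[of i] by simp
  qed
  then show ?thesis using y velocity_on by (metis vec_eq_iff)
qed

text \<open>A one-sided variation with s > 0 vanishes off J and makes z strictly subharmonic at i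
  alone, so only the positive part at i is switched on. Its cost rate \<mu>_i / (1 + z_i) must
  compensate the loss \<nu>_i, which is goodness at i as s tends to 0.\<close>

lemma L_face_tight_imp_good:
  assumes y: "\<And>k. k \<in> J \<Longrightarrow> y $ k = 0" and L: "L_face P lam \<mu> J y \<le> ereal (\<alpha> \<bullet> y)"
  shows "good J"
proof -
  let ?z = "harmonic J"
  have "?z $ i \<le> \<zeta> i" if "i \<in> J" for i
  proof -
    \<comment> \<open>The source -1 gives (P \<xi>)_i - \<xi>_i = 1, so \<open>h_node\<close> at i
      becomes positive for s > 0.\<close>
    obtain \<xi> where \<xi>: "\<forall>k. \<xi> $ k = (if k \<in> J then (P *v \<xi>) $ k else 0) + (\<chi> k. if k = i then -1 else 0) $ k"
      using dirichlet_problem by blast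
    have \<xi>J: "(P *v \<xi>) $ k - \<xi> $ k = (if k = i then 1 else 0)" if "k \<in> J" for k
      using \<xi>[rule_format, of k] that by auto
    have \<xi>off: "\<xi> $ k = 0" if "k \<notin> J" for k using \<xi> that \<open>i \<in> J\<close> by auto
    define w where "w k = 1 + ?z $ k" for k
    define d where "d = 1 / (norm \<xi> + 1)"
    have "d > 0" by (simp add: d_def add_nonneg_pos)
    have le: "\<nu> $ i * (w i + s * \<xi> $ i) \<le> \<mu> $ i" if s: "0 < s" "s < d" for s
    proof -
      define z where "z = ?z + s *\<^sub>R \<xi>"
      have pos: "0 < 1 + z $ k" for k unfolding z_def using perturbed_pos s by (simp add: d_def)
      have "(\<chi> k. ln (1 + z $ k)) \<bullet> y = \<theta> J \<bullet> y"
        unfolding inner_vec_def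
      proof (rule sum.cong[OF refl])
        fix k
        show "(\<chi> k. ln (1 + z $ k)) $ k \<bullet> y $ k = \<theta> J $ k \<bullet> y $ k"
          using y[of k] \<xi>off[of k] by (cases "k \<in> J") (simp_all add: \<theta>_def z_def)
      qed
      \<comment> \<open>The variation leaves the pairing with y unchanged, as \<xi> vanishes off J
        and y vanishes on J.\<close>
      then have H: "0 \<le> H_face P lam \<mu> J (\<chi> k. ln (1 + z $ k))"
        using H_face_ge_perturbed[OF y L, of "\<chi> k. ln (1 + z $ k)"] by simp
      have 1: "(\<Sum>k\<in>J. max (((P *v z) $ k - z $ k) / (1 + z $ k)) 0 * \<mu> $ k) =
          (\<Sum>k\<in>J. if k = i then s / (1 + z $ i) * \<mu> $ i else 0)"
      proof (rule sum.cong[OF refl])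
        fix k assume "k \<in> J"
        then have "(P *v z) $ k - z $ k = s * (if k = i then 1 else 0)"
          using \<xi>J[of k] harmonic[of J k] by (simp add: z_def P_perturbed algebra_simps)
        then show "max (((P *v z) $ k - z $ k) / (1 + z $ k)) 0 * \<mu> $ k = (if k = i then s / (1 + z $ i) * \<mu> $ i else 0)"
          using divide_pos_pos[OF s(1) pos[of k]] by (cases "k = i") (simp_all add: max_absorb1)
      qed
      have 2: "(\<Sum>k\<in>-J. ((P *v z) $ k - z $ k) / (1 + z $ k) * \<mu> $ k) = (\<Sum>k\<in>-J. \<nu> $ k * ((P *v z) $ k - z $ k))"
      proof (rule sum.cong[OF refl])
        fix k assume "k \<in> -J"
        then have "z $ k = \<zeta> k" using harmonic[of J k] \<xi>off by (simp add: z_def)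
        then show "((P *v z) $ k - z $ k) / (1 + z $ k) * \<mu> $ k = \<nu> $ k * ((P *v z) $ k - z $ k)"
          using \<mu>_eq[of k] pos[of k] by simp
      qed
      have 3: "(\<Sum>k\<in>J. \<nu> $ k * (z $ k - (P *v z) $ k)) = (\<Sum>k\<in>J. if k = i then - \<nu> $ i * s else 0)"
      proof (rule sum.cong[OF refl])
        fix k assume "k \<in> J"
        then have "(P *v z) $ k - z $ k = s * (if k = i then 1 else 0)"
          using \<xi>J[of k] harmonic[of J k] by (simp add: z_def P_perturbed algebra_simps)
        then show "\<nu> $ k * (z $ k - (P *v z) $ k) = (if k = i then - \<nu> $ i * s else 0)"
          by (auto simp: algebra_simps)
      qed
      have "0 \<le> (\<Sum>k\<in>J. \<nu> $ k * (z $ k - (P *v z) $ k)) + (\<Sum>k\<in>-J. \<nu> $ k * (z $ k - (P *v z) $ k))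
          + s / (1 + z $ i) * \<mu> $ i + (\<Sum>k\<in>-J. \<nu> $ k * ((P *v z) $ k - z $ k))"
        using H \<open>i \<in> J\<close> unfolding H_face_ln[OF pos] 1 2 traffic_dual sum_off[of _ J] by simp
      moreover have "(\<Sum>k\<in>-J. \<nu> $ k * (z $ k - (P *v z) $ k)) + (\<Sum>k\<in>-J. \<nu> $ k * ((P *v z) $ k - z $ k)) = 0"
        by (simp add: sum.distrib[symmetric] algebra_simps)
      ultimately have "\<nu> $ i * s \<le> s / (1 + z $ i) * \<mu> $ i"
        unfolding 3 using \<open>i \<in> J\<close> by simp
      then have "s * (\<nu> $ i * (1 + z $ i)) \<le> s * \<mu> $ i" using pos[of i] by (simp add: field_simps)
      then have "\<nu> $ i * (1 + z $ i) \<le> \<mu> $ i" using s(1) by (simp only: mult_le_cancel_left_pos)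
      then show ?thesis by (simp add: z_def w_def add.assoc)
    qed
    have "((\<lambda>s. \<nu> $ i * (w i + s * \<xi> $ i)) \<longlongrightarrow> \<nu> $ i * (w i + 0 * \<xi> $ i)) (at_right 0)"
      by (intro tendsto_intros)
    moreover have "eventually (\<lambda>s. \<nu> $ i * (w i + s * \<xi> $ i) \<le> \<mu> $ i) (at_right 0)"
      using eventually_at_right_less[of 0] order_tendstoD(2)[OF tendsto_ident_at \<open>0 < d\<close>, of "{0<..}"]
      by eventually_elim (rule le)
    ultimately have "\<nu> $ i * (w i + 0 * \<xi> $ i) \<le> \<mu> $ i"
      by (rule tendsto_upperbound) simp
    then show ?thesis using \<mu>_eq[of i] \<nu>_pos[of i] by (simp add: w_def)
  qed
  then show ?thesis unfolding good_def using harmonic[of J] by (metis order_refl)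
qed

end

section \<open>The cost of a path\<close>

lemma abs_continuous_on_imp_continuous_on:
  assumes "abs_continuous_on a b q"
  shows "continuous_on {a..b} q"
  unfolding continuous_on_iff
proof (intro ballI allI impI)
  fix x and e :: real assume x: "x \<in> {a..b}" and "e > 0"
  obtain \<delta> where "\<delta> > 0" and \<delta>: "\<And>A u v. \<lbrakk>finite A; \<And>i. i \<in> A \<Longrightarrow> a \<le> u i \<and> u i \<le> v i \<and> v i \<le> b;
      disjoint_family_on (\<lambda>i::unit. {u i<..<v i}) A; (\<Sum>i\<in>A. v i - u i) < \<delta>\<rbrakk>
    \<Longrightarrow> (\<Sum>i\<in>A. norm (q (v i) - q (u i))) < e"
    using abs_continuous_on_family[OF assms \<open>e > 0\<close>] by blast
  have "dist (q y) (q x) < e" if y: "y \<in> {a..b}" "dist y x < \<delta>" for y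
  proof -
    have "(\<Sum>i\<in>{()}. norm (q (max x y) - q (min x y))) < e"
    proof (rule \<delta>)
      show "a \<le> min x y \<and> min x y \<le> max x y \<and> max x y \<le> b" using x y by auto
      show "(\<Sum>i\<in>{()}. max x y - min x y) < \<delta>" using y by (auto simp: dist_real_def)
    qed (auto simp: disjoint_family_on_def)
    then show ?thesis by (auto simp: dist_norm max_def min_def norm_minus_commute split: if_splits)
  qed
  then show "\<exists>d>0. \<forall>x'\<in>{a..b}. dist x' x < d \<longrightarrow> dist (q x') (q x) < e"
    using \<open>\<delta> > 0\<close> by blast
qed

lemma lipschitz_imp_abs_continuous_on:
  assumes "C-lipschitz_on {a..b} q"
  shows "abs_continuous_on a b q"
  unfolding abs_continuous_on_def
proof (intro allI impI)
  fix \<epsilon> :: real assume "\<epsilon> > 0"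
  have "C \<ge> 0" using assms by (rule lipschitz_on_nonneg)
  have "(\<Sum>i<k. norm (q (v i) - q (u i))) < \<epsilon>"
    if H: "(\<forall>i<k. a \<le> u i \<and> u i \<le> v i \<and> v i \<le> b) \<and>
      disjoint_family_on (\<lambda>i. {u i<..<v i}) {..<k} \<and> (\<Sum>i<k. v i - u i) < \<epsilon> / (C + 1)" for k :: nat and u v
  proof -
    have "norm (q (v i) - q (u i)) \<le> (C + 1) * (v i - u i)" if "i < k" for i
    proof -
      have uv: "a \<le> u i" "u i \<le> v i" "v i \<le> b" using H \<open>i < k\<close> by auto
      have "dist (q (v i)) (q (u i)) \<le> C * dist (v i) (u i)"
        by (rule lipschitz_onD[OF assms]) (use uv in auto)
      also have "\<dots> \<le> (C + 1) * (v i - u i)" using uv by (simp add: dist_real_def algebra_simps)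
      finally show ?thesis by (simp add: dist_norm)
    qed
    then have "(\<Sum>i<k. norm (q (v i) - q (u i))) \<le> (\<Sum>i<k. (C + 1) * (v i - u i))"
      by (intro sum_mono) auto
    also have "\<dots> = (C + 1) * (\<Sum>i<k. v i - u i)" by (rule sum_distrib_left[symmetric])
    also have "\<dots> < \<epsilon>" using H \<open>C \<ge> 0\<close> by (simp add: pos_less_divide_eq mult.commute)
    finally show ?thesis .
  qed
  moreover have "\<epsilon> / (C + 1) > 0" using \<open>\<epsilon> > 0\<close> \<open>C \<ge> 0\<close> by simp
  ultimately show "\<exists>\<delta>>0. \<forall>(k::nat) u v.
        (\<forall>i<k. a \<le> u i \<and> u i \<le> v i \<and> v i \<le> b) \<and>
        disjoint_family_on (\<lambda>i. {u i<..<v i}) {..<k} \<and>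
        (\<Sum>i<k. v i - u i) < \<delta> \<longrightarrow>
        (\<Sum>i<k. norm (q (v i) - q (u i))) < \<epsilon>" by blast
qed

section \<open>Measurability of the cost integrand\<close>

definition zeros :: "real^'n \<Rightarrow> 'n set" where "zeros x = {i. x $ i = 0}"

lemma zeros_face: "x \<in> face J \<Longrightarrow> zeros x = J"
  by (auto simp: face_def zeros_def) (metis ComplI less_irrefl)

lemma face_zeros: "(\<And>i. 0 \<le> x $ i) \<Longrightarrow> x \<in> face (zeros x)"
  by (auto simp: face_def zeros_def order.order_iff_strict)

lemma Lagrangian_eq_L_face:
  assumes "\<And>i. 0 \<le> x $ i"
  shows "Lagrangian P lam \<mu> x y = L_face P lam \<mu> (zeros x) y"
proof -
  have "Lagrangian P lam \<mu> x y = (\<Sum>J\<in>UNIV. if J = zeros x then L_face P lam \<mu> J y else 0)"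
    unfolding Lagrangian_def
  proof (rule sum.cong[OF refl])
    fix J
    show "indicator (face J) x * L_face P lam \<mu> J y = (if J = zeros x then L_face P lam \<mu> J y else 0)"
      using zeros_face[of x J] face_zeros[OF assms] by (cases "J = zeros x") (auto simp: indicator_def)
  qed
  then show ?thesis by simp
qed

lemma face_borel [measurable]:
  fixes J :: "'n::finite set"
  shows "face J \<in> sets borel"
proof -
  have "face J = (\<Inter>i\<in>J. {x :: real^'n. x $ i = 0}) \<inter> (\<Inter>i\<in>-J. {x. x $ i > 0})"
    by (auto simp: face_def)
  moreover have "closed (\<Inter>i\<in>J. {x :: real^'n. x $ i = 0})"
    by (intro closed_INT ballI closed_Collect_eq continuous_intros)
  moreover have "open (\<Inter>i\<in>-J. {x :: real^'n. x $ i > 0})"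
    by (intro open_INT ballI open_Collect_less continuous_intros) auto
  ultimately show ?thesis by (simp add: borel_closed borel_open sets.Int)
qed

text \<open>The supremum is over an uncountable set of momenta, so measurability comes from lower
  semicontinuity: superlevel sets are unions of open sets.\<close>

lemma L_face_borel [measurable]: "L_face P lam \<mu> J \<in> borel_measurable borel"
proof (rule borel_measurableI_greater)
  fix a
  have "{y. a < L_face P lam \<mu> J y} = (\<Union>\<theta>. {y. a < ereal (\<theta> \<bullet> y - H_face P lam \<mu> J \<theta>)})"
    by (auto simp: L_face_def less_SUP_iff)
  moreover have "open {y. a < ereal (\<theta> \<bullet> y - H_face P lam \<mu> J \<theta>)}" for \<theta>
    by (intro open_Collect_less continuous_intros)
  ultimately have "open {y. a < L_face P lam \<mu> J y}" by auto
  then show "{y \<in> space borel. a < L_face P lam \<mu> J y} \<in> sets borel" by (simp add: borel_open)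
qed

lemma Lagrangian_measurable:
  assumes [measurable]: "q \<in> borel_measurable M" "y \<in> borel_measurable M"
  shows "(\<lambda>t. Lagrangian P lam \<mu> (q t) (y t)) \<in> borel_measurable M"
proof -
  have "(\<lambda>t. indicator (face J) (q t) * L_face P lam \<mu> J (y t)) \<in> borel_measurable M" for J
  proof (intro borel_measurable_ereal_times)
    show "(\<lambda>t. indicator (face J) (q t) :: ereal) \<in> borel_measurable M"
      by (rule measurable_compose[OF assms(1)]) measurable
    show "(\<lambda>t. L_face P lam \<mu> J (y t)) \<in> borel_measurable M"
      by (rule measurable_compose[OF assms(2) L_face_borel])
  qed
  then show ?thesis unfolding Lagrangian_def by (intro borel_measurable_ereal_sum)
qed

text \<open>Nothing is known of q outside [0, T], so path and derivative are cut off by the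
  indicator before being composed with the Lagrangian.\<close>

lemma path_cost_integrand_measurable:
  fixes q :: "real \<Rightarrow> real^'n"
  assumes ac: "abs_continuous_on 0 T q" and "0 \<le> T"
  shows "(\<lambda>t. e2ennreal (Lagrangian P lam \<mu> (q t) (vector_derivative q (at t))) * indicator {0..T} t)
    \<in> borel_measurable lebesgue"
proof -
  let ?y = "\<lambda>t. vector_derivative q (at t)"
  define q0 where "q0 = (\<lambda>t. indicator {0..T} t *\<^sub>R q t)"
  define y0 where "y0 = (\<lambda>t. indicator {0..T} t *\<^sub>R ?y t)"
  have "q0 \<in> borel_measurable borel"
    unfolding q0_def
    by (rule borel_measurable_continuous_on_indicator) (auto intro: abs_continuous_on_imp_continuous_on[OF ac])
  then have q0: "q0 \<in> borel_measurable lebesgue"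
    by (auto intro: measurable_completion)
  have y0: "y0 \<in> borel_measurable lebesgue"
  proof (subst borel_measurable_euclidean_space, intro ballI)
    fix b :: "real^'n" assume "b \<in> Basis"
    have "(\<lambda>t. b \<bullet> ?y t) absolutely_integrable_on {0..T}"
      using abs_continuous_on_FTC(1)[OF ac _ \<open>0 \<le> T\<close>] by simp
    then have "(\<lambda>t. indicator {0..T} t *\<^sub>R (b \<bullet> ?y t)) \<in> borel_measurable lebesgue"
      unfolding set_integrable_def by (rule borel_measurable_integrable)
    then show "(\<lambda>t. y0 t \<bullet> b) \<in> borel_measurable lebesgue"
      by (simp add: y0_def inner_commute)
  qed
  have [measurable]: "(\<lambda>t. Lagrangian P lam \<mu> (q0 t) (y0 t)) \<in> borel_measurable lebesgue"
    by (rule Lagrangian_measurable[OF q0 y0])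
  have "(\<lambda>t. e2ennreal (Lagrangian P lam \<mu> (q0 t) (y0 t)) * indicator {0..T} t) \<in> borel_measurable lebesgue"
    by (intro borel_measurable_times_ennreal measurable_compose[OF _ measurable_e2ennreal] borel_measurable_indicator) auto
  moreover have "(\<lambda>t. e2ennreal (Lagrangian P lam \<mu> (q0 t) (y0 t)) * indicator {0..T} t) =
      (\<lambda>t. e2ennreal (Lagrangian P lam \<mu> (q t) (?y t)) * indicator {0..T} t)"
    by (auto simp: q0_def y0_def indicator_def)
  ultimately show ?thesis by simp
qed

text \<open>A nonnegative coordinate that vanishes at an interior time has a local minimum
  there.\<close>

lemma admissible_derivative_zero:
  fixes q :: "real \<Rightarrow> real^'n"
  assumes nn: "\<forall>t\<in>{0..T}. \<forall>i. 0 \<le> q t $ i" and t: "0 < t" "t < T"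
    and der: "(q has_vector_derivative y) (at t)" and k: "q t $ k = 0"
  shows "y $ k = 0"
proof -
  have "((\<lambda>s. q s $ k) has_vector_derivative y $ k) (at t)"
    using bounded_linear.has_vector_derivative[OF bounded_linear_vec_nth der] .
  then have "DERIV (\<lambda>s. q s $ k) t :> y $ k"
    by (simp add: has_real_derivative_iff_has_vector_derivative)
  then show ?thesis
  proof (rule DERIV_local_min)
    show "0 < min t (T - t)" using t by simp
    show "\<forall>s. \<bar>t - s\<bar> < min t (T - t) \<longrightarrow> q t $ k \<le> q s $ k"
      using nn k by (auto simp: abs_less_iff)
  qed
qed

context stable_network
begin

definition extremal :: "real \<Rightarrow> (real \<Rightarrow> real^'n) \<Rightarrow> bool" where
  "extremal T q \<longleftrightarrow> negligible {t \<in> {0..T}. \<not> (good (zeros (q t)) \<and>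
     (q has_vector_derivative velocity (zeros (q t))) (at t))}"

text \<open>Three integrands are compared: F = \<alpha> . q' with integral \<alpha> . r, its
  positive part M, and the cost G. Almost everywhere F \<le> M \<le> G, so the cost is at least
  \<alpha> . r, and equality holds iff the three agree almost everywhere. The equality case of the
  local bound then translates this into \<open>extremal\<close>.\<close>

lemma path_cost_bounds:
  assumes adm: "admissible r T q"
  shows path_cost_ge: "ennreal (\<alpha> \<bullet> r) \<le> path_cost P lam \<mu> T q"
    and path_cost_le_imp_extremal: "path_cost P lam \<mu> T q \<le> ennreal (\<alpha> \<bullet> r) \<Longrightarrow> 0 \<le> \<alpha> \<bullet> r \<Longrightarrow> extremal T q"
    and extremal_imp_path_cost: "extremal T q \<Longrightarrow> path_cost P lam \<mu> T q = ennreal (\<alpha> \<bullet> r)"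
proof -
  have "0 \<le> T" and ac: "abs_continuous_on 0 T q" and nn: "\<forall>t\<in>{0..T}. \<forall>i. 0 \<le> q t $ i"
    and q0: "q 0 = 0" and qT: "q T = r"
    using adm by (auto simp: admissible_def)
  define y where "y t = vector_derivative q (at t)" for t
  define F where "F = (\<lambda>t. indicator {0..T} t *\<^sub>R (\<alpha> \<bullet> y t))"
  \<comment> \<open>G is \<open>ennreal\<close>-valued while F may be negative, hence the positive
    part between them.\<close>
  define M where "M = (\<lambda>t. max 0 (F t))"
  define G where "G = (\<lambda>t. e2ennreal (Lagrangian P lam \<mu> (q t) (y t)) * indicator {0..T} t)"
  have cost: "path_cost P lam \<mu> T q = (\<integral>\<^sup>+t. G t \<partial>lebesgue)"
    by (simp add: path_cost_def G_def y_def)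
  have G_meas [measurable]: "G \<in> borel_measurable lebesgue"
    unfolding G_def y_def by (rule path_cost_integrand_measurable[OF ac \<open>0 \<le> T\<close>])
  have Fint: "integrable lebesgue F"
    using abs_continuous_on_FTC(1)[OF ac order_refl \<open>0 \<le> T\<close> order_refl, of \<alpha>]
    by (simp add: set_integrable_def F_def y_def)
  have "integral\<^sup>L lebesgue F = integral {0..T} (\<lambda>t. \<alpha> \<bullet> y t)"
    using set_lebesgue_integral_eq_integral(2)[OF abs_continuous_on_FTC(1)[OF ac order_refl \<open>0 \<le> T\<close> order_refl, of \<alpha>]]
    by (simp add: set_lebesgue_integral_def F_def y_def)
  also have "\<dots> = \<alpha> \<bullet> r"
    using abs_continuous_on_FTC(2)[OF ac order_refl \<open>0 \<le> T\<close> order_refl, of \<alpha>] q0 qT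
    by (simp add: integral_unique y_def)
  finally have intF: "integral\<^sup>L lebesgue F = \<alpha> \<bullet> r" .
  have Mint: "integrable lebesgue M" unfolding M_def using Fint by (intro integrable_max) auto
  have nnM: "(\<integral>\<^sup>+t. ennreal (M t) \<partial>lebesgue) = ennreal (integral\<^sup>L lebesgue M)"
    by (rule nn_integral_eq_integral[OF Mint]) (simp add: M_def)
  have FM: "integral\<^sup>L lebesgue F \<le> integral\<^sup>L lebesgue M"
    by (rule integral_mono[OF Fint Mint]) (simp add: M_def)
  \<comment> \<open>The endpoints are excluded because the local minimum argument needs interior
    times.\<close>
  define N where "N = {0, T} \<union> {t \<in> {0..T}. \<not> (q has_vector_derivative vector_derivative q (at t)) (at t)}"
  have N: "N \<in> null_sets lebesgue"
    unfolding N_def negligible_iff_null_sets[symmetric]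
    by (intro negligible_Un abs_continuous_on_vector_derivative_ae[OF ac]) auto
  have reg: "(q has_vector_derivative y t) (at t)" "\<And>k. k \<in> zeros (q t) \<Longrightarrow> y t $ k = 0"
      "Lagrangian P lam \<mu> (q t) (y t) = L_face P lam \<mu> (zeros (q t)) (y t)"
    if t: "t \<in> {0..T}" "t \<notin> N" for t
  proof -
    show der: "(q has_vector_derivative y t) (at t)" using t by (auto simp: N_def y_def)
    show "y t $ k = 0" if "k \<in> zeros (q t)" for k
      by (rule admissible_derivative_zero[OF nn _ _ der]) (use t that in \<open>auto simp: N_def zeros_def\<close>)
    show "Lagrangian P lam \<mu> (q t) (y t) = L_face P lam \<mu> (zeros (q t)) (y t)"
      by (rule Lagrangian_eq_L_face) (use nn t in auto)
  qed
  have "ennreal (M t) \<le> G t" if "t \<notin> N" for t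
  proof (cases "t \<in> {0..T}")
    case True
    have "ereal (\<alpha> \<bullet> y t) \<le> Lagrangian P lam \<mu> (q t) (y t)"
      using L_face_ge[OF reg(2)[OF True that]] reg(3)[OF True that] by simp
    then have "ereal (max 0 (\<alpha> \<bullet> y t)) \<le> Lagrangian P lam \<mu> (q t) (y t)"
      using Lagrangian_nonneg[of P lam \<mu> "q t" "y t"] by (simp add: max_def zero_ereal_def)
    then have "e2ennreal (ereal (max 0 (\<alpha> \<bullet> y t))) \<le> e2ennreal (Lagrangian P lam \<mu> (q t) (y t))"
      by (rule e2ennreal_mono)
    then have "ennreal (max 0 (\<alpha> \<bullet> y t)) \<le> e2ennreal (Lagrangian P lam \<mu> (q t) (y t))"
      by (simp only: e2ennreal_ereal)
    then show ?thesis using True by (simp add: G_def M_def F_def)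
  qed (simp add: G_def M_def F_def)
  then have MG: "AE t in lebesgue. ennreal (M t) \<le> G t"
    by (intro AE_I'[OF N]) auto
  have le: "ennreal (integral\<^sup>L lebesgue M) \<le> path_cost P lam \<mu> T q"
    unfolding cost nnM[symmetric] by (rule nn_integral_mono_AE[OF MG])
  show "ennreal (\<alpha> \<bullet> r) \<le> path_cost P lam \<mu> T q"
    using le FM intF by (metis ennreal_leI order_trans)
  show "extremal T q" if up: "path_cost P lam \<mu> T q \<le> ennreal (\<alpha> \<bullet> r)" and nonneg: "0 \<le> \<alpha> \<bullet> r"
  proof -
    have "integral\<^sup>L lebesgue M \<le> \<alpha> \<bullet> r" using order_trans[OF le up] nonneg by (simp add: ennreal_le_iff)
    then have M_eq: "integral\<^sup>L lebesgue M = \<alpha> \<bullet> r" using FM intF by simp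
    have "(\<integral>t. M t - F t \<partial>lebesgue) = 0" using Mint Fint M_eq intF by simp
    moreover have "integrable lebesgue (\<lambda>t. M t - F t)" using Mint Fint by simp
    ultimately have AE1: "AE t in lebesgue. M t - F t = 0"
      by (subst (asm) integral_nonneg_eq_0_iff_AE) (auto simp: M_def)
    \<comment> \<open>The subtraction is legitimate because M has finite integral.\<close>
    have "(\<integral>\<^sup>+t. G t - ennreal (M t) \<partial>lebesgue) = (\<integral>\<^sup>+t. G t \<partial>lebesgue) - (\<integral>\<^sup>+t. ennreal (M t) \<partial>lebesgue)"
      using MG nnM Mint by (intro nn_integral_diff) auto
    also have "\<dots> = 0"
      using up unfolding cost nnM M_eq diff_eq_0_iff_ennreal
      by (auto intro: le_less_trans[OF _ ennreal_less_top])
    finally have AE2: "AE t in lebesgue. G t - ennreal (M t) = 0"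
      using Mint by (subst (asm) nn_integral_0_iff_AE) auto
    have "AE t in lebesgue. t \<in> {0..T} \<longrightarrow> good (zeros (q t)) \<and>
       (q has_vector_derivative velocity (zeros (q t))) (at t)"
      using AE1 AE2 AE_not_in[OF N]
    proof eventually_elim
      case (elim t)
      show ?case
      proof
        assume t: "t \<in> {0..T}"
        have F0: "0 \<le> \<alpha> \<bullet> y t" and Mt: "M t = \<alpha> \<bullet> y t" using elim(1) t by (auto simp: M_def F_def)
        have "e2ennreal (Lagrangian P lam \<mu> (q t) (y t)) - ennreal (\<alpha> \<bullet> y t) = 0"
          using elim(2) t Mt by (simp add: G_def)
        then have "e2ennreal (Lagrangian P lam \<mu> (q t) (y t)) \<le> ennreal (\<alpha> \<bullet> y t)"
          by (simp add: diff_eq_0_iff_ennreal)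
        then have "enn2ereal (e2ennreal (Lagrangian P lam \<mu> (q t) (y t))) \<le> enn2ereal (ennreal (\<alpha> \<bullet> y t))"
          by (simp add: less_eq_ennreal.rep_eq)
        then have "L_face P lam \<mu> (zeros (q t)) (y t) \<le> ereal (\<alpha> \<bullet> y t)"
          using Lagrangian_nonneg[of P lam \<mu> "q t" "y t"] F0 reg(3)[OF t elim(3)]
          by (simp add: enn2ereal_e2ennreal enn2ereal_ennreal)
        then have "y t = velocity (zeros (q t))" "good (zeros (q t))"
          using L_face_tight_imp_velocity[OF reg(2)[OF t elim(3)]] L_face_tight_imp_good[OF reg(2)[OF t elim(3)]]
          by auto
        then show "good (zeros (q t)) \<and> (q has_vector_derivative velocity (zeros (q t))) (at t)"
          using reg(1)[OF t elim(3)] by simp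
      qed
    qed
    then obtain N' where N': "N' \<in> null_sets lebesgue" "\<And>t. t \<in> space lebesgue - N' \<Longrightarrow> t \<in> {0..T} \<longrightarrow>
       good (zeros (q t)) \<and> (q has_vector_derivative velocity (zeros (q t))) (at t)"
      by (rule AE_E3) blast
    show ?thesis
      unfolding extremal_def
      by (rule negligible_subset[of N']) (use N' in \<open>auto simp: negligible_iff_null_sets\<close>)
  qed
  show "path_cost P lam \<mu> T q = ennreal (\<alpha> \<bullet> r)" if ext: "extremal T q"
  proof -
    define E where "E = {t \<in> {0..T}. \<not> (good (zeros (q t)) \<and> (q has_vector_derivative velocity (zeros (q t))) (at t))}"
    have E: "E \<in> null_sets lebesgue"
      using ext unfolding extremal_def E_def negligible_iff_null_sets .
    have *: "G t = ennreal (M t) \<and> F t = M t" if t: "t \<notin> N" "t \<notin> E" for t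
    proof (cases "t \<in> {0..T}")
      case True
      have g: "good (zeros (q t))" and der: "(q has_vector_derivative velocity (zeros (q t))) (at t)"
        using True t(2) by (auto simp: E_def)
      have y: "y t = velocity (zeros (q t))" unfolding y_def by (rule vector_derivative_at[OF der])
      have L: "Lagrangian P lam \<mu> (q t) (y t) = ereal (\<alpha> \<bullet> y t)"
        unfolding reg(3)[OF True t(1)] unfolding y by (rule L_face_velocity[OF g])
      then have "0 \<le> \<alpha> \<bullet> y t" using Lagrangian_nonneg[of P lam \<mu> "q t" "y t"] by simp
      then show ?thesis using True L by (simp add: G_def M_def F_def e2ennreal_ereal)
    qed (simp add: G_def M_def F_def)
    have NE: "N \<union> E \<in> null_sets lebesgue" using N E by (rule null_sets.Un)
    have AEs: "AE t in lebesgue. G t = ennreal (M t)" "AE t in lebesgue. F t = M t"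
      using * by (intro AE_I'[OF NE]; blast)+
    have "integral\<^sup>L lebesgue F = integral\<^sup>L lebesgue M"
      using AEs(2) Fint Mint by (intro integral_cong_AE) auto
    then show ?thesis
      unfolding cost using nn_integral_cong_AE[OF AEs(1)] nnM intF by simp
  qed
qed

end

section \<open>Existence and uniqueness of the extremal path\<close>

context stable_network
begin

section \<open>Construction of the path backwards from its endpoint\<close>

lemma good_empty: "good {}"
  using harmonic[of "{}"] by (simp add: good_def)

text \<open>\<open>harmonic J\<close> is a supersolution of the boundary value problem for J', so
  \<open>harmonic J'\<close> lies below it and inherits the bound by \<zeta>.\<close>

lemma good_supersolution:
  assumes "good J" "\<And>k. k \<in> J' \<Longrightarrow> (P *v harmonic J) $ k \<le> harmonic J $ k" "J \<subseteq> J'"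
  shows "good J'"
proof -
  have "harmonic J' $ k \<le> harmonic J $ k" for k
    by (rule harmonic_le_supersolution) (use assms harmonic[of J] in auto)
  then show ?thesis using assms(1) unfolding good_def by (meson order_trans)
qed

lemma velocity_nonneg_iff: "0 \<le> velocity J $ k \<longleftrightarrow> (P *v harmonic J) $ k \<le> harmonic J $ k"
  using \<nu>_pos[of k] by (simp add: velocity_def zero_le_mult_iff)

text \<open>The face entered at once when the velocity of J is followed backwards from x: a
  vanishing coordinate outside J has negative velocity and so becomes positive backwards.\<close>

definition departs :: "'n set \<Rightarrow> real^'n \<Rightarrow> bool" where
  "departs J x \<longleftrightarrow> (\<forall>k\<in>J. x $ k = 0) \<and> (\<forall>k. k \<notin> J \<longrightarrow> 0 < x $ k \<or> x $ k = 0 \<and> velocity J $ k < 0)"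

text \<open>A maximal good subset J of the zeros of x works. If another zero k had nonnegative
  velocity, \<open>harmonic J\<close> would be superharmonic at k too, and adding k would keep J
  good.\<close>

lemma ex_departs:
  assumes "\<And>k. 0 \<le> x $ k"
  shows "\<exists>J. good J \<and> departs J x"
proof -
  let ?A = "{J. good J \<and> J \<subseteq> zeros x}"
  have "finite ?A" "{} \<in> ?A" using good_empty by auto
  from finite_has_maximal2[OF this] obtain J where J: "J \<in> ?A" "\<forall>J'\<in>?A. J \<subseteq> J' \<longrightarrow> J = J'"
    by (elim bexE conjE)
  have "velocity J $ k < 0" if k: "k \<notin> J" "x $ k = 0" for k
  proof (rule ccontr)
    assume "\<not> velocity J $ k < 0"
    then have k_super: "(P *v harmonic J) $ k \<le> harmonic J $ k" using velocity_nonneg_iff[of J k] by simp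
    have "good (insert k J)"
    proof (rule good_supersolution)
      show "good J" "J \<subseteq> insert k J" using J(1) by blast+
      show "(P *v harmonic J) $ j \<le> harmonic J $ j" if "j \<in> insert k J" for j
        using k_super harmonic[of J j] that by (cases "j = k") simp_all
    qed
    then have "insert k J \<in> ?A" using J(1) k by (simp add: zeros_def)
    then show False using J(2) k(1) by blast
  qed
  then have "departs J x" using J(1) assms unfolding departs_def zeros_def
    by (auto simp: order.order_iff_strict)
  then show ?thesis using J(1) by blast
qed

lemma departs_face:
  assumes "x \<in> face J"
  shows "departs J x"
proof -
  have "x $ k = 0" if "k \<in> J" for k using assms that by (simp add: face_def)
  moreover have "0 < x $ k" if "k \<notin> J" for k using assms that by (simp add: face_def)
  ultimately show ?thesis by (simp add: departs_def)
qed

text \<open>Followed backwards from \<open>x\<close>, the velocity of \<open>J\<close> stays in the face of \<open>J\<close> until a coordinate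
  outside \<open>J\<close> vanishes; the comparison principle makes the enlarged zero set good again.\<close>

lemma backward_step:
  assumes "good J" "departs J x" "J \<noteq> UNIV"
  obtains s x' J' where "0 < s" "x = x' + s *\<^sub>R velocity J" "x' \<in> face J'" "good J'" "J \<subset> J'"
    "\<And>u. 0 < u \<Longrightarrow> u < s \<Longrightarrow> x' + u *\<^sub>R velocity J \<in> face J"
proof -
  let ?v = "velocity J"
  have xJ: "x $ k = 0" if "k \<in> J" for k using assms(2) that by (simp add: departs_def)
  have xoff: "0 < x $ k \<or> x $ k = 0 \<and> ?v $ k < 0" if "k \<notin> J" for k using assms(2) that by (simp add: departs_def)
  have x_nn: "0 \<le> x $ k" for k using xJ[of k] xoff[of k] by force
  define S where "S = {k. 0 < ?v $ k}"
  have SJ: "k \<notin> J" if "k \<in> S" for k using that velocity_on[of k J] by (auto simp: S_def)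
  have xS: "0 < x $ k" if "k \<in> S" for k using xoff[OF SJ[OF that]] that by (auto simp: S_def)
  \<comment> \<open>S holds the coordinates that decrease backwards. Were it empty,
    \<open>harmonic J\<close> would be subharmonic at every node, hence nonpositive, but it equals
    \<zeta> > 0 off J.\<close>
  have "S \<noteq> {}"
  proof
    assume "S = {}"
    then have "harmonic J $ k \<le> (P *v harmonic J) $ k" for k
      using \<nu>_pos[of k] by (force simp: S_def velocity_def zero_less_mult_iff not_less)
    then have "(P *v (- harmonic J)) $ k \<le> (- harmonic J) $ k" for k
      by (simp add: P_apply sum_negf)
    then have "0 \<le> (- harmonic J) $ k" for k by (rule comparison[of UNIV]) auto
    moreover obtain k where "k \<notin> J" using assms(3) by blast
    ultimately show False using harmonic[of J k] \<zeta>_pos[of k] by (metis less_le_not_le neg_0_le_iff_le vector_uminus_component)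
  qed
  \<comment> \<open>The first backward time at which a coordinate of S reaches 0.\<close>
  define s where "s = Min ((\<lambda>k. x $ k / ?v $ k) ` S)"
  have "s \<in> (\<lambda>k. x $ k / ?v $ k) ` S" unfolding s_def using \<open>S \<noteq> {}\<close> by (intro Min_in) auto
  then obtain i where i: "i \<in> S" "s = x $ i / ?v $ i" by blast
  have "0 < s" using i xS by (simp add: S_def)
  have s_le: "s * ?v $ k \<le> x $ k" if "k \<in> S" for k
  proof -
    have "s \<le> x $ k / ?v $ k" unfolding s_def using that by (intro Min_le) auto
    then show ?thesis using that by (simp add: S_def pos_le_divide_eq)
  qed
  define x' where "x' = x - s *\<^sub>R ?v"
  \<comment> \<open>The case u = s, for coordinates outside S, shows that every new zero at the end
    of the segment belongs to S.\<close>
  have inside: "0 < x $ k - u * ?v $ k" if "0 < u" "u < s \<or> k \<notin> S \<and> u = s" "k \<notin> J" for u k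
  proof (cases "k \<in> S")
    case True
    then have "u * ?v $ k < s * ?v $ k" using that by (simp add: S_def)
    then show ?thesis using s_le[OF True] by linarith
  next
    case False
    then have "u * ?v $ k \<le> 0" using \<open>0 < u\<close> by (simp add: S_def mult_le_0_iff)
    moreover have "u * ?v $ k < 0" if "?v $ k < 0" using \<open>0 < u\<close> that by (simp add: mult_less_0_iff)
    ultimately show ?thesis using xoff[OF that(3)] by auto
  qed
  have x'_nn: "0 \<le> x' $ k" for k
  proof (cases "k \<in> J")
    case True
    then show ?thesis using xJ velocity_on by (simp add: x'_def)
  next
    case False
    then show ?thesis
      using inside[of s k] s_le[of k] \<open>0 < s\<close> by (cases "k \<in> S") (auto simp: x'_def)
  qed
  define J' where "J' = zeros x'"
  have "x' \<in> face J'" unfolding J'_def by (rule face_zeros[OF x'_nn])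
  have "J \<subseteq> J'" using xJ velocity_on by (auto simp: J'_def zeros_def x'_def)
  moreover have "i \<in> J'" using i by (simp add: J'_def zeros_def x'_def S_def)
  ultimately have "J \<subset> J'" using SJ[OF i(1)] by blast
  have "good J'"
  proof (rule good_supersolution[OF \<open>good J\<close> _ \<open>J \<subseteq> J'\<close>])
    fix k assume "k \<in> J'"
    then have "k \<in> J \<or> k \<in> S"
      using inside[of s k] \<open>0 < s\<close> by (force simp: J'_def zeros_def x'_def)
    \<comment> \<open>A coordinate that reached 0 backwards has positive velocity, which is
      superharmonicity of \<open>harmonic J\<close> at that node.\<close>
    then have "0 \<le> ?v $ k" using velocity_on[of k J] by (auto simp: S_def)
    then show "(P *v harmonic J) $ k \<le> harmonic J $ k" by (simp add: velocity_nonneg_iff)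
  qed
  have "x' + u *\<^sub>R ?v \<in> face J" if u: "0 < u" "u < s" for u
  proof -
    have e: "(x' + u *\<^sub>R ?v) $ k = x $ k - (s - u) * ?v $ k" for k by (simp add: x'_def algebra_simps)
    have "(x' + u *\<^sub>R ?v) $ k = 0" if "k \<in> J" for k unfolding e using xJ velocity_on that by simp
    moreover have "0 < (x' + u *\<^sub>R ?v) $ k" if "k \<notin> J" for k unfolding e using inside[of "s - u" k] u that by simp
    ultimately show ?thesis by (simp add: face_def)
  qed
  then show ?thesis
    using that[of s x' J'] \<open>0 < s\<close> \<open>x' \<in> face J'\<close> \<open>good J'\<close> \<open>J \<subset> J'\<close> by (simp add: x'_def)
qed

text \<open>Segment i + 1 runs forwards from t i to t (Suc i) in the face of K (Suc i). An interior
  breakpoint still lies in the face of the segment ending there, since a coordinate newly growing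
  from 0 is still 0 at that time.\<close>

definition polygonal :: "nat \<Rightarrow> (nat \<Rightarrow> real) \<Rightarrow> (nat \<Rightarrow> 'n set) \<Rightarrow> (real \<Rightarrow> real^'n) \<Rightarrow> real^'n \<Rightarrow> bool" where
  "polygonal n t K q x \<longleftrightarrow> t 0 = 0 \<and> q 0 = 0 \<and> q (t n) = x \<and>
     (\<forall>i<n. t i < t (Suc i) \<and> good (K (Suc i)) \<and> K (Suc i) \<noteq> UNIV \<and>
        (\<forall>s\<in>{t i..t (Suc i)}. q s = q (t i) + (s - t i) *\<^sub>R velocity (K (Suc i))) \<and>
        (\<forall>s\<in>{t i<..<t (Suc i)}. q s \<in> face (K (Suc i)))) \<and>
     (\<forall>i\<in>{1..<n}. K (Suc i) \<subset> K i \<and> q (t i) \<in> face (K i))"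

lemma polygonalD:
  assumes "polygonal n t K q x"
  shows "t 0 = 0" "q 0 = 0" "q (t n) = x"
    "\<And>i. i < n \<Longrightarrow> t i < t (Suc i)" "\<And>i. i < n \<Longrightarrow> good (K (Suc i))" "\<And>i. i < n \<Longrightarrow> K (Suc i) \<noteq> UNIV"
    "\<And>i s. i < n \<Longrightarrow> t i \<le> s \<Longrightarrow> s \<le> t (Suc i) \<Longrightarrow> q s = q (t i) + (s - t i) *\<^sub>R velocity (K (Suc i))"
    "\<And>i s. i < n \<Longrightarrow> t i < s \<Longrightarrow> s < t (Suc i) \<Longrightarrow> q s \<in> face (K (Suc i))"
    "\<And>i. 1 \<le> i \<Longrightarrow> i < n \<Longrightarrow> K (Suc i) \<subset> K i" "\<And>i. 1 \<le> i \<Longrightarrow> i < n \<Longrightarrow> q (t i) \<in> face (K i)"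
proof -
  show "t 0 = 0" "q 0 = 0" "q (t n) = x" using assms by (simp_all only: polygonal_def)
  have B: "\<forall>i<n. t i < t (Suc i) \<and> good (K (Suc i)) \<and> K (Suc i) \<noteq> UNIV \<and>
        (\<forall>s\<in>{t i..t (Suc i)}. q s = q (t i) + (s - t i) *\<^sub>R velocity (K (Suc i))) \<and>
        (\<forall>s\<in>{t i<..<t (Suc i)}. q s \<in> face (K (Suc i)))"
    using assms unfolding polygonal_def by (elim conjE)
  have C: "\<forall>i\<in>{1..<n}. K (Suc i) \<subset> K i \<and> q (t i) \<in> face (K i)"
    using assms unfolding polygonal_def by (elim conjE)
  fix i s
  show "t i < t (Suc i)" "good (K (Suc i))" "K (Suc i) \<noteq> UNIV" if "i < n"
    using B that by blast+
  show "q s = q (t i) + (s - t i) *\<^sub>R velocity (K (Suc i))" if "i < n" "t i \<le> s" "s \<le> t (Suc i)"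
    using B that by (meson atLeastAtMost_iff)
  show "q s \<in> face (K (Suc i))" if "i < n" "t i < s" "s < t (Suc i)"
    using B that by (meson greaterThanLessThan_iff)
  show "K (Suc i) \<subset> K i" "q (t i) \<in> face (K i)" if "1 \<le> i" "i < n"
    using C that by (meson atLeastLessThan_iff)+
qed

lemma polygonal_mono:
  assumes "polygonal n t K q x" "i \<le> j" "j \<le> n"
  shows "t i \<le> t j"
  using assms(2,3)
proof (induction j rule: dec_induct)
  case (step k)
  then show ?case using polygonalD(4)[OF assms(1), of k] by simp
qed simp

text \<open>Each backward step strictly enlarges the zero set, so induction on the number of
  remaining coordinates ends at the origin. The path to x' is extended at its end by the segment
  from x' to x.\<close>

lemma polygonal_exists:
  assumes "good J" "departs J x"
  shows "\<exists>n t K q. polygonal n t K q x \<and> (0 < n \<longrightarrow> K n = J) \<and> (n = 0 \<longrightarrow> x = 0)"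
  using assms
proof (induction "card (- J)" arbitrary: J x rule: less_induct)
  case less
  show ?case
  proof (cases "J = UNIV")
    case True
    then have "x = 0" using less.prems(2) by (simp add: departs_def vec_eq_iff)
    then have "polygonal 0 (\<lambda>_. 0) (\<lambda>_. J) (\<lambda>_. 0) x" by (simp add: polygonal_def)
    then show ?thesis using \<open>x = 0\<close> by blast
  next
    case False
    obtain s x' J' where s: "0 < s" "x = x' + s *\<^sub>R velocity J" "x' \<in> face J'" "good J'" "J \<subset> J'"
      "\<And>u. 0 < u \<Longrightarrow> u < s \<Longrightarrow> x' + u *\<^sub>R velocity J \<in> face J"
      using backward_step[OF less.prems False] by blast
    have "card (- J') < card (- J)" using s(5) by (intro psubset_card_mono) auto
    then obtain n t K q where IH: "polygonal n t K q x'" "0 < n \<longrightarrow> K n = J'" "n = 0 \<longrightarrow> x' = 0"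
      using less.hyps[OF _ s(4) departs_face[OF s(3)]] by blast
    note D = polygonalD[OF IH(1)]
    define t' where "t' = t(Suc n := t n + s)"
    define K' where "K' = K(Suc n := J)"
    define q' where "q' = (\<lambda>u. if u \<le> t n then q u else x' + (u - t n) *\<^sub>R velocity J)"
    have t'_le: "t' i = t i" "K' i = K i" if "i \<le> n" for i using that by (auto simp: t'_def K'_def)
    have q'_le: "q' u = q u" if "u \<le> t n" for u using that by (simp add: q'_def)
    have t_le: "t i \<le> t n" if "i \<le> n" for i using polygonal_mono[OF IH(1) that] by simp
    have "polygonal (Suc n) t' K' q' x"
      unfolding polygonal_def
    proof (intro conjI allI impI ballI)
      show "t' 0 = 0" using D(1) t'_le[of 0] by simp
      show "q' 0 = 0" using D(1,2) t_le[of 0] by (simp add: q'_def)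
      show "q' (t' (Suc n)) = x" using s(1,2) by (simp add: q'_def t'_def)
    next
      fix i assume "i < Suc n"
      then consider "i < n" | "i = n" by linarith
      then show "t' i < t' (Suc i)" using D(4)[of i] s(1) by cases (auto simp: t'_def)
      show "good (K' (Suc i))" using D(5)[of i] less.prems(1) \<open>i < Suc n\<close> by (auto simp: K'_def)
      show "K' (Suc i) \<noteq> UNIV" using D(6)[of i] False \<open>i < Suc n\<close> by (auto simp: K'_def)
    next
      fix i u assume i: "i < Suc n" and u: "u \<in> {t' i..t' (Suc i)}"
      show "q' u = q' (t' i) + (u - t' i) *\<^sub>R velocity (K' (Suc i))"
      proof (cases "i < n")
        case True
        then have "u \<le> t n" "t i \<le> t n" using u t_le[of "Suc i"] t_le[of i] t'_le[of "Suc i"] by auto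
        then show ?thesis using True D(7)[of i u] u by (simp add: t'_le q'_le)
      next
        case False
        then have "i = n" using i by simp
        then show ?thesis using u D(3) by (auto simp: t'_def K'_def q'_def)
      qed
    next
      fix i u assume i: "i < Suc n" and u: "u \<in> {t' i<..<t' (Suc i)}"
      show "q' u \<in> face (K' (Suc i))"
      proof (cases "i < n")
        case True
        then have "u \<le> t n" using u t_le[of "Suc i"] t'_le[of "Suc i"] by auto
        then show ?thesis using True D(8)[of i u] u by (simp add: t'_le q'_le)
      next
        case False
        then have "i = n" using i by simp
        then show ?thesis using u s(6)[of "u - t n"] by (auto simp: t'_def K'_def q'_def)
      qed
    next
      fix i assume i: "i \<in> {1..<Suc n}"
      then show "K' (Suc i) \<subset> K' i" using D(9)[of i] IH(2) s(5) by (cases "i = n") (auto simp: K'_def)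
      show "q' (t' i) \<in> face (K' i)"
        using i D(3) D(10)[of i] IH(2) s(3) t_le[of i] by (cases "i = n") (auto simp: t'_le q'_le)
    qed
    then show ?thesis
      by (intro exI[of _ "Suc n"] exI[of _ t'] exI[of _ K'] exI[of _ q']) (simp add: K'_def)
  qed
qed

lemma polygonal_cases:
  assumes "polygonal n t K q x" "0 \<le> s" "s \<le> t n"
  obtains "s = 0" | "s = t n" | i where "1 \<le> i" "i < n" "s = t i" | i where "i < n" "t i < s" "s < t (Suc i)"
proof -
  note D = polygonalD[OF assms(1)]
  have "m \<le> n \<Longrightarrow> s \<le> t m \<Longrightarrow> (\<exists>i\<le>m. s = t i) \<or> (\<exists>i<m. t i < s \<and> s < t (Suc i))" for m
  proof (induction m)
    case 0
    then show ?case using D(1) assms(2) by auto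
  next
    case (Suc m)
    show ?case
    proof (cases "s \<le> t m")
      case True
      then show ?thesis using Suc by (metis Suc_leD le_SucI less_SucI)
    next
      case False
      then show ?thesis using Suc.prems by (metis le_refl lessI linorder_not_le order_le_less)
    qed
  qed
  from this[OF order_refl assms(3)] consider i where "i \<le> n" "s = t i" | i where "i < n" "t i < s" "s < t (Suc i)"
    by blast
  then show ?thesis
  proof cases
    case (1 i)
    then consider "i = 0" | "i = n" | "1 \<le> i" "i < n" by linarith
    then show ?thesis by cases (use 1 D(1) that(1-3) in auto)
  next
    case (2 i)
    then show ?thesis by (rule that(4))
  qed
qed

lemma polygonal_nonzero:
  assumes "polygonal n t K q x" "x \<noteq> 0" "0 < s" "s \<le> t n"
  shows "q s \<noteq> 0"
proof -
  note D = polygonalD[OF assms(1)]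
  have ne: "y \<noteq> 0" if "y \<in> face J" "J \<noteq> UNIV" for y :: "real^'n" and J
    using that by (auto simp: face_def)
  show ?thesis
    using polygonal_cases[OF assms(1) less_imp_le[OF assms(3)] assms(4)]
  proof cases
    case (3 i)
    have "K i \<noteq> UNIV" using D(6)[of "i - 1"] 3 by simp
    then show ?thesis using ne D(10)[of i] 3 by simp
  next
    case (4 i)
    then show ?thesis using ne[OF D(8)[of i s] D(6)[of i]] by simp
  qed (use assms D(3) in auto)
qed

lemma polygonal_nonneg:
  assumes "polygonal n t K q x" "\<And>k. 0 \<le> x $ k" "0 \<le> s" "s \<le> t n"
  shows "0 \<le> q s $ k"
proof -
  note D = polygonalD[OF assms(1)]
  have nn: "0 \<le> y $ k" if "y \<in> face J" for y :: "real^'n" and J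
    using that by (cases "k \<in> J") (auto simp: face_def less_imp_le)
  show ?thesis
    using polygonal_cases[OF assms(1,3,4)]
  proof cases
    case (3 i)
    then show ?thesis using nn[OF D(10)[of i]] by simp
  next
    case (4 i)
    then show ?thesis using nn[OF D(8)[of i s]] by simp
  qed (use assms(2) D(2,3) in auto)
qed

lemma polygonal_lipschitz:
  assumes "polygonal n t K q x"
  shows "\<exists>C. C-lipschitz_on {0..t n} q"
proof -
  note D = polygonalD[OF assms]
  define C where "C = (\<Sum>i<n. norm (velocity (K (Suc i))))"
  have C_ge: "norm (velocity (K (Suc i))) \<le> C" if "i < n" for i
    unfolding C_def using that by (intro member_le_sum) auto
  have "C \<ge> 0" unfolding C_def by (intro sum_nonneg) auto
  have "m \<le> n \<Longrightarrow> C-lipschitz_on {0..t m} q" for m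
  proof (induction m)
    case 0
    then show ?case using D(1) \<open>C \<ge> 0\<close> by (simp add: lipschitz_on_def)
  next
    case (Suc m)
    have "C-lipschitz_on {t m..t (Suc m)} q"
    proof (rule lipschitz_onI[OF _ \<open>C \<ge> 0\<close>])
      fix u w assume "u \<in> {t m..t (Suc m)}" "w \<in> {t m..t (Suc m)}"
      then have qu: "q u = q (t m) + (u - t m) *\<^sub>R velocity (K (Suc m))"
        and qw: "q w = q (t m) + (w - t m) *\<^sub>R velocity (K (Suc m))"
        using D(7)[of m u] D(7)[of m w] Suc.prems by simp_all
      have "q u - q w = (u - w) *\<^sub>R velocity (K (Suc m))"
        unfolding qu qw by (simp add: algebra_simps)
      then have "dist (q u) (q w) = dist u w * norm (velocity (K (Suc m)))"
        by (simp add: dist_norm)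
      also have "\<dots> \<le> C * dist u w" using mult_right_mono[OF C_ge[of m], of "dist u w"] Suc.prems by (simp add: mult.commute)
      finally show "dist (q u) (q w) \<le> C * dist u w" .
    qed
    \<comment> \<open>The trivial case distinction matches the form in which Lipschitz pieces are
      concatenated.\<close>
    then have "C-lipschitz_on {0..t (Suc m)} (\<lambda>s. if s \<le> t m then q s else q s)"
      using Suc by (intro lipschitz_on_concat) auto
    then show ?case by simp
  qed
  then show ?thesis by blast
qed

lemma polygonal_admissible:
  assumes "polygonal n t K q x" "\<And>k. 0 \<le> x $ k"
  shows "admissible x (t n) q"
  unfolding admissible_def
proof (intro conjI ballI allI)
  show "0 \<le> t n" using polygonal_mono[OF assms(1), of 0 n] polygonalD(1)[OF assms(1)] by simp
  show "abs_continuous_on 0 (t n) q"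
    using polygonal_lipschitz[OF assms(1)] lipschitz_imp_abs_continuous_on by blast
  show "0 \<le> q s $ k" if "s \<in> {0..t n}" for s k
    using polygonal_nonneg[OF assms, of s k] that by simp
  show "q 0 = 0" "q (t n) = x" using polygonalD(2,3)[OF assms(1)] by auto
qed

lemma polygonal_extremal:
  assumes "polygonal n t K q x"
  shows "extremal (t n) q"
  unfolding extremal_def
proof (rule negligible_subset)
  note D = polygonalD[OF assms]
  show "negligible (t ` {..n})" by (intro negligible_finite) auto
  show "{s \<in> {0..t n}. \<not> (good (zeros (q s)) \<and> (q has_vector_derivative velocity (zeros (q s))) (at s))} \<subseteq> t ` {..n}"
  proof (rule subsetI, rule ccontr)
    fix s assume s: "s \<in> {s \<in> {0..t n}. \<not> (good (zeros (q s)) \<and> (q has_vector_derivative velocity (zeros (q s))) (at s))}"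
      and "s \<notin> t ` {..n}"
    then have ne: "s \<noteq> t i" if "i \<le> n" for i using that by auto
    have "0 \<le> s" "s \<le> t n" using s by auto
    then obtain i where i: "i < n" "t i < s" "s < t (Suc i)"
      by (rule polygonal_cases[OF assms]) (use ne[of 0] ne D(1) in auto)
    have z: "zeros (q s) = K (Suc i)" using D(8)[OF i] by (rule zeros_face)
    have "((\<lambda>u. q (t i) + (u - t i) *\<^sub>R velocity (K (Suc i))) has_vector_derivative velocity (K (Suc i))) (at s)"
      by (auto intro!: derivative_eq_intros)
    then have "(q has_vector_derivative velocity (K (Suc i))) (at s)"
    proof (rule has_vector_derivative_transform_within_open)
      show "open {t i<..<t (Suc i)}" "s \<in> {t i<..<t (Suc i)}" using i by auto
      show "q (t i) + (u - t i) *\<^sub>R velocity (K (Suc i)) = q u" if "u \<in> {t i<..<t (Suc i)}" for u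
        using D(7)[OF i(1), of u] that by simp
    qed
    then show False using s z D(5)[OF i(1)] by simp
  qed
qed

section \<open>Uniqueness through potential coordinates\<close>

lemma ex_potential:
  obtains g :: "real^'n \<Rightarrow> real^'n"
  where "linear g" "\<And>x k. x $ k = \<nu> $ k * (g x $ k - (P *v g x) $ k)" "\<And>J. g (velocity J) = harmonic J"
proof -
  \<comment> \<open>R maps \<open>harmonic J\<close> to \<open>velocity J\<close>, so its inverse g
    turns the velocity of a path into the harmonic function of its face. Injectivity is the
    comparison principle on all nodes.\<close>
  define R :: "real^'n \<Rightarrow> real^'n" where "R u = (\<chi> k. \<nu> $ k * (u $ k - (P *v u) $ k))" for u
  have lin: "linear R"
    by (rule linearI)
       (auto simp: R_def vec_eq_iff matrix_vector_right_distrib matrix_vector_mult_scaleR algebra_simps)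
  have nn: "0 \<le> u $ k" if "R u = 0" for u k
    by (rule comparison[of UNIV]) (use that \<nu>_pos in \<open>auto simp: R_def vec_eq_iff less_le\<close>)
  have "u = 0" if "R u = 0" for u
  proof -
    have "R (- u) = 0" using linear_neg[OF lin, of u] that by simp
    then show ?thesis using nn[OF that] nn[of "- u"] by (simp add: vec_eq_iff order_antisym)
  qed
  then have "inj R" using lin by (simp add: linear_injective_0)
  then obtain g where g: "linear g" "g \<circ> R = id" using lin linear_injective_left_inverse by blast
  then have Rg: "R \<circ> g = id" using lin linear_inverse_left by blast
  show ?thesis
  proof
    show "linear g" by fact
    show "x $ k = \<nu> $ k * (g x $ k - (P *v g x) $ k)" for x k
      using fun_cong[OF Rg, of x] by (simp add: R_def vec_eq_iff)
    show "g (velocity J) = harmonic J" for J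
      using fun_cong[OF g(2), of "harmonic J"] by (simp add: R_def velocity_def)
  qed
qed

text \<open>The k-th potential moves at speed \<open>harmonic (zeros (q t)) $ k\<close>: goodness
  bounds it by \<zeta> k, and it equals \<zeta> k while the k-th coordinate is positive.\<close>

lemma potential_increments:
  assumes g: "linear g" "\<And>J. g (velocity J) = harmonic J"
    and ac: "abs_continuous_on 0 T q" and ext: "extremal T q" and cd: "0 \<le> c" "c \<le> d" "d \<le> T"
  shows "g (q d) $ k - g (q c) $ k \<le> \<zeta> k * (d - c)"
    and "(\<And>t. t \<in> {c..d} \<Longrightarrow> 0 < q t $ k) \<Longrightarrow> g (q d) $ k - g (q c) $ k = \<zeta> k * (d - c)"
proof -
  define w where "w = adjoint g (axis k 1)"
  have w: "w \<bullet> x = g x $ k" for x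
    using adjoint_works[OF g(1), of x "axis k 1"] by (simp add: w_def inner_axis inner_commute)
  define N where "N = {t \<in> {0..T}. \<not> (good (zeros (q t)) \<and> (q has_vector_derivative velocity (zeros (q t))) (at t))}"
  have N: "negligible N" using ext by (simp add: extremal_def N_def)
  have int: "((\<lambda>t. w \<bullet> vector_derivative q (at t)) has_integral (g (q d) $ k - g (q c) $ k)) {c..d}"
    using abs_continuous_on_FTC(2)[OF ac cd, of w] by (simp add: w)
  \<comment> \<open>The value \<zeta> k on N lets both estimates hold pointwise.\<close>
  have int': "((\<lambda>t. if t \<in> N then \<zeta> k else w \<bullet> vector_derivative q (at t)) has_integral (g (q d) $ k - g (q c) $ k)) {c..d}"
    by (rule has_integral_spike[OF N _ int]) auto
  have const: "((\<lambda>t. \<zeta> k) has_integral \<zeta> k * (d - c)) {c..d}"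
    using has_integral_const_real[of "\<zeta> k" c d] cd by (simp add: mult.commute)
  have val: "w \<bullet> vector_derivative q (at t) = harmonic (zeros (q t)) $ k" "good (zeros (q t))"
    if "t \<in> {c..d}" "t \<notin> N" for t
  proof -
    have der: "(q has_vector_derivative velocity (zeros (q t))) (at t)" and "good (zeros (q t))"
      using that cd by (auto simp: N_def)
    then show "w \<bullet> vector_derivative q (at t) = harmonic (zeros (q t)) $ k" "good (zeros (q t))"
      by (simp_all add: vector_derivative_at[OF der] w g(2))
  qed
  show "g (q d) $ k - g (q c) $ k \<le> \<zeta> k * (d - c)"
    by (rule has_integral_le[OF int' const]) (use val in \<open>auto simp: good_def\<close>)
  show "g (q d) $ k - g (q c) $ k = \<zeta> k * (d - c)" if pos: "\<And>t. t \<in> {c..d} \<Longrightarrow> 0 < q t $ k"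
  proof (rule has_integral_unique[OF int'])
    have "(if t \<in> N then \<zeta> k else w \<bullet> vector_derivative q (at t)) = \<zeta> k" if "t \<in> {c..d}" for t
      using val[OF that] pos[OF that] harmonic[of "zeros (q t)" k] by (auto simp: zeros_def)
    then show "((\<lambda>t. if t \<in> N then \<zeta> k else w \<bullet> vector_derivative q (at t)) has_integral \<zeta> k * (d - c)) {c..d}"
      using const by (subst has_integral_cong) auto
  qed
qed

text \<open>Backwards from the common endpoint both potentials increase at rate at most \<open>\<zeta>\<close>, with equality
  where the coordinate is positive.  At the first time that the weighted maximum of their difference
  is attained, the second path has the larger coordinate, so its potential has been growing at the
  maximal rate, and the difference was at least as large before.\<close>

lemma potential_le:
  assumes g: "linear g" "\<And>J. g (velocity J) = harmonic J" "\<And>x k. x $ k = \<nu> $ k * (g x $ k - (P *v g x) $ k)"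
    and q: "admissible r T q" "extremal T q" and q': "admissible r T' q'" "extremal T' q'"
    and s: "0 \<le> s" "s \<le> T" "s \<le> T'"
  shows "g (q' (T' - s)) $ k \<le> g (q (T - s)) $ k"
proof (rule ccontr)
  assume neg: "\<not> g (q' (T' - s)) $ k \<le> g (q (T - s)) $ k"
  have ac: "abs_continuous_on 0 T q" "abs_continuous_on 0 T' q'" and T: "0 \<le> T" "0 \<le> T'"
    and nn: "\<And>t k. t \<in> {0..T} \<Longrightarrow> 0 \<le> q t $ k"
    and end_eq: "q T = r" "q' T' = r"
    using q(1) q'(1) by (auto simp: admissible_def)
  \<comment> \<open>Division by m makes a maximum over nodes compatible with
    \<open>m_super\<close>.\<close>
  define \<Delta> where "\<Delta> u k = (g (q' (T' - u)) $ k - g (q (T - u)) $ k) / m $ k" for u k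
  define f where "f u = Max (range (\<Delta> u))" for u
  have \<Delta>f: "\<Delta> u k \<le> f u" for u k unfolding f_def by (intro Max_ge) auto
  have f\<Delta>: "\<exists>k. f u = \<Delta> u k" for u
  proof -
    have "f u \<in> range (\<Delta> u)" unfolding f_def by (intro Max_in) auto
    then show ?thesis by auto
  qed
  have cont_q: "continuous_on {0..s} (\<lambda>u. q (T - u))" "continuous_on {0..s} (\<lambda>u. q' (T' - u))"
    by (rule continuous_on_compose2[OF abs_continuous_on_imp_continuous_on[OF ac(1)]]
             continuous_on_compose2[OF abs_continuous_on_imp_continuous_on[OF ac(2)]];
        use s in \<open>auto intro!: continuous_intros\<close>)+
  have cont\<Delta>: "continuous_on {0..s} (\<lambda>u. \<Delta> u k)" for k
  proof -
    have lc: "continuous_on UNIV g" using g(1) by (simp add: linear_continuous_on linear_conv_bounded_linear)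
    show ?thesis unfolding \<Delta>_def
      by (intro continuous_intros continuous_on_compose2[OF lc] cont_q) (use m_pos in \<open>auto simp: less_imp_neq[THEN not_sym]\<close>)
  qed
  have "compact {0..s}" "{0..s} \<noteq> {}" using s by auto
  then have "\<exists>u\<in>{0..s}. \<forall>v\<in>{0..s}. \<Delta> v k \<le> \<Delta> u k" for k
    using continuous_attains_sup[OF _ _ cont\<Delta>] by blast
  then obtain U where U: "\<And>k. U k \<in> {0..s}" "\<And>k v. v \<in> {0..s} \<Longrightarrow> \<Delta> v k \<le> \<Delta> (U k) k"
    by metis
  define M where "M = Max (range (\<lambda>k. \<Delta> (U k) k))"
  have M_ge: "\<Delta> v k \<le> M" if "v \<in> {0..s}" for v k
    using U(2)[OF that, of k] unfolding M_def by (intro order_trans[OF _ Max_ge]) auto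
  have "M \<in> range (\<lambda>k. \<Delta> (U k) k)" unfolding M_def by (intro Max_in) auto
  then obtain k0 where k0: "M = \<Delta> (U k0) k0" by blast
  have "0 < \<Delta> s k" using neg m_pos[of k] by (simp add: \<Delta>_def)
  then have "0 < M" using M_ge[of s k] s by simp
  \<comment> \<open>All backward times at which some node attains the overall maximum M; its least
    element is positive because both paths end at r.\<close>
  define A where "A = (\<Union>k. {u \<in> {0..s}. \<Delta> u k = M})"
  have "closed A" unfolding A_def
    by (intro closed_UN ballI continuous_closed_preimage_constant cont\<Delta>) auto
  moreover have "A \<noteq> {}" "bdd_below A" using U(1)[of k0] k0 by (auto simp: A_def intro!: bdd_belowI[of _ 0])
  ultimately have "Inf A \<in> A" by (intro closed_contains_Inf)
  define u where "u = Inf A"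
  obtain j where j: "u \<in> {0..s}" "\<Delta> u j = M" using \<open>Inf A \<in> A\<close> by (auto simp: A_def u_def)
  have first: "u \<le> v" if "v \<in> A" for v unfolding u_def using that \<open>bdd_below A\<close> by (rule cInf_lower)
  have "\<Delta> 0 j = 0" by (simp add: \<Delta>_def end_eq)
  then have "0 < u" using j \<open>0 < M\<close> by (cases "u = 0") auto
  define D where "D = g (q' (T' - u)) - g (q (T - u))"
  have D_le: "D $ k \<le> (M *s m) $ k" for k
    using M_ge[OF j(1), of k] m_pos[of k] by (simp add: \<Delta>_def D_def pos_divide_le_eq)
  have Dj: "D $ j = M * m $ j" using j(2) m_pos[of j] by (simp add: \<Delta>_def D_def field_simps)
  \<comment> \<open>D lies below M m and touches it at j, so D_j exceeds (P D)_j. In the original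
    coordinates this says that the second path is strictly larger at j.\<close>
  have "(P *v D) $ j \<le> (P *v (M *s m)) $ j" by (rule P_mono[OF D_le])
  also have "\<dots> = M * (P *v m) $ j" by (simp add: P_apply sum_distrib_left mult.left_commute)
  also have "\<dots> < M * m $ j" using m_super[of j] \<open>0 < M\<close> by simp
  finally have "0 < \<nu> $ j * (D $ j - (P *v D) $ j)" using Dj \<nu>_pos[of j] by simp
  also have "\<dots> = q' (T' - u) $ j - q (T - u) $ j"
    using g(3)[of "q' (T' - u)" j] g(3)[of "q (T - u)" j]
    by (simp add: D_def matrix_vector_mult_diff_distrib algebra_simps)
  finally have pos: "0 < q' (T' - u) $ j" using nn[of "T - u" j] j s by auto
  have "continuous_on {0..s} (\<lambda>v. q' (T' - v) $ j)" using cont_q(2) by (intro continuous_intros)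
  then obtain d where d: "d > 0" "\<And>v. v \<in> {0..s} \<Longrightarrow> dist v u < d \<Longrightarrow> dist (q' (T' - v) $ j) (q' (T' - u) $ j) < q' (T' - u) $ j"
    using j(1) pos unfolding continuous_on_iff by blast
  define v where "v = max 0 (u - d / 2)"
  have v: "0 \<le> v" "v < u" "u - v < d" using \<open>0 < u\<close> \<open>0 < d\<close> by (auto simp: v_def)
  have pos': "0 < q' t $ j" if "t \<in> {T' - u..T' - v}" for t
  proof -
    have "T' - t \<in> {0..s}" "dist (T' - t) u < d" using that v j(1) by (auto simp: dist_real_def)
    from d(2)[OF this] show ?thesis by (auto simp: dist_real_def)
  qed
  have "g (q' (T' - v)) $ j - g (q' (T' - u)) $ j = \<zeta> j * ((T' - v) - (T' - u))"
    by (rule potential_increments(2)[OF g(1,2) ac(2) q'(2)]) (use pos' v j s in auto)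
  moreover have "g (q (T - v)) $ j - g (q (T - u)) $ j \<le> \<zeta> j * ((T - v) - (T - u))"
    by (rule potential_increments(1)[OF g(1,2) ac(1) q(2)]) (use v j s in auto)
  \<comment> \<open>The two increments have equal duration u - v, so subtraction shows that the
    difference at v is no smaller than at u.\<close>
  ultimately have "D $ j \<le> g (q' (T' - v)) $ j - g (q (T - v)) $ j" by (simp add: D_def)
  then have "M \<le> \<Delta> v j" using Dj m_pos[of j] by (simp add: \<Delta>_def pos_le_divide_eq)
  moreover have "v \<in> {0..s}" using v j(1) by auto
  ultimately have "v \<in> A" using M_ge[of v j] by (auto simp: A_def)
  then show False using first v by force
qed

lemma extremal_unique:
  assumes q: "admissible r T q" "extremal T q" and q': "admissible r T' q'" "extremal T' q'"
    and s: "0 \<le> s" "s \<le> T" "s \<le> T'"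
  shows "q (T - s) = q' (T' - s)"
proof -
  obtain g :: "real^'n \<Rightarrow> real^'n" where g: "linear g" "\<And>x k. x $ k = \<nu> $ k * (g x $ k - (P *v g x) $ k)"
      "\<And>J. g (velocity J) = harmonic J"
    using ex_potential by blast
  have "g (q (T - s)) = g (q' (T' - s))"
    unfolding vec_eq_iff
    using potential_le[OF g(1,3,2) q q' s] potential_le[OF g(1,3,2) q' q s(1,3,2)] by (metis order_antisym)
  moreover have "x = y" if "g x = g y" for x y
    unfolding vec_eq_iff
  proof
    fix k
    have "x $ k = \<nu> $ k * (g x $ k - (P *v g x) $ k)" by (rule g(2))
    also have "\<dots> = \<nu> $ k * (g y $ k - (P *v g y) $ k)" by (simp only: that)
    also have "\<dots> = y $ k" by (rule g(2)[symmetric])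
    finally show "x $ k = y $ k" .
  qed
  ultimately show ?thesis by blast
qed

text \<open>Along an extremal path \<alpha> . q is nondecreasing, since its rate equals the
  nonnegative Lagrangian. If it is 0 at time c it was 0 before, and \<alpha> is positive.\<close>

lemma extremal_return_zero:
  assumes q: "admissible r T q" "extremal T q" and c: "0 \<le> c" "c \<le> T" "q c = 0" and t: "t \<in> {0..c}"
  shows "q t = 0"
proof -
  have ac: "abs_continuous_on 0 T q" using q(1) by (simp add: admissible_def)
  have "t \<in> {0..T}" using t c by auto
  then have nn: "0 \<le> q t $ k" for k using q(1) unfolding admissible_def by blast
  define N where "N = {t \<in> {0..T}. \<not> (good (zeros (q t)) \<and> (q has_vector_derivative velocity (zeros (q t))) (at t))}"
  have N: "negligible N" using q(2) by (simp add: extremal_def N_def)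
  have int: "((\<lambda>t. \<alpha> \<bullet> vector_derivative q (at t)) has_integral (\<alpha> \<bullet> q c - \<alpha> \<bullet> q t)) {t..c}"
    by (rule abs_continuous_on_FTC(2)[OF ac]) (use t c in auto)
  have int': "((\<lambda>t. if t \<in> N then 0 else \<alpha> \<bullet> vector_derivative q (at t)) has_integral (\<alpha> \<bullet> q c - \<alpha> \<bullet> q t)) {t..c}"
    by (rule has_integral_spike[OF N _ int]) auto
  have "0 \<le> \<alpha> \<bullet> velocity J" if "good J" for J
    using L_face_velocity[OF that] L_face_nonneg[of P lam \<mu> J "velocity J"] by simp
  then have "0 \<le> \<alpha> \<bullet> q c - \<alpha> \<bullet> q t"
    by (intro has_integral_nonneg[OF int']) (use t c in \<open>auto simp: N_def vector_derivative_at\<close>)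
  then have "(\<Sum>k\<in>UNIV. \<alpha> $ k * q t $ k) \<le> 0" using c(3) by (simp add: inner_vec_def)
  moreover have "0 \<le> \<alpha> $ k * q t $ k" for k using \<alpha>_pos[of k] nn[of k] by simp
  ultimately have "(\<Sum>k\<in>UNIV. \<alpha> $ k * q t $ k) = 0" by (simp add: sum_nonneg order_antisym)
  then have "\<alpha> $ k * q t $ k = 0" for k
    using \<open>\<And>k. 0 \<le> \<alpha> $ k * q t $ k\<close> by (simp add: sum_nonneg_eq_0_iff)
  then show ?thesis using \<alpha>_pos by (simp add: vec_eq_iff) (metis less_irrefl)
qed

text \<open>The polygonal path attains the lower bound, so every optimal trajectory is extremal and
  agrees with it backwards from r. Aligning the terminal times leaves only an initial interval, on
  which \<open>extremal_return_zero\<close> keeps the path at the origin.\<close>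

theorem optimal_trajectory_structure:
  assumes r_nn: "\<And>k. 0 \<le> r $ k" and "r \<noteq> 0"
  shows "\<exists>Tstar qstar.
    optimal_trajectory P lam \<mu> r Tstar qstar \<and>
    (\<forall>s. 0 < s \<and> s \<le> Tstar \<longrightarrow> qstar s \<noteq> 0) \<and>
    (\<forall>T q. optimal_trajectory P lam \<mu> r T q \<longrightarrow>
       Tstar \<le> T \<and>
       (\<forall>s\<in>{0..T - Tstar}. q s = 0) \<and>
       (\<forall>s\<in>{0..Tstar}. q (T - Tstar + s) = qstar s)) \<and>
    (\<exists>(n::nat) (t :: nat \<Rightarrow> real) (J :: nat \<Rightarrow> 'n set).
       1 \<le> n \<and> t 0 = 0 \<and> t n = Tstar \<and>
       (\<forall>i<n. t i < t (Suc i)) \<and>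
       (\<forall>i\<in>{1..<n}. J (Suc i) \<subset> J i) \<and>
       (\<forall>i\<in>{1..n}.
          affine_on_interval (t (i - 1)) (t i) qstar \<and>
          (\<forall>s\<in>{t (i - 1)<..<t i}. qstar s \<in> face (J i))) \<and>
       inj_on J {1..n})"
proof -
  obtain J0 where "good J0" "departs J0 r" using ex_departs[OF r_nn] by auto
  then obtain n t J q where poly: "polygonal n t J q r" and "n = 0 \<longrightarrow> r = 0"
    using polygonal_exists by blast
  then have "n \<ge> 1" using \<open>r \<noteq> 0\<close> by (cases n) auto
  note D = polygonalD[OF poly]
  have adm: "admissible r (t n) q" by (rule polygonal_admissible[OF poly r_nn])
  have ext: "extremal (t n) q" by (rule polygonal_extremal[OF poly])
  have cost: "path_cost P lam \<mu> (t n) q = ennreal (\<alpha> \<bullet> r)" by (rule extremal_imp_path_cost[OF adm ext])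
  have "0 \<le> \<alpha> \<bullet> r" unfolding inner_vec_def using \<alpha>_pos r_nn by (intro sum_nonneg) (simp add: less_imp_le)
  have opt: "optimal_trajectory P lam \<mu> r (t n) q"
    unfolding optimal_trajectory_def using adm cost path_cost_ge by simp
  have nz: "q s \<noteq> 0" if "0 < s" "s \<le> t n" for s using polygonal_nonzero[OF poly \<open>r \<noteq> 0\<close> that] .
  have uniq: "t n \<le> T \<and> (\<forall>s\<in>{0..T - t n}. q' s = 0) \<and> (\<forall>s\<in>{0..t n}. q' (T - t n + s) = q s)"
    if "optimal_trajectory P lam \<mu> r T q'" for T q'
  proof -
    have adm': "admissible r T q'" using that by (simp add: optimal_trajectory_def)
    have "path_cost P lam \<mu> T q' \<le> ennreal (\<alpha> \<bullet> r)"
      using that adm cost unfolding optimal_trajectory_def by metis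
    then have ext': "extremal T q'" by (rule path_cost_le_imp_extremal[OF adm' _ \<open>0 \<le> \<alpha> \<bullet> r\<close>])
    have "0 \<le> T" "q' 0 = 0" "0 \<le> t n" using adm adm' by (auto simp: admissible_def)
    have eq: "q' (T - s) = q (t n - s)" if "0 \<le> s" "s \<le> T" "s \<le> t n" for s
      by (rule extremal_unique[OF adm' ext' adm ext that])
    have le: "t n \<le> T"
    proof (rule ccontr)
      assume "\<not> t n \<le> T"
      \<comment> \<open>A competitor of shorter duration would be at 0 at backward time T, where the
        polygonal path is not yet 0.\<close>
      then show False using eq[of T] nz[of "t n - T"] \<open>0 \<le> T\<close> \<open>q' 0 = 0\<close> by simp
    qed
    have shift: "q' (T - t n + s) = q s" if "s \<in> {0..t n}" for s
      using eq[of "t n - s"] that le by (simp add: algebra_simps)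
    have "q' (T - t n) = 0" using shift[of 0] \<open>0 \<le> t n\<close> D(2) by simp
    then have "\<forall>s\<in>{0..T - t n}. q' s = 0"
      using extremal_return_zero[OF adm' ext', of "T - t n"] le \<open>0 \<le> t n\<close> by simp
    then show ?thesis using le shift by blast
  qed
  have affine: "affine_on_interval (t (i - 1)) (t i) q" if "i \<in> {1..n}" for i
    unfolding affine_on_interval_def
  proof (intro exI ballI)
    fix s assume "s \<in> {t (i - 1)..t i}"
    moreover have "i - 1 < n" "Suc (i - 1) = i" using that by auto
    ultimately show "q s = (q (t (i - 1)) - t (i - 1) *\<^sub>R velocity (J i)) + s *\<^sub>R velocity (J i)"
      using D(7)[of "i - 1" s] that by (simp add: scaleR_diff_left del: One_nat_def)
  qed
  have in_face: "q s \<in> face (J i)" if "i \<in> {1..n}" "s \<in> {t (i - 1)<..<t i}" for i s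
  proof -
    have "i - 1 < n" "Suc (i - 1) = i" using that by auto
    then show ?thesis using D(8)[of "i - 1" s] that by simp
  qed
  have J_less: "J k \<subset> J i" if "1 \<le> i" "Suc i \<le> k" "k \<le> n" for i k
    using that(2,3)
  proof (induction k rule: dec_induct)
    case base
    then show ?case using D(9)[of i] that(1) by simp
  next
    case (step k)
    then have "J (Suc k) \<subset> J k" using D(9)[of k] that(1) by simp
    then show ?case using step by (meson Suc_leD psubset_trans)
  qed
  have "inj_on J {1..n}"
  proof (rule linorder_inj_onI')
    fix i k assume "i \<in> {1..n}" "k \<in> {1..n}" "i < k"
    then show "J i \<noteq> J k" using J_less[of i k] by auto
  qed
  show ?thesis
  proof (rule exI[of _ "t n"], rule exI[of _ q], intro conjI)
    show "optimal_trajectory P lam \<mu> r (t n) q" by (rule opt)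
    show "\<forall>s. 0 < s \<and> s \<le> t n \<longrightarrow> q s \<noteq> 0" using nz by blast
    show "\<forall>T q'. optimal_trajectory P lam \<mu> r T q' \<longrightarrow> t n \<le> T \<and>
       (\<forall>s\<in>{0..T - t n}. q' s = 0) \<and> (\<forall>s\<in>{0..t n}. q' (T - t n + s) = q s)"
      by (intro allI impI) (rule uniq)
    show "\<exists>n' t' J'. 1 \<le> n' \<and> t' 0 = 0 \<and> t' n' = t n \<and> (\<forall>i<n'. t' i < t' (Suc i)) \<and>
       (\<forall>i\<in>{1..<n'}. J' (Suc i) \<subset> J' i) \<and>
       (\<forall>i\<in>{1..n'}. affine_on_interval (t' (i - 1)) (t' i) q \<and>
          (\<forall>s\<in>{t' (i - 1)<..<t' i}. q s \<in> face (J' i))) \<and> inj_on J' {1..n'}"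
    proof (rule exI[of _ n], rule exI[of _ t], rule exI[of _ J], intro conjI allI ballI impI)
      show "1 \<le> n" "t 0 = 0" "t n = t n" by (fact \<open>n \<ge> 1\<close> D(1) refl)+
      show "t i < t (Suc i)" if "i < n" for i by (rule D(4)[OF that])
      show "J (Suc i) \<subset> J i" if "i \<in> {1..<n}" for i using that by (intro D(9)) auto
      show "affine_on_interval (t (i - 1)) (t i) q" if "i \<in> {1..n}" for i by (rule affine[OF that])
      show "q s \<in> face (J i)" if "i \<in> {1..n}" "s \<in> {t (i - 1)<..<t i}" for i s by (rule in_face[OF that])
      show "inj_on J {1..n}" by fact
    qed
  qed
qed

end

section \<open>Substochastic matrices\<close>

lemma det_eq_0_iff_ker:
  fixes A :: "real^'n^'n"
  shows "det A = 0 \<longleftrightarrow> (\<exists>x. x \<noteq> 0 \<and> A *v x = 0)"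
  using invertible_det_nz[of A] invertible_left_inverse[of A] matrix_left_invertible_ker[of A] by blast

lemma matrix_inv_right:
  assumes "invertible A"
  shows "A ** matrix_inv A = mat 1"
  using someI_ex[OF assms[unfolded invertible_def]] unfolding matrix_inv_def by (rule conjunct1)

text \<open>A fixed vector makes 1 an eigenvalue. Row sums bound every eigenvalue by 1 in modulus,
  so the set of moduli is bounded and its supremum really is an upper bound.\<close>

lemma substochastic_no_fixed_vector:
  fixes P :: "real^'n^'n"
  assumes sub: "substochastic P" and sr: "spectral_radius P < 1" and v: "P *v v = v"
  shows "v = 0"
proof (rule ccontr)
  assume "v \<noteq> 0"
  define w :: "complex^'n" where "w = (\<chi> i. complex_of_real (v $ i))"
  have "map_matrix complex_of_real P *v w = 1 *s w"
    unfolding vec_eq_iff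
  proof
    fix i
    have "(map_matrix complex_of_real P *v w) $ i = complex_of_real ((P *v v) $ i)"
      by (simp add: matrix_vector_mult_def w_def map_matrix_def)
    then show "(map_matrix complex_of_real P *v w) $ i = (1 *s w) $ i" unfolding v by (simp add: w_def)
  qed
  moreover have "w \<noteq> 0" using \<open>v \<noteq> 0\<close> by (auto simp: w_def vec_eq_iff)
  ultimately have 1: "1 \<in> complex_eigenvalues P" unfolding complex_eigenvalues_def by blast
  have "cmod c \<le> 1" if c: "c \<in> complex_eigenvalues P" for c
  proof -
    obtain u :: "complex^'n" where u: "u \<noteq> 0" "map_matrix complex_of_real P *v u = c *s u"
      using c unfolding complex_eigenvalues_def by blast
    define M where "M = Max (range (\<lambda>k. cmod (u $ k)))"
    have le: "cmod (u $ k) \<le> M" for k unfolding M_def by (intro Max_ge) auto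
    have "M \<in> range (\<lambda>k. cmod (u $ k))" unfolding M_def by (intro Max_in) auto
    then obtain k where k: "M = cmod (u $ k)" by blast
    obtain j where "u $ j \<noteq> 0" using u(1) by (auto simp: vec_eq_iff)
    then have "0 < M" using le[of j] by (meson less_le_trans zero_less_norm_iff)
    have "c * u $ k = (\<Sum>l\<in>UNIV. complex_of_real (P $ k $ l) * u $ l)"
      using arg_cong[OF u(2), of "\<lambda>x. x $ k"] by (simp add: matrix_vector_mult_def map_matrix_def)
    then have "cmod c * M = cmod (\<Sum>l\<in>UNIV. complex_of_real (P $ k $ l) * u $ l)"
      by (metis k norm_mult)
    also have "\<dots> \<le> (\<Sum>l\<in>UNIV. P $ k $ l * M)"
      using sub le by (intro sum_norm_le) (auto simp: norm_mult substochastic_def intro: mult_left_mono)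
    also have "\<dots> = (\<Sum>l\<in>UNIV. P $ k $ l) * M" by (simp add: sum_distrib_right)
    also have "\<dots> \<le> 1 * M" using sub \<open>0 < M\<close> by (intro mult_right_mono) (auto simp: substochastic_def)
    finally show ?thesis using \<open>0 < M\<close> by simp
  qed
  then have "bdd_above (cmod ` complex_eigenvalues P)" by (intro bdd_aboveI[of _ 1]) auto
  then have "cmod 1 \<le> spectral_radius P" unfolding spectral_radius_def by (intro cSUP_upper 1)
  then show False using sr by simp
qed

text \<open>Where \<open>u\<close> attains a negative minimum, \<open>P\<close> restricts to a stochastic matrix on a closed
  class; its left fixed vector contradicts the invertibility of \<open>I - P\<close>.\<close>

lemma substochastic_superharmonic_nonneg:
  fixes P :: "real^'n^'n"
  assumes sub: "substochastic P" and fixfree: "\<And>v. P *v v = v \<Longrightarrow> v = 0"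
    and super: "\<And>k. (P *v u) $ k \<le> u $ k"
  shows "0 \<le> u $ k"
proof (rule ccontr)
  assume neg: "\<not> 0 \<le> u $ k"
  have nn: "0 \<le> P $ k $ l" and row: "(\<Sum>l\<in>UNIV. P $ k $ l) \<le> 1" for k l
    using sub by (auto simp: substochastic_def)
  define c where "c = Min (range (\<lambda>k. u $ k))"
  have c_le: "c \<le> u $ l" for l unfolding c_def by (intro Min_le) auto
  have "c < 0" using c_le[of k] neg by linarith
  define A where "A = {k. u $ k = c}"
  have "c \<in> range (\<lambda>k. u $ k)" unfolding c_def by (intro Min_in) auto
  then obtain a where "a \<in> A" by (auto simp: A_def)
  \<comment> \<open>Superharmonicity at a negative minimum forces equality twice: the row sums to 1,
    and it charges only nodes where u is minimal.\<close>
  have closed: "(\<Sum>l\<in>UNIV. P $ k $ l) = 1" "\<And>l. l \<notin> A \<Longrightarrow> P $ k $ l = 0" if "k \<in> A" for k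
  proof -
    have "(P *v u) $ k = (\<Sum>l\<in>UNIV. P $ k $ l * (u $ l - c)) + c * (\<Sum>l\<in>UNIV. P $ k $ l)"
      by (simp add: matrix_vector_mult_def algebra_simps sum_subtractf sum_distrib_left)
    then have le: "(\<Sum>l\<in>UNIV. P $ k $ l * (u $ l - c)) + c * (\<Sum>l\<in>UNIV. P $ k $ l) \<le> c"
      using super[of k] that by (simp add: A_def)
    have ge: "0 \<le> P $ k $ l * (u $ l - c)" for l using nn c_le[of l] by simp
    have "0 \<le> (\<Sum>l\<in>UNIV. P $ k $ l * (u $ l - c))" using ge by (intro sum_nonneg) auto
    moreover have "c * 1 \<le> c * (\<Sum>l\<in>UNIV. P $ k $ l)"
      using \<open>c < 0\<close> row[of k] by (intro mult_left_mono_neg) auto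
    ultimately have "(\<Sum>l\<in>UNIV. P $ k $ l * (u $ l - c)) = 0" "c * (\<Sum>l\<in>UNIV. P $ k $ l) = c * 1"
      using le by linarith+
    then show "(\<Sum>l\<in>UNIV. P $ k $ l) = 1" "\<And>l. l \<notin> A \<Longrightarrow> P $ k $ l = 0"
      using \<open>c < 0\<close> ge by (auto simp: sum_nonneg_eq_0_iff A_def)
  qed
  \<comment> \<open>Q keeps the rows of P in A. It fixes the indicator of A, so its transpose fixes
    some w, which is supported in A and hence fixed by the transpose of P.\<close>
  define Q :: "real^'n^'n" where "Q = (\<chi> k l. if k \<in> A then P $ k $ l else 0)"
  define e :: "real^'n" where "e = (\<chi> k. if k \<in> A then 1 else 0)"
  have "Q *v e = e"
    unfolding vec_eq_iff
  proof
    fix k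
    show "(Q *v e) $ k = e $ k"
    proof (cases "k \<in> A")
      case True
      have "(Q *v e) $ k = (\<Sum>l\<in>UNIV. P $ k $ l)"
        unfolding matrix_vector_mult_def vec_lambda_beta
        by (rule sum.cong) (use True closed(2)[OF True] in \<open>auto simp: Q_def e_def\<close>)
      then show ?thesis using True closed(1)[OF True] by (simp add: e_def)
    qed (simp add: matrix_vector_mult_def Q_def e_def)
  qed
  then have "(mat 1 - Q) *v e = 0" by (simp add: matrix_vector_mult_diff_rdistrib)
  moreover have "e \<noteq> 0" using \<open>a \<in> A\<close> by (auto simp: e_def vec_eq_iff)
  ultimately have "det (mat 1 - Q) = 0" using det_eq_0_iff_ker by blast
  then have "det (transpose (mat 1 - Q)) = 0" by simp
  then obtain w where w: "w \<noteq> 0" "transpose (mat 1 - Q) *v w = 0"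
    using det_eq_0_iff_ker by blast
  have w_eq: "w $ l = (\<Sum>k\<in>UNIV. Q $ k $ l * w $ k)" for l
  proof -
    have "(transpose (mat 1 - Q) *v w) $ l = (\<Sum>k\<in>UNIV. (if k = l then 1 else 0) * w $ k - Q $ k $ l * w $ k)"
      by (simp add: matrix_vector_mult_def transpose_def mat_def algebra_simps)
    also have "\<dots> = w $ l - (\<Sum>k\<in>UNIV. Q $ k $ l * w $ k)"
      by (simp add: sum_subtractf if_distrib[of "\<lambda>x. x * _"] cong: if_cong)
    finally show ?thesis using w(2) by simp
  qed
  have w_off: "w $ l = 0" if "l \<notin> A" for l
    unfolding w_eq[of l] by (rule sum.neutral) (use closed(2) that in \<open>auto simp: Q_def\<close>)
  have "(transpose (mat 1 - P) *v w) $ l = 0" for l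
  proof -
    have "(transpose (mat 1 - P) *v w) $ l = (\<Sum>k\<in>UNIV. (if k = l then 1 else 0) * w $ k - P $ k $ l * w $ k)"
      by (simp add: matrix_vector_mult_def transpose_def mat_def algebra_simps)
    also have "\<dots> = w $ l - (\<Sum>k\<in>UNIV. P $ k $ l * w $ k)"
      by (simp add: sum_subtractf if_distrib[of "\<lambda>x. x * _"] cong: if_cong)
    also have "(\<Sum>k\<in>UNIV. P $ k $ l * w $ k) = (\<Sum>k\<in>UNIV. Q $ k $ l * w $ k)"
      by (rule sum.cong) (use w_off in \<open>auto simp: Q_def\<close>)
    finally show ?thesis using w_eq[of l] by simp
  qed
  then have "transpose (mat 1 - P) *v w = 0" by (simp add: vec_eq_iff)
  then have "det (transpose (mat 1 - P)) = 0" using w(1) det_eq_0_iff_ker by blast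
  then have "det (mat 1 - P) = 0" by simp
  then obtain v where v: "v \<noteq> 0" "(mat 1 - P) *v v = 0" using det_eq_0_iff_ker by blast
  then have "P *v v = v" by (simp add: matrix_vector_mult_diff_rdistrib)
  then show False using fixfree v(1) by blast
qed

lemma stable_network_exists:
  fixes P :: "real^'n^'n" and lam \<mu> \<nu> :: "real^'n"
  assumes sub: "substochastic P" and sr: "spectral_radius P < 1"
    and lam: "\<And>k. 0 < lam $ k"
    and \<nu>: "\<nu> = matrix_inv (mat 1 - transpose P) *v lam"
    and \<nu>_less: "\<And>k. \<nu> $ k < \<mu> $ k"
  shows "\<exists>m. stable_network P lam \<mu> \<nu> m"
proof -
  let ?A = "mat 1 - P"
  have fixfree: "v = 0" if "P *v v = v" for v
    by (rule substochastic_no_fixed_vector[OF sub sr that])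
  have A_apply: "(?A *v u) $ k = u $ k - (P *v u) $ k" for u k
    by (simp add: matrix_vector_mult_diff_rdistrib)
  have "det ?A \<noteq> 0"
  proof
    assume "det ?A = 0"
    then obtain v where "v \<noteq> 0" "?A *v v = 0" using det_eq_0_iff_ker by blast
    then show False using fixfree[of v] by (simp add: matrix_vector_mult_diff_rdistrib)
  qed
  then have inv: "invertible ?A" by (simp add: invertible_det_nz)
  then have invT: "invertible (transpose ?A)" by (simp add: invertible_det_nz)
  have solve: "?A *v (matrix_inv ?A *v b) = b" for b
    using matrix_inv_right[OF inv] by (simp add: matrix_vector_mul_assoc)
  have nonneg: "0 \<le> (matrix_inv ?A *v b) $ k" if "\<And>k. 0 \<le> b $ k" for b k
  proof (rule substochastic_superharmonic_nonneg[OF sub fixfree])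
    show "(P *v (matrix_inv ?A *v b)) $ j \<le> (matrix_inv ?A *v b) $ j" for j
      using A_apply[of "matrix_inv ?A *v b" j] that[of j] unfolding solve by simp
  qed
  \<comment> \<open>The solution of m - P m = 1: nonnegativity of m and P m then makes m positive
    with strict decrease under P.\<close>
  define m where "m = matrix_inv ?A *v (\<chi> i. 1)"
  have m_eq: "m $ k - (P *v m) $ k = 1" for k
    using A_apply[of m k] unfolding m_def solve by simp
  have m_nn: "0 \<le> m $ k" for k unfolding m_def by (rule nonneg) simp
  have Pm_nn: "0 \<le> (P *v m) $ k" for k
    unfolding matrix_vector_mult_def using sub m_nn by (auto simp: substochastic_def intro!: sum_nonneg)
  have T: "mat 1 - transpose P = transpose ?A"
    by (simp add: vec_eq_iff transpose_def mat_def)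
  have \<nu>_eq: "transpose ?A *v \<nu> = lam"
    unfolding \<nu> T using matrix_inv_right[OF invT] by (simp add: matrix_vector_mul_assoc)
  have traffic: "\<nu> $ l = lam $ l + (\<Sum>k\<in>UNIV. \<nu> $ k * P $ k $ l)" for l
  proof -
    have "lam $ l = \<nu> $ l - (transpose P *v \<nu>) $ l"
      unfolding \<nu>_eq[symmetric] T[symmetric] by (simp add: matrix_vector_mult_diff_rdistrib)
    then show ?thesis by (simp add: matrix_vector_mult_def transpose_def mult.commute)
  qed
  have \<nu>_nn: "0 \<le> \<nu> $ l" for l
  proof -
    \<comment> \<open>Duality: \<nu>_l is lam paired with the l-th column of the inverse of I - P,
      whose entries are nonnegative.\<close>
    have "\<nu> $ l = \<nu> \<bullet> (?A *v (matrix_inv ?A *v axis l 1))" unfolding solve by (simp add: inner_axis)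
    also have "\<dots> = lam \<bullet> (matrix_inv ?A *v axis l 1)"
      unfolding \<nu>_eq[symmetric] transpose_matrix_vector by (rule dot_lmul_matrix[symmetric])
    also have "\<dots> \<ge> 0"
      unfolding inner_vec_def using lam nonneg[of "axis l 1"]
      by (intro sum_nonneg) (auto simp: axis_def less_imp_le)
    finally show ?thesis .
  qed
  have "0 < \<nu> $ l" for l
    unfolding traffic[of l] using lam[of l] \<nu>_nn sub
    by (intro add_pos_nonneg sum_nonneg) (auto simp: substochastic_def)
  then have "stable_network P lam \<mu> \<nu> m"
  proof unfold_locales
    fix k l
    show "0 \<le> P $ k $ l" "(\<Sum>l\<in>UNIV. P $ k $ l) \<le> 1" using sub by (simp_all add: substochastic_def)
    show "0 < m $ k" "(P *v m) $ k < m $ k" using m_eq[of k] Pm_nn[of k] by linarith+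
    show "\<nu> $ l = lam $ l + (\<Sum>k\<in>UNIV. \<nu> $ k * P $ k $ l)" by (rule traffic)
  qed (use lam \<nu>_less in auto)
  then show ?thesis by blast
qed

theorem mainTheorem3:
  fixes P :: "real^'n^'n" and lam \<mu> \<nu> \<rho> r :: "real^'n"
  assumes "substochastic P" and "spectral_radius P < 1"
    and "\<forall>k. lam $ k > 0" and "\<forall>k. \<mu> $ k > 0"
    and "\<nu> = matrix_inv (mat 1 - transpose P) *v lam"
    and "\<rho> = (\<chi> k. \<nu> $ k / \<mu> $ k)"
    and "\<forall>k. \<rho> $ k < 1"
    and "\<forall>k. 0 \<le> r $ k" and "r \<noteq> 0"
  shows "\<exists>Tstar qstar.
    optimal_trajectory P lam \<mu> r Tstar qstar \<and>
    (\<forall>s. 0 < s \<and> s \<le> Tstar \<longrightarrow> qstar s \<noteq> 0) \<and>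
    (\<forall>T q. optimal_trajectory P lam \<mu> r T q \<longrightarrow>
       Tstar \<le> T \<and>
       (\<forall>s\<in>{0..T - Tstar}. q s = 0) \<and>
       (\<forall>s\<in>{0..Tstar}. q (T - Tstar + s) = qstar s)) \<and>
    (\<exists>(n::nat) (t :: nat \<Rightarrow> real) (J :: nat \<Rightarrow> 'n set).
       1 \<le> n \<and> t 0 = 0 \<and> t n = Tstar \<and>
       (\<forall>i<n. t i < t (Suc i)) \<and>
       (\<forall>i\<in>{1..<n}. J (Suc i) \<subset> J i) \<and>
       (\<forall>i\<in>{1..n}.
          affine_on_interval (t (i - 1)) (t i) qstar \<and>
          (\<forall>s\<in>{t (i - 1)<..<t i}. qstar s \<in> face (J i))) \<and>
       inj_on J {1..n})"
proof -
  have "\<nu> $ k < \<mu> $ k" for k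
    using assms(4,6,7) by (simp add: divide_less_eq_1_pos)
  then obtain m where "stable_network P lam \<mu> \<nu> m"
    using stable_network_exists[OF assms(1,2) _ assms(5)] assms(3) by blast
  then interpret stable_network P lam \<mu> \<nu> m .
  show ?thesis by (rule optimal_trajectory_structure) (use assms(8,9) in auto)
qed

end
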